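(* Let $l>0$. Let $T$ and $\tilde T$ be two equilateral metric caterpillar trees with all edges of length $l$, each rooted at an end vertex of its stalk, and with real potentials from $L_2(0,l)$ on their edges (the potentials on $T$ and on $\tilde T$ may be different). If the spectrum of the Neumann problem on $T$ coincides with the spectrum of the Neumann problem on $\tilde T$, and the spectrum of the Dirichlet problem on $T$ coincides with the spectrum of the Dirichlet problem on $\tilde T$ (eigenvalues counted with multiplicities), then $T$ and $\tilde T$ have the same shape, i.e. their underlying combinatorial trees are isomorphic. In other words, the spectra of the Neumann and Dirichlet problems uniquely determine the shape of a caterpillar tree.
   Context: A (combinatorial) caterpillar tree is a finite tree in which all vertices are within distance 1 of a central path, called the stalk. The stalk $v_0\to v_1\to\dots\to v_r$ is taken to be a longest path, so its end vertices $v_0,v_r$ have degree 1. The tree is rooted at the end vertex $v_0$ of the stalk, and all edges are directed away from the root. Let $T$ be such a tree with $p\ge 2$ vertices and $g=p-1$ edges $e_1,\dots,e_g$, where $e_1$ is the edge incident with $v_0$. Each edge $e_j$ is identified with the interval $[0,l]$, with the coordinate $x$ increasing in the direction of the edge (away from the root). On the edges consider the Sturm-Liouville equations $$-y_j''+q_j(x)y_j=\lambda y_j,\qquad j=1,\dots,g,$$ where $q_j\in L_2(0,l)$ are real. Conditions at vertices other than the root: if $e_j$ ends at a pendant (degree 1) vertex different from the root, then $y_j'(l)=0$; at every interior vertex $v$, with incoming edge $e_j$ and outgoing edges $e_k$, one imposes continuity $y_j(l)=y_k(0)$ for all outgoing $e_k$ and Kirchhoff's condition $y_j'(l)=\sum_k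 y_k'(0)$ (sum over all edges $e_k$ outgoing from $v$). The Neumann problem consists of these equations and conditions together with $y_1'(0)=0$ at the root. The Dirichlet problem consists of the same equations and conditions together with $y_1(0)=0$ at the root. *)

theory Defs
  imports
    "HOL-Analysis.Analysis"
    "HOL-Library.Function_Algebras"
    "Graph_Theory.Digraph_Component"
    "Graph_Theory.Digraph_Isomorphism"
    "Graph_Theory.Pair_Digraph"
begin

section \<open>Caterpillar trees\<close>

text \<open>
  A finite simple graph is a \<^locale>\<open>pair_graph\<close>: a finite loop-free symmetric digraph whose arcs
  are pairs of vertices, every undirected edge being represented by its two orientations. Such a
  graph always has the closed walks \<open>u, v, u\<close>, which count as cycles for the library's
  \<open>forest\<close>; so a tree is defined here by excluding only the cycles of length at least 3.
\<close>

definition undirected_tree :: "'a pair_pre_digraph \<Rightarrow> bool" where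
  "undirected_tree G \<longleftrightarrow>
     pair_graph G \<and> Digraph_Component.connected (with_proj G) \<and>
     \<not> (\<exists>p. pre_digraph.cycle (with_proj G) p \<and> 3 \<le> length p)"

abbreviation simple_path :: "'a pair_pre_digraph \<Rightarrow> 'a \<Rightarrow> ('a \<times> 'a) list \<Rightarrow> 'a \<Rightarrow> bool" where
  "simple_path G \<equiv> pre_digraph.apath (with_proj G)"

definition within_distance_1 :: "'a pair_pre_digraph \<Rightarrow> 'a \<Rightarrow> ('a \<times> 'a) list \<Rightarrow> bool" where
  "within_distance_1 G u p \<longleftrightarrow>
     (\<forall>v\<in>pverts G. \<exists>w\<in>set (pawalk_verts u p). v = w \<or> (w, v) \<in> parcs G)"

definition caterpillar :: "'a pair_pre_digraph \<Rightarrow> bool" where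
  "caterpillar G \<longleftrightarrow>
     undirected_tree G \<and> (\<exists>u p w. simple_path G u p w \<and> within_distance_1 G u p)"

definition stalk :: "'a pair_pre_digraph \<Rightarrow> 'a \<Rightarrow> ('a \<times> 'a) list \<Rightarrow> 'a \<Rightarrow> bool" where
  "stalk G u p w \<longleftrightarrow>
     simple_path G u p w \<and> within_distance_1 G u p \<and>
     (\<forall>u' p' w'. simple_path G u' p' w' \<longrightarrow> length p' \<le> length p)"

text \<open>The reversal of a stalk is a stalk, so the root may be either of its end vertices.\<close>

definition rooted_caterpillar :: "'a pair_pre_digraph \<Rightarrow> 'a \<Rightarrow> bool" where
  "rooted_caterpillar G r \<longleftrightarrow>
     caterpillar G \<and> 2 \<le> card (pverts G) \<and> (\<exists>p w. stalk G r p w)"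

text \<open>
  The edges directed away from the root: of the two orientations of an undirected edge, exactly
  one is the last step of a path starting at the root.
\<close>

definition tree_edges :: "'a pair_pre_digraph \<Rightarrow> 'a \<Rightarrow> ('a \<times> 'a) set" where
  "tree_edges G r = {e \<in> parcs G. \<exists>p. simple_path G r (p @ [e]) (snd e)}"


section \<open>Sturm-Liouville problems\<close>

definition L2 :: "real \<Rightarrow> (real \<Rightarrow> real) \<Rightarrow> bool" where
  "L2 l f \<longleftrightarrow>
     set_borel_measurable lebesgue {0<..<l} f \<and>
     set_integrable lebesgue {0<..<l} (\<lambda>x. (f x)\<^sup>2)"

text \<open>
  \<open>f\<close> is absolutely continuous on \<open>[0,l]\<close> with derivative \<open>g\<close> almost everywhere.
\<close>

definition has_ac_derivative :: "real \<Rightarrow> (real \<Rightarrow> complex) \<Rightarrow> (real \<Rightarrow> complex) \<Rightarrow> bool" where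
  "has_ac_derivative l f g \<longleftrightarrow>
     g absolutely_integrable_on {0..l} \<and>
     (\<forall>x\<in>{0..l}. (g has_integral (f x - f 0)) {0..x})"

text \<open>
  Here \<open>y'\<close> is itself absolutely continuous, hence it is the classical derivative of \<open>y\<close> on
  \<open>[0,l]\<close> (one-sided at the end points), and its values at \<open>0\<close> and \<open>l\<close> make sense.
\<close>

definition sturm_liouville_solution ::
    "real \<Rightarrow> (real \<Rightarrow> real) \<Rightarrow> complex \<Rightarrow> (real \<Rightarrow> complex) \<Rightarrow> (real \<Rightarrow> complex) \<Rightarrow> bool" where
  "sturm_liouville_solution l q z y y' \<longleftrightarrow>
     has_ac_derivative l y y' \<and>
     (\<exists>y''. has_ac_derivative l y' y'' \<and>
        (AE x in lebesgue. x \<in> {0<..<l} \<longrightarrow> - y'' x + complex_of_real (q x) * y x = z * y x))"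

definition vertex_conditions ::
    "'a pair_pre_digraph \<Rightarrow> 'a \<Rightarrow> real \<Rightarrow>
      ('a \<times> 'a \<Rightarrow> real \<Rightarrow> complex) \<Rightarrow> ('a \<times> 'a \<Rightarrow> real \<Rightarrow> complex) \<Rightarrow> bool" where
  "vertex_conditions G r l y y' \<longleftrightarrow>
     (\<forall>j\<in>tree_edges G r.
        if out_degree (with_proj G) (snd j) = 1
        then y' j l = 0
        else (\<forall>k\<in>tree_edges G r. fst k = snd j \<longrightarrow> y j l = y k 0) \<and>
             y' j l = (\<Sum>k | k \<in> tree_edges G r \<and> fst k = snd j. y' k 0))"

text \<open>
  A family of functions on the edges is stored as a total function; requiring it to vanish outside
  the tree makes the representation of a family unique.
\<close>

definition tree_solution ::
    "'a pair_pre_digraph \<Rightarrow> 'a \<Rightarrow> real \<Rightarrow> ('a \<times> 'a \<Rightarrow> real \<Rightarrow> real) \<Rightarrow> complex \<Rightarrow>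
      ('a \<times> 'a \<Rightarrow> real \<Rightarrow> complex) \<Rightarrow> ('a \<times> 'a \<Rightarrow> real \<Rightarrow> complex) \<Rightarrow> bool" where
  "tree_solution G r l q z y y' \<longleftrightarrow>
     (\<forall>j\<in>tree_edges G r. sturm_liouville_solution l (q j) z (y j) (y' j)) \<and>
     vertex_conditions G r l y y' \<and>
     (\<forall>j x. j \<notin> tree_edges G r \<or> x \<notin> {0..l} \<longrightarrow> y j x = 0)"

text \<open>The root of a rooted caterpillar has degree 1, so exactly one edge starts there.\<close>

definition neumann_eigenspace ::
    "'a pair_pre_digraph \<Rightarrow> 'a \<Rightarrow> real \<Rightarrow> ('a \<times> 'a \<Rightarrow> real \<Rightarrow> real) \<Rightarrow> complex \<Rightarrow>
      ('a \<times> 'a \<Rightarrow> real \<Rightarrow> complex) set" where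
  "neumann_eigenspace G r l q z =
     {y. \<exists>y'. tree_solution G r l q z y y' \<and> (\<forall>j\<in>tree_edges G r. fst j = r \<longrightarrow> y' j 0 = 0)}"

definition dirichlet_eigenspace ::
    "'a pair_pre_digraph \<Rightarrow> 'a \<Rightarrow> real \<Rightarrow> ('a \<times> 'a \<Rightarrow> real \<Rightarrow> real) \<Rightarrow> complex \<Rightarrow>
      ('a \<times> 'a \<Rightarrow> real \<Rightarrow> complex) set" where
  "dirichlet_eigenspace G r l q z =
     {y. \<exists>y'. tree_solution G r l q z y y' \<and> (\<forall>j\<in>tree_edges G r. fst j = r \<longrightarrow> y j 0 = 0)}"

definition edge_scale ::
    "complex \<Rightarrow> ('e \<Rightarrow> real \<Rightarrow> complex) \<Rightarrow> ('e \<Rightarrow> real \<Rightarrow> complex)" where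
  "edge_scale c y = (\<lambda>j x. c * y j x)"

lemma vector_space_edge_scale: "vector_space edge_scale"
  by unfold_locales (auto simp: edge_scale_def fun_eq_iff algebra_simps)

text \<open>
  A spectrum is the function assigning to each complex number its multiplicity as an eigenvalue,
  i.e. the complex dimension of its eigenspace (at most twice the number of edges); the eigenvalues
  are the points where it is nonzero. Both problems are self-adjoint, so there is no difference
  between geometric and algebraic multiplicity.
\<close>

definition neumann_spectrum ::
    "'a pair_pre_digraph \<Rightarrow> 'a \<Rightarrow> real \<Rightarrow> ('a \<times> 'a \<Rightarrow> real \<Rightarrow> real) \<Rightarrow> complex \<Rightarrow> nat" where
  "neumann_spectrum G r l q z = vector_space.dim edge_scale (neumann_eigenspace G r l q z)"

definition dirichlet_spectrum ::
    "'a pair_pre_digraph \<Rightarrow> 'a \<Rightarrow> real \<Rightarrow> ('a \<times> 'a \<Rightarrow> real \<Rightarrow> real) \<Rightarrow> complex \<Rightarrow> nat" where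
  "dirichlet_spectrum G r l q z = vector_space.dim edge_scale (dirichlet_eigenspace G r l q z)"

end

theory Submission
  imports
    Defs
    "HOL-Complex_Analysis.Complex_Analysis"
    "HOL-Computational_Algebra.Fundamental_Theorem_Algebra"
begin

text \<open>
  Each of the two spectra is the zero set, with multiplicities, of an entire characteristic function of
  \<open>\<lambda>\<close>. That geometric multiplicities are orders of zeros is proved along the recursion that builds the
  caterpillar edge by edge from the far end of the stalk; it rests on the Nevanlinna property
  (positivity of a Wronskian in \<open>\<lambda>\<close>) of the pair of characteristic functions, which makes their
  reduced zeros simple.

  For \<open>\<lambda> = s\<^sup>2\<close> with \<open>s\<close> going to infinity in a horizontal strip, the characteristic functions
  approach \<open>A(cos sl)\<close> and \<open>s sin(sl) R(cos sl)\<close>, where the polynomials \<open>A, R\<close> depend on the shape only.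
  By Rouche's theorem in discs around \<open>s + 2\<pi>k/l\<close> the spectra therefore determine the zeros of
  these periodic functions, hence \<open>A\<close> and \<open>R\<close>. Finally the shape is read off from
  \<open>X R(X) / A(X)\<close>, whose limit at infinity is the number of children of the current vertex; both steps of the
  recursion for \<open>A, R\<close> can be undone.
\<close>

section \<open>Absolutely continuous functions\<close>

text \<open>The delicate point is multiplicity. When a pendant edge and the rest of the tree at its
  vertex both admit solutions vanishing there, gluing them costs no condition and a solution with
  zero boundary data appears. It has to be matched by a common zero of \<open>charD\<close> and
  \<open>charN\<close>. After cancelling common factors, the sign of the Wronskian is what makes the
  induction close: the contributions of the two glued parts have the same sign and cannot cancel.

  No zero of a characteristic function is ever located. In each far disc the two trees produce the
  same weighted sum over zeros, and the orders of the two limit functions are compared through this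
  sum. Horizontal strips are used because cosine and sine are bounded there, so that errors of size
  1/|s| survive the products in the recursion.

  The stalk being a longest path means that its end vertices carry no leaves, so the list describing
  the shape begins and ends with a stalk edge. This normal form is essential: a final pendant edge
  would give the same polynomials as a final stalk edge.\<close>

lemma has_ac_derivative_integrable:
  assumes "has_ac_derivative l f g" "0 \<le> a" "b \<le> l"
  shows "g absolutely_integrable_on {a..b}"
  using assms set_integrable_subset[of lebesgue "{0..l}" g "{a..b}"]
  by (auto simp: has_ac_derivative_def)

lemma has_ac_derivative_has_integral:
  assumes ac: "has_ac_derivative l f g" and "0 \<le> a" "a \<le> b" "b \<le> l"
  shows "(g has_integral (f b - f a)) {a..b}"
proof -
  have A: "(g has_integral (f x - f 0)) {0..x}" if "x \<in> {0..l}" for x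
    using ac that by (auto simp: has_ac_derivative_def)
  have "g integrable_on {0..b}" using A[of b] assms by auto
  hence "integral {0..a} g + integral {a..b} g = integral {0..b} g"
    using assms by (intro Henstock_Kurzweil_Integration.integral_combine) auto
  moreover have "g integrable_on {a..b}"
    using has_ac_derivative_integrable[OF ac, of a b] assms set_lebesgue_integral_eq_integral(1) by blast
  ultimately show ?thesis
    using A[of a] A[of b] assms integral_unique
    by (smt (verit, best) add_diff_cancel_left' atLeastAtMost_iff diff_add_cancel diff_diff_eq2 has_integral_integrable_integral)
qed

lemma has_ac_derivative_integral:
  assumes "has_ac_derivative l f g" "x \<in> {0..l}"
  shows "f x = f 0 + integral {0..x} g"
  using assms by (auto simp: has_ac_derivative_def dest!: bspec integral_unique)

lemma has_ac_derivative_continuous: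
  assumes "has_ac_derivative l f g"
  shows "continuous_on {0..l} f"
proof -
  have "g integrable_on {0..l}"
    using assms set_lebesgue_integral_eq_integral(1) by (auto simp: has_ac_derivative_def)
  hence "continuous_on {0..l} (\<lambda>x. f 0 + integral {0..x} g)"
    by (intro continuous_intros indefinite_integral_continuous_1)
  thus ?thesis
    by (rule iffD1[OF continuous_on_cong, rotated -1]) (simp_all add: has_ac_derivative_integral[OF assms, symmetric])
qed

lemma has_ac_derivativeI:
  assumes "g absolutely_integrable_on {0..l}"
    and "\<And>x. x \<in> {0..l} \<Longrightarrow> f x = c + integral {0..x} g" and "0 \<le> l"
  shows "has_ac_derivative l f g"
proof -
  have "(g has_integral (f x - f 0)) {0..x}" if "x \<in> {0..l}" for x
  proof -
    have "g integrable_on {0..x}"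
      using set_integrable_subset[OF assms(1), of "{0..x}"] that set_lebesgue_integral_eq_integral(1)
      by fastforce
    moreover have "f 0 = c" using assms(2)[of 0] assms(3) by simp
    ultimately show ?thesis using assms(2)[OF that] by (simp add: integrable_integral)
  qed
  thus ?thesis using assms(1) by (simp add: has_ac_derivative_def)
qed

lemma absolutely_integrable_continuous_mult:
  fixes f g :: "real \<Rightarrow> complex"
  assumes "continuous_on {a..b} f" "g absolutely_integrable_on {a..b}"
  shows "(\<lambda>x. f x * g x) absolutely_integrable_on {a..b}"
proof -
  have "bilinear ((*) :: complex \<Rightarrow> complex \<Rightarrow> complex)"
    using bilinear_conv_bounded_bilinear bounded_bilinear_mult by blast
  moreover have "f \<in> borel_measurable (lebesgue_on {a..b})"
    using assms(1) by (intro continuous_imp_measurable_on_sets_lebesgue) auto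
  moreover have "bounded (f ` {a..b})"
    using assms(1) compact_continuous_image compact_imp_bounded by blast
  ultimately show ?thesis
    using absolutely_integrable_bounded_measurable_product[of "(*)" f "{a..b}" g] assms(2) by auto
qed

section \<open>The product rule for absolutely continuous functions\<close>

lemma has_ac_derivative_mult_aux:
  assumes f: "has_ac_derivative l f f'" and g: "has_ac_derivative l g g'"
    and ab: "0 \<le> a" "a \<le> b" "b \<le> l"
    and osc: "\<And>x y. x \<in> {a..b} \<Longrightarrow> y \<in> {a..b} \<Longrightarrow> norm (f x - f y) \<le> e \<and> norm (g x - g y) \<le> e"
  shows "norm (f b * g b - f a * g a - integral {a..b} (\<lambda>t. f' t * g t + f t * g' t))
          \<le> e * integral {a..b} (\<lambda>t. norm (f' t) + norm (g' t))"
proof -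
  have cf: "continuous_on {a..b} f" "continuous_on {a..b} g"
    using has_ac_derivative_continuous[OF f] has_ac_derivative_continuous[OF g] ab
    by (auto intro: continuous_on_subset)
  note I = has_ac_derivative_integrable[OF f, of a b] has_ac_derivative_integrable[OF g, of a b]
  have i: "(\<lambda>t. f' t * (g b - g t)) absolutely_integrable_on {a..b}"
       "(\<lambda>t. (f a - f t) * g' t) absolutely_integrable_on {a..b}"
       "(\<lambda>t. g t * f' t) absolutely_integrable_on {a..b}"
       "(\<lambda>t. f t * g' t) absolutely_integrable_on {a..b}"
    subgoal using absolutely_integrable_continuous_mult[of a b "\<lambda>t. g b - g t" f'] I ab cf
      by (simp add: mult.commute continuous_intros)
    subgoal using I ab cf by (intro absolutely_integrable_continuous_mult continuous_intros) auto
    subgoal using I ab cf by (intro absolutely_integrable_continuous_mult continuous_intros) auto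
    subgoal using I ab cf by (intro absolutely_integrable_continuous_mult continuous_intros) auto
    done
  have d1: "((\<lambda>t. f' t * g b + f a * g' t) has_integral ((f b - f a) * g b + f a * (g b - g a))) {a..b}"
    using has_ac_derivative_has_integral[OF f ab] has_ac_derivative_has_integral[OF g ab]
    by (intro has_integral_add has_integral_mult_left has_integral_mult_right)
  have d2: "((\<lambda>t. f' t * g t + f t * g' t) has_integral integral {a..b} (\<lambda>t. f' t * g t + f t * g' t)) {a..b}"
    using i(3,4) set_lebesgue_integral_eq_integral(1)
    by (intro integrable_integral integrable_add) (auto simp: mult.commute)
  have e1: "(\<lambda>t. f' t * (g b - g t) + (f a - f t) * g' t) = (\<lambda>t. (f' t * g b + f a * g' t) - (f' t * g t + f t * g' t))"
    by (simp add: algebra_simps)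
  have e2: "f b * g b - f a * g a = (f b - f a) * g b + f a * (g b - g a)"
    by (simp add: algebra_simps)
  have J: "((\<lambda>t. f' t * (g b - g t) + (f a - f t) * g' t) has_integral
      (f b * g b - f a * g a - integral {a..b} (\<lambda>t. f' t * g t + f t * g' t))) {a..b}"
    unfolding e1 e2 by (rule has_integral_diff[OF d1 d2])
  have "norm (integral {a..b} (\<lambda>t. f' t * (g b - g t) + (f a - f t) * g' t))
      \<le> integral {a..b} (\<lambda>t. e * (norm (f' t) + norm (g' t)))"
  proof (rule integral_norm_bound_integral)
    show "(\<lambda>t. f' t * (g b - g t) + (f a - f t) * g' t) integrable_on {a..b}" using J by auto
    show "(\<lambda>t. e * (norm (f' t) + norm (g' t))) integrable_on {a..b}"
      using I ab by (intro integrable_on_mult_right integrable_add)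
         (auto simp: absolutely_integrable_on_def)
    show "norm (f' t * (g b - g t) + (f a - f t) * g' t) \<le> e * (norm (f' t) + norm (g' t))"
      if "t \<in> {a..b}" for t
    proof -
      have "norm (f' t * (g b - g t)) \<le> norm (f' t) * e"
        unfolding norm_mult using osc[of b t] that ab by (intro mult_left_mono) auto
      moreover have "norm ((f a - f t) * g' t) \<le> e * norm (g' t)"
        unfolding norm_mult using osc[of a t] that ab by (intro mult_right_mono) auto
      ultimately show ?thesis by (smt (verit) norm_triangle_ineq distrib_left mult.commute)
    qed
  qed
  thus ?thesis using integral_unique[OF J] by simp
qed

text \<open>The local estimate is summed over a partition so fine that both functions oscillate by
  at most \<open>e\<close> on each piece. The errors add up to \<open>e\<close> times a fixed
  integral, and \<open>e\<close> is arbitrary. This avoids almost-everywhere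
  differentiation.\<close>

lemma has_ac_derivative_mult:
  assumes f: "has_ac_derivative l f f'" and g: "has_ac_derivative l g g'" and l: "0 \<le> l"
  shows "has_ac_derivative l (\<lambda>t. f t * g t) (\<lambda>t. f' t * g t + f t * g' t)"
proof (rule has_ac_derivativeI[OF _ _ l])
  let ?h = "\<lambda>t. f' t * g t + f t * g' t"
  let ?k = "\<lambda>t. norm (f' t) + norm (g' t)"
  have cf: "continuous_on {0..l} f" "continuous_on {0..l} g"
    using has_ac_derivative_continuous[OF f] has_ac_derivative_continuous[OF g] by auto
  note I = has_ac_derivative_integrable[OF f, of 0 l] has_ac_derivative_integrable[OF g, of 0 l]
  show hi: "?h absolutely_integrable_on {0..l}"
    using absolutely_integrable_continuous_mult[of 0 l g f']
      absolutely_integrable_continuous_mult[of 0 l f g'] I cf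
    by (intro set_integral_add) (auto simp: mult.commute)
  have ki: "?k integrable_on {0..l}"
    using I by (intro integrable_add) (auto simp: absolutely_integrable_on_def)
  fix x assume x: "x \<in> {0..l}"
  define D where "D t = f t * g t - f 0 * g 0 - integral {0..t} ?h" for t
  have hs: "?h integrable_on {a..b}" "?k integrable_on {a..b}" if "0 \<le> a" "b \<le> l" for a b
    using set_lebesgue_integral_eq_integral(1)[OF hi] ki that
    by (auto intro: integrable_subinterval_real)
  have "norm (D x) \<le> e * integral {0..x} ?k" if e: "e > 0" for e
  proof -
    have "uniformly_continuous_on {0..l} f" "uniformly_continuous_on {0..l} g"
      using cf compact_uniformly_continuous by blast+
    then obtain d1 d2 where d: "d1 > 0" "d2 > 0"
      "\<forall>u\<in>{0..l}. \<forall>v\<in>{0..l}. dist v u < d1 \<longrightarrow> dist (f v) (f u) < e"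
      "\<forall>u\<in>{0..l}. \<forall>v\<in>{0..l}. dist v u < d2 \<longrightarrow> dist (g v) (g u) < e"
      using e unfolding uniformly_continuous_on_def by (elim allE[of _ e]) blast
    obtain n :: nat where n: "x / min d1 d2 < real n" using reals_Archimedean2 by blast
    have n0: "n > 0" using n x d by (cases n) (auto simp: divide_less_0_iff)
    have step: "x / real n < min d1 d2"
    proof -
      have "0 < min d1 d2" using d by simp
      thus ?thesis using n n0 by (simp add: pos_divide_less_eq mult.commute del: min_less_iff_conj)
    qed
    define t where "t i = x * real i / real n" for i
    have tl: "0 \<le> t i" "t i \<le> t (Suc i)" for i
      using x by (auto simp: t_def intro!: divide_right_mono mult_left_mono)
    have tx: "t i \<le> x" if "i \<le> n" for i
      using x n0 that by (auto simp: t_def field_simps intro!: mult_left_mono)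
    have "norm (D (t i)) \<le> e * integral {0..t i} ?k" if "i \<le> n" for i
      using that
    proof (induction i)
      case 0 thus ?case by (simp add: t_def D_def)
    next
      case (Suc i)
      have b: "t (Suc i) \<le> l" using tx[of "Suc i"] Suc x by auto
      have sm: "t (Suc i) - t i < min d1 d2"
        using step n0 by (simp add: t_def field_simps)
      have "norm (f (t (Suc i)) * g (t (Suc i)) - f (t i) * g (t i) - integral {t i..t (Suc i)} ?h)
            \<le> e * integral {t i..t (Suc i)} ?k"
      proof (rule has_ac_derivative_mult_aux[OF f g tl b])
        fix u v assume uv: "u \<in> {t i..t (Suc i)}" "v \<in> {t i..t (Suc i)}"
        hence "dist u v < min d1 d2" using sm by (auto simp: dist_real_def)
        moreover have "u \<in> {0..l}" "v \<in> {0..l}" using uv tl(1)[of i] b by auto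
        ultimately have "dist (f u) (f v) < e" "dist (g u) (g v) < e" using d by auto
        thus "norm (f u - f v) \<le> e \<and> norm (g u - g v) \<le> e" by (simp add: dist_norm)
      qed
      moreover have "integral {0..t i} ?h + integral {t i..t (Suc i)} ?h = integral {0..t (Suc i)} ?h"
         "integral {0..t i} ?k + integral {t i..t (Suc i)} ?k = integral {0..t (Suc i)} ?k"
        using tl[of i] b hs by (auto intro!: Henstock_Kurzweil_Integration.integral_combine)
      ultimately have "D (t (Suc i)) = D (t i) + (f (t (Suc i)) * g (t (Suc i)) - f (t i) * g (t i) - integral {t i..t (Suc i)} ?h)"
        and "e * integral {0..t (Suc i)} ?k = e * integral {0..t i} ?k + e * integral {t i..t (Suc i)} ?k"
        by (simp_all add: D_def algebra_simps flip: distrib_left)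
      thus ?case using Suc \<open>norm (f (t (Suc i)) * _ - _ - _) \<le> _\<close> 
        by (smt (verit) Suc_leD norm_triangle_ineq)
    qed
    from this[of n] show ?thesis using n0 by (simp add: t_def)
  qed
  hence N: "norm (D x) \<le> e * (integral {0..x} ?k)" if "e > 0" for e using that by blast
  have "D x = 0"
  proof (rule ccontr)
    assume "D x \<noteq> 0"
    define K where "K = integral {0..x} ?k"
    have "K > 0" using N[of 1] \<open>D x \<noteq> 0\<close> by (simp add: K_def) (smt (verit) zero_less_norm_iff)
    \<comment> \<open>For this \<open>e\<close> the bound says that \<open>norm (D x)\<close> is at
      most half of itself.\<close>
    from N[of "norm (D x) / (2 * K)"] show False using \<open>D x \<noteq> 0\<close> \<open>K > 0\<close> 
      by (simp add: K_def[symmetric] divide_simps)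
  qed
  thus "f x * g x = f 0 * g 0 + integral {0..x} ?h" by (simp add: D_def algebra_simps)
qed

lemma has_ac_derivative_add:
  assumes "has_ac_derivative l f f'" "has_ac_derivative l g g'"
  shows "has_ac_derivative l (\<lambda>t. f t + g t) (\<lambda>t. f' t + g' t)"
  unfolding has_ac_derivative_def
proof (intro conjI ballI)
  show "(\<lambda>t. f' t + g' t) absolutely_integrable_on {0..l}"
    using assms by (intro set_integral_add) (auto simp: has_ac_derivative_def)
  fix x assume "x \<in> {0..l}"
  hence "((\<lambda>t. f' t + g' t) has_integral ((f x - f 0) + (g x - g 0))) {0..x}"
    using assms by (intro has_integral_add) (auto simp: has_ac_derivative_def)
  thus "((\<lambda>t. f' t + g' t) has_integral (f x + g x - (f 0 + g 0))) {0..x}"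
    by (simp add: algebra_simps)
qed

lemma has_ac_derivative_cmult:
  assumes "has_ac_derivative l f f'"
  shows "has_ac_derivative l (\<lambda>t. c * f t) (\<lambda>t. c * f' t)"
  using assms unfolding has_ac_derivative_def
  by (auto simp: right_diff_distrib[symmetric] intro!: has_integral_mult_right)

lemma has_ac_derivative_cnj:
  assumes "has_ac_derivative l f f'"
  shows "has_ac_derivative l (\<lambda>t. cnj (f t)) (\<lambda>t. cnj (f' t))"
  unfolding has_ac_derivative_def
proof (intro conjI ballI)
  show "(\<lambda>t. cnj (f' t)) absolutely_integrable_on {0..l}"
    using assms absolutely_integrable_linear[OF _ bounded_linear_cnj, of "{0..l}" f']
    by (auto simp: has_ac_derivative_def o_def)
  fix x assume "x \<in> {0..l}"
  thus "((\<lambda>t. cnj (f' t)) has_integral (cnj (f x) - cnj (f 0))) {0..x}"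
    using assms has_integral_linear[OF _ bounded_linear_cnj, of f' "f x - f 0" "{0..x}"]
    by (auto simp: has_ac_derivative_def o_def)
qed

section \<open>Schroedinger equations with integrable potentials\<close>

lemma has_ac_derivative_diff:
  assumes "has_ac_derivative l f f'" "has_ac_derivative l g g'"
  shows "has_ac_derivative l (\<lambda>t. f t - g t) (\<lambda>t. f' t - g' t)"
  using has_ac_derivative_add[OF assms(1) has_ac_derivative_cmult[OF assms(2), of "-1"]] by simp

lemma has_ac_derivative_power:
  assumes f: "has_ac_derivative l f f'" and l: "0 \<le> l"
  shows "has_ac_derivative l (\<lambda>t. f t ^ Suc n) (\<lambda>t. of_nat (Suc n) * (f' t * f t ^ n))"
proof (induction n)
  case 0 thus ?case using f by simp
next
  case (Suc n)
  have "(\<lambda>t. f' t * f t ^ Suc n + f t * (of_nat (Suc n) * (f' t * f t ^ n)))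
      = (\<lambda>t. of_nat (Suc (Suc n)) * (f' t * f t ^ Suc n))"
    by (simp add: algebra_simps)
  thus ?case using has_ac_derivative_mult[OF f Suc l] by simp
qed

text \<open>
  The equation \<open>y'' = Q y\<close> with a complex potential, which is the Sturm-Liouville equation
  for \<open>Q = q - \<lambda>\<close>.
\<close>

definition schroedinger ::
    "real \<Rightarrow> (real \<Rightarrow> complex) \<Rightarrow> (real \<Rightarrow> complex) \<Rightarrow> (real \<Rightarrow> complex) \<Rightarrow> bool" where
  "schroedinger l Q y y' \<longleftrightarrow> has_ac_derivative l y y' \<and> has_ac_derivative l y' (\<lambda>x. Q x * y x)"

text \<open>\<open>sturm_liouville_solution\<close> prescribes the second derivative only almost
  everywhere in the open interval. This lemma lets it be replaced by the product of potential and
  solution at every point; the endpoints simply join the null set.\<close>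

lemma has_ac_derivative_AE_cong:
  assumes "has_ac_derivative l f g" "AE x in lebesgue. x \<in> {0<..<l} \<longrightarrow> h x = g x"
  shows "has_ac_derivative l f h"
proof -
  obtain N where N: "N \<in> null_sets lebesgue" "{x \<in> space lebesgue. \<not> (x \<in> {0<..<l} \<longrightarrow> h x = g x)} \<subseteq> N"
    using assms(2) unfolding eventually_ae_filter by blast
  define M where "M = N \<union> {0, l}"
  have M: "negligible M" using N(1) by (auto simp: M_def negligible_iff_null_sets)
  have eq: "h x = g x" if "x \<in> {0..l} - M" for x
    using that N(2) by (auto simp: M_def) (metis (mono_tags, lifting) greaterThanLessThan_iff 
       linorder_not_less mem_Collect_eq order_antisym subsetD)
  show ?thesis unfolding has_ac_derivative_def
  proof (intro conjI ballI)
    show "h absolutely_integrable_on {0..l}"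
      using assms(1) by (intro absolutely_integrable_spike[where f=g, OF _ M eq]) (simp_all add: has_ac_derivative_def)
    fix x assume x: "x \<in> {0..l}"
    have "(g has_integral (f x - f 0)) {0..x}"
      using assms(1) x by (simp add: has_ac_derivative_def)
    thus "(h has_integral (f x - f 0)) {0..x}"
      by (rule has_integral_spike[OF M, rotated]) (use eq x in auto)
  qed
qed

lemma sturm_liouville_solution_iff:
  "sturm_liouville_solution l q z y y' \<longleftrightarrow> schroedinger l (\<lambda>x. complex_of_real (q x) - z) y y'"
proof
  assume "sturm_liouville_solution l q z y y'"
  then obtain y'' where y: "has_ac_derivative l y y'" "has_ac_derivative l y' y''"
      and ae: "AE x in lebesgue. x \<in> {0<..<l} \<longrightarrow> - y'' x + complex_of_real (q x) * y x = z * y x"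
    by (auto simp: sturm_liouville_solution_def)
  have "AE x in lebesgue. x \<in> {0<..<l} \<longrightarrow> (complex_of_real (q x) - z) * y x = y'' x"
    using ae by eventually_elim (auto simp: algebra_simps)
  thus "schroedinger l (\<lambda>x. complex_of_real (q x) - z) y y'"
    using y has_ac_derivative_AE_cong by (auto simp: schroedinger_def)
next
  assume "schroedinger l (\<lambda>x. complex_of_real (q x) - z) y y'"
  thus "sturm_liouville_solution l q z y y'"
    unfolding sturm_liouville_solution_def schroedinger_def
    by (auto intro!: exI[of _ "\<lambda>x. (complex_of_real (q x) - z) * y x"] simp: algebra_simps)
qed

lemma schroedinger_continuous:
  assumes "schroedinger l Q y y'"
  shows "continuous_on {0..l} y" "continuous_on {0..l} y'"
  using assms has_ac_derivative_continuous by (auto simp: schroedinger_def)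

lemma schroedinger_cnj:
  assumes "schroedinger l Q y y'"
  shows "schroedinger l (\<lambda>x. cnj (Q x)) (\<lambda>x. cnj (y x)) (\<lambda>x. cnj (y' x))"
  using assms has_ac_derivative_cnj by (fastforce simp: schroedinger_def)

text \<open>Lagrange's identity: the terms \<open>y' x * u' x\<close> cancel and the difference of
  the potentials remains. It yields the constancy of the Wronskian, variation of constants and the
  norm identities behind the Nevanlinna property.\<close>

lemma schroedinger_green:
  assumes y: "schroedinger l Q y y'" and u: "schroedinger l R u u'" and l: "0 \<le> l"
  shows "has_ac_derivative l (\<lambda>x. y x * u' x - y' x * u x) (\<lambda>x. (R x - Q x) * (y x * u x))"
proof -
  have e: "(\<lambda>x. (R x - Q x) * (y x * u x))
      = (\<lambda>x. (y' x * u' x + y x * (R x * u x)) - (Q x * y x * u x + y' x * u' x))"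
    by (simp add: algebra_simps)
  show ?thesis using y u l unfolding schroedinger_def e
    by (intro has_ac_derivative_diff has_ac_derivative_mult) auto
qed

definition fundamental_pair where
  "fundamental_pair l Q C C' S S' \<longleftrightarrow>
     schroedinger l Q C C' \<and> C 0 = 1 \<and> C' 0 = 0 \<and> schroedinger l Q S S' \<and> S 0 = 0 \<and> S' 0 = 1"

lemma fundamental_pair_wronskian:
  assumes F: "fundamental_pair l Q C C' S S'" and x: "x \<in> {0..l}"
  shows "C x * S' x - C' x * S x = 1"
proof -
  have "has_ac_derivative l (\<lambda>x. C x * S' x - C' x * S x) (\<lambda>x. (Q x - Q x) * (C x * S x))"
    using F x by (intro schroedinger_green) (auto simp: fundamental_pair_def)
  from has_ac_derivative_integral[OF this x] show ?thesis
    using F by (simp add: fundamental_pair_def)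
qed

text \<open>By Cramer's rule with Wronskian 1, the coefficients of \<open>(y, y')\<close> in the
  basis \<open>C\<close>, \<open>S\<close> are the Wronskians of \<open>y\<close> with
  \<open>S\<close> and \<open>C\<close>, which Lagrange's identity integrates. Used with
  \<open>R = Q\<close> for uniqueness, with two spectral parameters for holomorphy, and with
  constant \<open>R\<close> for asymptotics.\<close>

lemma variation_of_constants:
  assumes F: "fundamental_pair l R C C' S S'" and y: "schroedinger l Q y y'" and x: "x \<in> {0..l}"
  defines "u \<equiv> \<lambda>x. y 0 + integral {0..x} (\<lambda>t. (R t - Q t) * (y t * S t))"
    and "v \<equiv> \<lambda>x. y' 0 - integral {0..x} (\<lambda>t. (R t - Q t) * (y t * C t))"
  shows "y x = u x * C x + v x * S x" "y' x = u x * C' x + v x * S' x"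
proof -
  have l: "0 \<le> l" using x by auto
  have u: "y x * S' x - y' x * S x = u x" and v: "C x * y' x - C' x * y x = v x"
    using has_ac_derivative_integral[OF schroedinger_green[OF y _ l] x, of R S S']
      has_ac_derivative_integral[OF schroedinger_green[OF y _ l] x, of R C C'] F
    by (auto simp: fundamental_pair_def u_def v_def algebra_simps)
  have w: "C x * S' x - C' x * S x = 1"
    using fundamental_pair_wronskian[OF F x] .
  have "y x = y x * (C x * S' x - C' x * S x)" using w by simp
  thus "y x = u x * C x + v x * S x"
    unfolding u[symmetric] v[symmetric] by (simp add: algebra_simps)
  have "y' x = y' x * (C x * S' x - C' x * S x)" using w by simp
  thus "y' x = u x * C' x + v x * S' x"
    unfolding u[symmetric] v[symmetric] by (simp add: algebra_simps)
qed

lemma schroedinger_unique: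
  assumes F: "fundamental_pair l Q C C' S S'" and y: "schroedinger l Q y y'" and x: "x \<in> {0..l}"
  shows "y x = y 0 * C x + y' 0 * S x" "y' x = y 0 * C' x + y' 0 * S' x"
  using variation_of_constants[OF F y x] by simp_all

section \<open>Existence of solutions by Picard iteration\<close>

lemma integral_norm_nonneg: "0 \<le> integral A (\<lambda>t. norm (Q t))"
  \<comment> \<open>In the non-integrable case the integral is 0 by convention.\<close>
  by (cases "(\<lambda>t. norm (Q t)) integrable_on A")
     (auto intro: Henstock_Kurzweil_Integration.integral_nonneg simp: not_integrable_integral)

lemma integral_mult_norm_bound:
  fixes Q y :: "real \<Rightarrow> complex"
  assumes Q: "Q absolutely_integrable_on {0..l}" and y: "continuous_on {0..l} y" and x: "x \<in> {0..l}"
    and M: "\<And>t. t \<in> {0..l} \<Longrightarrow> norm (y t) \<le> M"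
  shows "norm (integral {0..x} (\<lambda>t. Q t * y t)) \<le> integral {0..l} (\<lambda>t. norm (Q t)) * M"
proof -
  have Qx: "Q absolutely_integrable_on {0..x}"
    using Q x by (auto intro: set_integrable_subset)
  have "(\<lambda>t. y t * Q t) absolutely_integrable_on {0..x}"
    using Qx x y by (intro absolutely_integrable_continuous_mult) (auto intro: continuous_on_subset)
  hence i: "(\<lambda>t. Q t * y t) integrable_on {0..x}"
    using set_lebesgue_integral_eq_integral(1) by (auto simp: mult.commute)
  have n: "(\<lambda>t. norm (Q t)) integrable_on {0..x}" "(\<lambda>t. norm (Q t)) integrable_on {0..l}"
    using Qx Q by (auto simp: absolutely_integrable_on_def)
  have "M \<ge> 0" using M[of x] x norm_ge_zero order_trans by blast
  have "norm (integral {0..x} (\<lambda>t. Q t * y t)) \<le> integral {0..x} (\<lambda>t. norm (Q t) * M)"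
    using x M n i by (intro integral_norm_bound_integral integrable_on_mult_left) (auto simp: norm_mult mult_left_mono)
  also have "\<dots> = integral {0..x} (\<lambda>t. norm (Q t)) * M" by simp
  also have "\<dots> \<le> integral {0..l} (\<lambda>t. norm (Q t)) * M"
    using x n \<open>M \<ge> 0\<close> by (intro mult_right_mono integral_subset_le) auto
  finally show ?thesis .
qed

text \<open>The terms, not the partial sums, of the Picard series for the integral equation
  equivalent to \<open>y'' = Q y\<close> with initial data \<open>a\<close>,
  \<open>b\<close>.\<close>

fun picard :: "(real \<Rightarrow> complex) \<Rightarrow> complex \<Rightarrow> complex \<Rightarrow> nat \<Rightarrow> real \<Rightarrow> complex" where
  "picard Q a b 0 = (\<lambda>x. a + b * x)"
| "picard Q a b (Suc n) = (\<lambda>x. integral {0..x} (\<lambda>s. integral {0..s} (\<lambda>t. Q t * picard Q a b n t)))"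

lemma integral_mult_integrable:
  fixes Q y :: "real \<Rightarrow> complex"
  assumes Q: "Q absolutely_integrable_on {0..l}" and y: "continuous_on {0..l} y" and x: "x \<le> l"
  shows "(\<lambda>t. Q t * y t) integrable_on {0..x}" "(\<lambda>t. Q t * y t) absolutely_integrable_on {0..x}"
proof -
  have "Q absolutely_integrable_on {0..x}"
    using Q x by (auto intro: set_integrable_subset)
  hence "(\<lambda>t. y t * Q t) absolutely_integrable_on {0..x}"
    using x y by (intro absolutely_integrable_continuous_mult) (auto intro: continuous_on_subset)
  thus "(\<lambda>t. Q t * y t) absolutely_integrable_on {0..x}" by (simp add: mult.commute)
  thus "(\<lambda>t. Q t * y t) integrable_on {0..x}"
    using set_lebesgue_integral_eq_integral(1) by auto
qed

lemma continuous_on_integral_mult: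
  fixes Q y :: "real \<Rightarrow> complex"
  assumes "Q absolutely_integrable_on {0..l}" "continuous_on {0..l} y"
  shows "continuous_on {0..l} (\<lambda>x. integral {0..x} (\<lambda>t. Q t * y t))"
  by (intro indefinite_integral_continuous_1 integral_mult_integrable[OF assms order.refl])

text \<open>Since \<open>h\<close> is a primitive of \<open>norm (Q t)\<close>, integrating
  \<open>norm (Q t) * h t ^ n\<close> gives \<open>h x ^ Suc n / Suc n\<close>, and iterating
  produces the factorial. Continuity is part of the induction because it makes the next integrand
  integrable.\<close>

lemma picard_bound:
  assumes Q: "Q absolutely_integrable_on {0..l}" and l: "0 \<le> l"
  defines "h \<equiv> \<lambda>x. integral {0..x} (\<lambda>t. norm (Q t))"
  shows "continuous_on {0..l} (picard Q a b n)
    \<and> (\<forall>x\<in>{0..l}. norm (picard Q a b n x) \<le> (norm a + norm b * l) * (l * h x) ^ n / fact n)"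
proof (induction n)
  case 0
  have "norm (a + b * complex_of_real x) \<le> norm a + norm b * l" if "x \<in> {0..l}" for x
  proof -
    have "norm (a + b * complex_of_real x) \<le> norm a + norm (b * complex_of_real x)" by (rule norm_triangle_ineq)
    also have "norm (b * complex_of_real x) \<le> norm b * l"
      using that by (simp add: norm_mult mult_left_mono)
    finally show ?thesis by simp
  qed
  thus ?case by (auto intro!: continuous_intros)
next
  case (Suc n)
  define M where "M = norm a + norm b * l"
  have M0: "M \<ge> 0" using l by (simp add: M_def)
  define I where "I = (\<lambda>s. integral {0..s} (\<lambda>t. Q t * picard Q a b n t))"
  have c: "continuous_on {0..l} (picard Q a b n)" and
    bd: "\<And>x. x \<in> {0..l} \<Longrightarrow> norm (picard Q a b n x) \<le> M * (l * h x) ^ n / fact n"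
    using Suc by (auto simp: M_def)
  have cI: "continuous_on {0..l} I"
    unfolding I_def by (rule continuous_on_integral_mult[OF Q c])
  have nQ: "(\<lambda>t. norm (Q t)) absolutely_integrable_on {0..l}"
    using Q set_integrable_norm by blast
  have nQi: "(\<lambda>t. norm (Q t)) integrable_on {0..x}" if "x \<le> l" for x
    using set_integrable_subset[OF nQ, of "{0..x}"] that set_lebesgue_integral_eq_integral(1) by fastforce
  have h_mono: "h s \<le> h x" if "0 \<le> s" "s \<le> x" "x \<le> l" for s x
    unfolding h_def using that nQi by (intro integral_subset_le) auto
  have h0: "h x \<ge> 0" for x unfolding h_def by (rule integral_norm_nonneg)
  \<comment> \<open>\<open>h\<close> is made complex-valued to fit the type of
    \<open>has_ac_derivative\<close>, whose power rule then integrates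
    \<open>norm (Q t) * h t ^ n\<close>.\<close>
  have hc: "has_ac_derivative l (\<lambda>x. complex_of_real (h x)) (\<lambda>t. complex_of_real (norm (Q t)))"
  proof (rule has_ac_derivativeI[OF _ _ l, where c=0])
    show "(\<lambda>t. complex_of_real (norm (Q t))) absolutely_integrable_on {0..l}"
      using absolutely_integrable_linear[OF nQ bounded_linear_of_real] by (simp add: o_def)
    show "complex_of_real (h x) = 0 + integral {0..x} (\<lambda>t. complex_of_real (norm (Q t)))" if "x \<in> {0..l}" for x
      using integral_linear[OF nQi[of x] bounded_linear_of_real[where 'a=complex]] that by (simp add: h_def o_def)
  qed
  have hint: "((\<lambda>t. norm (Q t) * h t ^ n) has_integral (h x ^ Suc n / real (Suc n))) {0..x}" if "x \<in> {0..l}" for x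
  proof -
    have "((\<lambda>t. of_nat (Suc n) * (complex_of_real (norm (Q t)) * complex_of_real (h t) ^ n)) has_integral
        (complex_of_real (h x) ^ Suc n - complex_of_real (h 0) ^ Suc n)) {0..x}"
      using has_ac_derivative_has_integral[OF has_ac_derivative_power[OF hc l, of n], of 0 x] that by auto
    from has_integral_linear[OF this bounded_linear_Re]
    have "((\<lambda>t. real (Suc n) * (norm (Q t) * h t ^ n)) has_integral (h x ^ Suc n)) {0..x}"
      by (simp add: o_def h_def flip: of_real_power of_real_mult)
    from has_integral_mult_right[OF this, of "1 / real (Suc n)"] show ?thesis by simp
  qed
  have Ib: "norm (I s) \<le> M * l ^ n * h s ^ Suc n / fact (Suc n)" if "s \<in> {0..l}" for s
  proof -
    have "norm (I s) \<le> integral {0..s} (\<lambda>t. M * l ^ n / fact n * (norm (Q t) * h t ^ n))"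
      unfolding I_def
    proof (rule integral_norm_bound_integral)
      show "(\<lambda>t. Q t * picard Q a b n t) integrable_on {0..s}"
        using that by (intro integral_mult_integrable[OF Q c]) auto
      show "(\<lambda>t. M * l ^ n / fact n * (norm (Q t) * h t ^ n)) integrable_on {0..s}"
        using hint[OF that] by (intro integrable_on_mult_right) auto
      fix t assume "t \<in> {0..s}"
      hence "norm (Q t) * norm (picard Q a b n t) \<le> norm (Q t) * (M * (l * h t) ^ n / fact n)"
        using that by (intro mult_left_mono bd) auto
      thus "norm (Q t * picard Q a b n t) \<le> M * l ^ n / fact n * (norm (Q t) * h t ^ n)"
        by (simp add: norm_mult power_mult_distrib algebra_simps)
    qed
    also have "\<dots> = M * l ^ n / fact n * (h s ^ Suc n / real (Suc n))"
      using integral_unique[OF hint[OF that]] by simp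
    finally show ?thesis by (simp add: field_simps)
  qed
  have "norm (picard Q a b (Suc n) x) \<le> M * (l * h x) ^ Suc n / fact (Suc n)" if "x \<in> {0..l}" for x
  proof -
    have "norm (integral {0..x} I) \<le> integral {0..x} (\<lambda>s. M * l ^ n * h x ^ Suc n / fact (Suc n))"
    proof (rule integral_norm_bound_integral)
      show "I integrable_on {0..x}"
        using cI that by (intro integrable_continuous_real) (auto intro: continuous_on_subset)
      fix s assume s: "s \<in> {0..x}"
      have "norm (I s) \<le> M * l ^ n * h s ^ Suc n / fact (Suc n)" using Ib s that by auto
      also have "\<dots> \<le> M * l ^ n * h x ^ Suc n / fact (Suc n)"
        using h_mono[of s x] s that l M0 h0 by (intro divide_right_mono mult_left_mono power_mono) auto
      finally show "norm (I s) \<le> M * l ^ n * h x ^ Suc n / fact (Suc n)" .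
    qed auto
    also have "\<dots> = x * (M * l ^ n * h x ^ Suc n / fact (Suc n))" using that by simp
    also have "\<dots> \<le> l * (M * l ^ n * h x ^ Suc n / fact (Suc n))"
      using that M0 l h0 by (intro mult_right_mono) auto
    also have "\<dots> = M * (l * h x) ^ Suc n / fact (Suc n)" by (simp add: power_mult_distrib)
    finally show ?thesis by (simp add: I_def)
  qed
  moreover have "continuous_on {0..l} (picard Q a b (Suc n))"
    using cI by (auto simp: I_def intro!: indefinite_integral_continuous_1 integrable_continuous_real)
  ultimately show ?case by (auto simp: M_def)
qed

text \<open>The Picard terms are dominated by the exponential series of \<open>l * H\<close>, so the
  series converges uniformly and the limit may be taken under both integrals of the
  recursion.\<close>

lemma schroedinger_exists:
  assumes Q: "Q absolutely_integrable_on {0..l}" and l: "0 \<le> l"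
  shows "\<exists>y y'. schroedinger l Q y y' \<and> y 0 = a \<and> y' 0 = b"
proof -
  define d where "d = picard Q a b"
  define H where "H = integral {0..l} (\<lambda>t. norm (Q t))"
  define m where "m n = (norm a + norm b * l) * ((l * H) ^ n / fact n)" for n :: nat
  have nQ: "(\<lambda>t. norm (Q t)) integrable_on {0..l}"
    using Q by (auto simp: absolutely_integrable_on_def)
  have H0: "H \<ge> 0" unfolding H_def by (rule integral_norm_nonneg)
  have dc: "continuous_on {0..l} (d n)" for n using picard_bound[OF Q l] by (auto simp: d_def)
  have db: "norm (d n x) \<le> m n" if x: "x \<in> {0..l}" for n x
  proof -
    have "integral {0..x} (\<lambda>t. norm (Q t)) \<le> H" "0 \<le> integral {0..x} (\<lambda>t. norm (Q t))"
      unfolding H_def using nQ x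
      by (auto intro!: integral_subset_le integral_norm_nonneg intro: integrable_subinterval_real)
    hence "(norm a + norm b * l) * (l * integral {0..x} (\<lambda>t. norm (Q t))) ^ n / fact n \<le> m n"
      unfolding m_def times_divide_eq_right[symmetric] using l
      by (intro mult_left_mono divide_right_mono power_mono) auto
    thus ?thesis using picard_bound[OF Q l, of a b n] x by (force simp: d_def)
  qed
  have sm: "summable m"
    unfolding m_def using summable_exp[of "l * H"]
    by (intro summable_mult) (simp add: field_simps)
  define Y where "Y N x = (\<Sum>i<N. d i x)" for N x
  define y where "y x = (\<Sum>i. d i x)" for x
  have ul: "uniform_limit {0..l} Y y sequentially"
    unfolding Y_def y_def using db sm by (intro Weierstrass_m_test) auto
  have Yc: "continuous_on {0..l} (Y N)" for N
    unfolding Y_def by (intro continuous_intros) (simp add: dc eta_contract_eq)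
  have yc: "continuous_on {0..l} y"
    by (rule uniform_limit_theorem[OF _ ul]) (auto simp: Yc)
  define T where "T f s = integral {0..s} (\<lambda>t. Q t * f t)" for f s
  have Tc: "continuous_on {0..l} (T f)" if "continuous_on {0..l} f" for f
    unfolding T_def using Q that by (rule continuous_on_integral_mult)
  have Ti: "T f integrable_on {0..x}" if "continuous_on {0..l} f" "x \<le> l" for f x
    using Tc[OF that(1)] that(2) by (intro integrable_continuous_real) (auto intro: continuous_on_subset)
  have Yrec: "Y (Suc N) x = a + b * x + integral {0..x} (T (Y N))" if x: "x \<in> {0..l}" for N x
  proof (induction N)
    case 0 thus ?case by (simp add: Y_def T_def[abs_def] d_def)
  next
    case (Suc N)
    have "T (Y (Suc N)) s = T (Y N) s + T (d N) s" if "s \<in> {0..x}" for s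
    proof -
      have "(\<lambda>t. Q t * Y (Suc N) t) = (\<lambda>t. Q t * Y N t + Q t * d N t)"
        by (simp add: Y_def algebra_simps)
      thus ?thesis unfolding T_def using that x
        by (simp add: Henstock_Kurzweil_Integration.integral_add integral_mult_integrable[OF Q] Yc dc)
    qed
    hence "integral {0..x} (T (Y (Suc N))) = integral {0..x} (\<lambda>s. T (Y N) s + T (d N) s)"
      by (intro integral_cong) auto
    also have "\<dots> = integral {0..x} (T (Y N)) + integral {0..x} (T (d N))"
      using x by (intro Henstock_Kurzweil_Integration.integral_add Ti Yc dc) auto
    also have "integral {0..x} (T (d N)) = d (Suc N) x"
      by (simp add: d_def T_def[abs_def])
    finally show ?case using Suc by (simp add: Y_def algebra_simps)
  qed
  have yeq: "y x = a + b * x + integral {0..x} (T y)" if x: "x \<in> {0..l}" for x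
  proof (rule LIMSEQ_unique)
    show "(\<lambda>N. Y (Suc N) x) \<longlonglongrightarrow> y x"
      using tendsto_uniform_limitI[OF ul x] by (rule LIMSEQ_Suc)
    have "(\<lambda>N. integral {0..x} (T (Y N))) \<longlonglongrightarrow> integral {0..x} (T y)"
    proof (rule LIMSEQ_I)
      fix r :: real assume r: "r > 0"
      \<comment> \<open>The iterated integrals differ by at most \<open>l * H * e\<close>, which
        this choice keeps below \<open>r\<close>; the summand 1 covers \<open>H = 0\<close>.\<close>
      define e where "e = r / (2 * (l * H + 1))"
      have e: "e > 0" unfolding e_def using r l H0 by (intro divide_pos_pos mult_pos_pos) (auto simp: add_nonneg_pos)
      obtain N0 where "\<forall>n\<ge>N0. \<forall>t\<in>{0..l}. dist (Y n t) (y t) < e"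
        using uniform_limitD[OF ul e] unfolding eventually_sequentially by blast
      hence N0: "\<And>n t. n \<ge> N0 \<Longrightarrow> t \<in> {0..l} \<Longrightarrow> dist (Y n t) (y t) < e" by blast
      have "norm (integral {0..x} (T (Y n)) - integral {0..x} (T y)) < r" if n: "n \<ge> N0" for n
      proof -
        have dcn: "continuous_on {0..l} (\<lambda>t. Y n t - y t)" by (intro continuous_intros Yc yc)
        have "norm (T (Y n) s - T y s) \<le> H * e" if s: "s \<in> {0..l}" for s
        proof -
          have "T (Y n) s - T y s = integral {0..s} (\<lambda>t. Q t * (Y n t - y t))"
            unfolding T_def using s
            by (subst Henstock_Kurzweil_Integration.integral_diff[symmetric])
               (auto simp: right_diff_distrib intro!: integral_mult_integrable[OF Q] Yc yc)
          also have "norm \<dots> \<le> H * e"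
            unfolding H_def using N0[OF n] s
            by (intro integral_mult_norm_bound[OF Q dcn]) (auto simp: dist_norm less_imp_le)
          finally show ?thesis .
        qed
        hence "norm (integral {0..x} (\<lambda>s. T (Y n) s - T y s)) \<le> integral {0..x} (\<lambda>s. H * e)"
          using x by (intro integral_norm_bound_integral integrable_diff Ti Yc yc) auto
        also have "\<dots> = x * (H * e)" using x by simp
        also have "\<dots> \<le> l * (H * e)" using x H0 e by (intro mult_right_mono) auto
        also have "\<dots> < (l * H + 1) * (2 * e)" using e l H0 by (simp add: algebra_simps add_nonneg_pos)
        also have "(l * H + 1) * (2 * e) = r"
        proof -
          have "l * H + 1 > 0" using l H0 by (simp add: add_nonneg_pos)
          thus ?thesis by (simp add: e_def field_simps)
        qed
        finally show ?thesis using x Ti[OF Yc] Ti[OF yc]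
          by (simp add: Henstock_Kurzweil_Integration.integral_diff)
      qed
      thus "\<exists>no. \<forall>n\<ge>no. norm (integral {0..x} (T (Y n)) - integral {0..x} (T y)) < r" by blast
    qed
    thus "(\<lambda>N. Y (Suc N) x) \<longlonglongrightarrow> a + b * x + integral {0..x} (T y)"
      unfolding Yrec[OF x] by (intro tendsto_intros)
  qed
  define y' where "y' x = b + T y x" for x
  have "has_ac_derivative l y' (\<lambda>x. Q x * y x)"
    by (rule has_ac_derivativeI[OF integral_mult_integrable(2)[OF Q yc] _ l, where c=b])
       (auto simp: y'_def T_def)
  moreover have "has_ac_derivative l y y'"
  proof (rule has_ac_derivativeI[OF _ _ l, where c=a])
    show "y' absolutely_integrable_on {0..l}"
      unfolding y'_def by (intro absolutely_integrable_continuous_real continuous_intros Tc yc)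
    fix x assume x: "x \<in> {0..l}"
    have "integral {0..x} y' = integral {0..x} (\<lambda>_. b) + integral {0..x} (T y)"
      unfolding y'_def using x by (intro Henstock_Kurzweil_Integration.integral_add Ti yc) auto
    thus "y x = a + integral {0..x} y'" using yeq[OF x] x by (simp add: scaleR_conv_of_real mult.commute)
  qed
  moreover have "y 0 = a" using yeq[of 0] l by simp
  moreover have "y' 0 = b" by (simp add: y'_def T_def)
  ultimately show ?thesis unfolding schroedinger_def by blast
qed

section \<open>The transfer matrix of an edge\<close>

text \<open>The choice is unique on \<open>{0..l}\<close> only; values outside are unspecified,
  hence the restriction to \<open>x \<in> {0..l}\<close> in what follows.\<close>

definition ivp ::
    "real \<Rightarrow> (real \<Rightarrow> real) \<Rightarrow> complex \<Rightarrow> complex \<Rightarrow> complex \<Rightarrow> (real \<Rightarrow> complex) \<times> (real \<Rightarrow> complex)" where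
  "ivp l q a b z = (SOME p. schroedinger l (\<lambda>x. complex_of_real (q x) - z) (fst p) (snd p)
     \<and> fst p 0 = a \<and> snd p 0 = b)"

text \<open>The matrix that maps \<open>(y(l), y'(l))\<close> to \<open>(y(0), y'(0))\<close>; it is inverted using the constant Wronskian 1.\<close>

definition tr11 where "tr11 l q z = snd (ivp l q 0 1 z) l"
definition tr12 where "tr12 l q z = - fst (ivp l q 0 1 z) l"
definition tr21 where "tr21 l q z = - snd (ivp l q 1 0 z) l"
definition tr22 where "tr22 l q z = fst (ivp l q 1 0 z) l"

text \<open>The solution with value \<open>a\<close> and derivative \<open>b\<close> at the far end \<open>l\<close>.\<close>

definition evp where
  "evp l q a b z = ivp l q (tr11 l q z * a + tr12 l q z * b) (tr21 l q z * a + tr22 l q z * b) z"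

text \<open>Integrability is the form in which the potential enters the integral equation; square
  integrability on a bounded interval implies it.\<close>

locale edge_potential =
  fixes l :: real and q :: "real \<Rightarrow> real"
  assumes l: "0 < l" and q: "q absolutely_integrable_on {0..l}"
begin

lemma potential_integrable: "(\<lambda>x. complex_of_real (q x) - z) absolutely_integrable_on {0..l}"
proof -
  have "(\<lambda>x. complex_of_real (q x)) absolutely_integrable_on {0..l}"
    using absolutely_integrable_linear[OF q bounded_linear_of_real] by (simp add: o_def)
  thus ?thesis by (intro set_integral_diff) auto
qed

lemma ivp:
  "schroedinger l (\<lambda>x. complex_of_real (q x) - z) (fst (ivp l q a b z)) (snd (ivp l q a b z))"
  "fst (ivp l q a b z) 0 = a" "snd (ivp l q a b z) 0 = b"
proof -
  let ?P = "\<lambda>p. schroedinger l (\<lambda>x. complex_of_real (q x) - z) (fst p) (snd p)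
     \<and> fst p 0 = a \<and> snd p 0 = b"
  have "\<exists>p. ?P p"
    using schroedinger_exists[OF potential_integrable, of z a b] l by fastforce
  hence "?P (ivp l q a b z)" unfolding ivp_def by (rule someI_ex)
  thus "schroedinger l (\<lambda>x. complex_of_real (q x) - z) (fst (ivp l q a b z)) (snd (ivp l q a b z))"
  "fst (ivp l q a b z) 0 = a" "snd (ivp l q a b z) 0 = b" by auto
qed

lemma fundamental_ivp:
  "fundamental_pair l (\<lambda>x. complex_of_real (q x) - z) (fst (ivp l q 1 0 z)) (snd (ivp l q 1 0 z))
     (fst (ivp l q 0 1 z)) (snd (ivp l q 0 1 z))"
  unfolding fundamental_pair_def using ivp by auto

lemmas ivp_unique = schroedinger_unique[OF fundamental_ivp]

lemma ivp_lincomb: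
  assumes "x \<in> {0..l}"
  shows "fst (ivp l q a b z) x = a * fst (ivp l q 1 0 z) x + b * fst (ivp l q 0 1 z) x"
    and "snd (ivp l q a b z) x = a * snd (ivp l q 1 0 z) x + b * snd (ivp l q 0 1 z) x"
  using ivp_unique[OF ivp(1)[of z a b] assms] by (simp_all add: ivp)

lemma ivp_continuous: "continuous_on {0..l} (fst (ivp l q a b z))" "continuous_on {0..l} (snd (ivp l q a b z))"
  using schroedinger_continuous[OF ivp(1)] by auto

lemma transfer_det: "tr11 l q z * tr22 l q z - tr12 l q z * tr21 l q z = 1"
  using fundamental_pair_wronskian[OF fundamental_ivp, of l z] l
  by (simp add: tr11_def tr12_def tr21_def tr22_def algebra_simps)

section \<open>Dependence of the solutions on the spectral parameter\<close>

text \<open>Variation of constants between the parameters \<open>z\<close> and \<open>w\<close>: the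
  potentials differ by the constant \<open>z - w\<close>, so the difference quotient in the
  parameter becomes explicit.\<close>

lemma ivp_variation:
  fixes a b w z :: complex
  assumes "x \<in> {0..l}"
  defines "C \<equiv> ivp l q 1 0 w" and "S \<equiv> ivp l q 0 1 w" and "y \<equiv> fst (ivp l q a b z)"
  shows "fst (ivp l q a b z) x = fst (ivp l q a b w) x + (z - w) *
      (fst C x * integral {0..x} (\<lambda>t. y t * fst S t) - fst S x * integral {0..x} (\<lambda>t. y t * fst C t))"
    and "snd (ivp l q a b z) x = snd (ivp l q a b w) x + (z - w) *
      (snd C x * integral {0..x} (\<lambda>t. y t * fst S t) - snd S x * integral {0..x} (\<lambda>t. y t * fst C t))"
proof -
  have e: "(\<lambda>t. (complex_of_real (q t) - w - (complex_of_real (q t) - z)) * f t) = (\<lambda>t. (z - w) * f t)" for f :: "real \<Rightarrow> complex"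
    by simp
  note V = variation_of_constants[OF fundamental_ivp[of w] ivp(1)[of z a b] assms(1), unfolded e integral_mult_right]
  show "fst (ivp l q a b z) x = fst (ivp l q a b w) x + (z - w) *
      (fst C x * integral {0..x} (\<lambda>t. y t * fst S t) - fst S x * integral {0..x} (\<lambda>t. y t * fst C t))"
    unfolding C_def S_def y_def by (subst V(1)) (simp add: ivp ivp_lincomb(1)[OF assms(1), of a b] algebra_simps)
  show "snd (ivp l q a b z) x = snd (ivp l q a b w) x + (z - w) *
      (snd C x * integral {0..x} (\<lambda>t. y t * fst S t) - snd S x * integral {0..x} (\<lambda>t. y t * fst C t))"
    unfolding C_def S_def y_def by (subst V(2)) (simp add: ivp ivp_lincomb(2)[OF assms(1), of a b] algebra_simps)
qed

text \<open>A bootstrap: the variation formula bounds the difference by \<open>norm (z - w)\<close>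
  times a multiple of the maximum of the solution at \<open>z\<close>, and for small
  \<open>norm (z - w)\<close> that maximum is itself controlled by the solution at
  \<open>w\<close>.\<close>

lemma ivp_lipschitz:
  "\<exists>K d. K \<ge> 0 \<and> d > 0 \<and> (\<forall>z x. dist z w < d \<longrightarrow> x \<in> {0..l} \<longrightarrow>
     norm (fst (ivp l q a b z) x - fst (ivp l q a b w) x) \<le> K * norm (z - w))"
proof -
  define C S where "C = fst (ivp l q 1 0 w)" and "S = fst (ivp l q 0 1 w)"
  have bnd: "\<exists>m. \<forall>x\<in>{0..l}. norm (f x) \<le> m" if "continuous_on {0..l} f" for f :: "real \<Rightarrow> complex"
    using compact_imp_bounded[OF compact_continuous_image[OF that compact_Icc]]
    by (auto simp: bounded_iff)
  obtain m1 m2 m3 where m1: "\<And>x. x \<in> {0..l} \<Longrightarrow> norm (C x) \<le> m1"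
    and m2: "\<And>x. x \<in> {0..l} \<Longrightarrow> norm (S x) \<le> m2"
    and m3: "\<And>x. x \<in> {0..l} \<Longrightarrow> norm (fst (ivp l q a b w) x) \<le> m3"
    using bnd[OF ivp_continuous(1)] unfolding C_def S_def by metis
  have m0: "m1 \<ge> 0" "m2 \<ge> 0" "m3 \<ge> 0"
    using order_trans[OF norm_ge_zero m1[of 0]] order_trans[OF norm_ge_zero m2[of 0]]
      order_trans[OF norm_ge_zero m3[of 0]] l by simp_all
  define k where "k = 2 * m1 * m2 * l"
  have k0: "k \<ge> 0" unfolding k_def using m0 l by auto
  have *: "norm (fst (ivp l q a b z) x - fst (ivp l q a b w) x) \<le> norm (z - w) * (k * M)"
    if x: "x \<in> {0..l}" and M: "\<And>t. t \<in> {0..l} \<Longrightarrow> norm (fst (ivp l q a b z) t) \<le> M" for z x M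
  proof -
    define y where "y = fst (ivp l q a b z)"
    have yc: "continuous_on {0..l} y" unfolding y_def by (rule ivp_continuous)
    have M0: "M \<ge> 0" using M[OF x] norm_ge_zero order_trans by blast
    have I: "norm (integral {0..x} (\<lambda>t. y t * f t)) \<le> l * (M * m)"
      if "continuous_on {0..l} f" "\<And>t. t \<in> {0..l} \<Longrightarrow> norm (f t) \<le> m" "0 \<le> m" for f m
    proof -
      have "norm (integral {0..x} (\<lambda>t. y t * f t)) \<le> integral {0..x} (\<lambda>t. M * m)"
      proof (rule integral_norm_bound_integral)
        show "(\<lambda>t. y t * f t) integrable_on {0..x}" using yc that x
          by (intro integrable_continuous_real continuous_intros) (auto intro: continuous_on_subset)
        show "norm (y t * f t) \<le> M * m" if "t \<in> {0..x}" for t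
          unfolding norm_mult using M[of t] \<open>\<And>t. t \<in> {0..l} \<Longrightarrow> norm (f t) \<le> m\<close>[of t] that x M0
          by (intro mult_mono) (auto simp: y_def)
      qed auto
      also have "\<dots> = x * (M * m)" using x by simp
      also have "\<dots> \<le> l * (M * m)" using x M0 that by (intro mult_right_mono) auto
      finally show ?thesis .
    qed
    have "norm (C x * integral {0..x} (\<lambda>t. y t * S t)) \<le> m1 * (l * (M * m2))"
      unfolding norm_mult using m1[OF x] m0 m2 I[of S m2] by (intro mult_mono) (auto simp: S_def ivp_continuous)
    moreover have "norm (S x * integral {0..x} (\<lambda>t. y t * C t)) \<le> m2 * (l * (M * m1))"
      unfolding norm_mult using m2[OF x] m0 m1 I[of C m1] by (intro mult_mono) (auto simp: C_def ivp_continuous)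
    ultimately have "norm (C x * integral {0..x} (\<lambda>t. y t * S t) - S x * integral {0..x} (\<lambda>t. y t * C t)) \<le> k * M"
      by (intro norm_triangle_le_diff) (simp add: k_def algebra_simps)
    thus ?thesis unfolding ivp_variation(1)[OF x, of a b z w]
      by (simp add: norm_mult C_def S_def y_def mult_left_mono)
  qed
  \<comment> \<open>For \<open>z\<close> this close to \<open>w\<close> the maximum \<open>M\<close>
    satisfies \<open>M \<le> m3 + M / 2\<close>.\<close>
  have bd: "norm (fst (ivp l q a b z) x) \<le> 2 * m3" if z: "dist z w < 1 / (2 * k + 1)" and x: "x \<in> {0..l}" for z x
  proof -
    have "continuous_on {0..l} (\<lambda>x. norm (fst (ivp l q a b z) x))" by (intro continuous_intros ivp_continuous)
    then obtain x0 where x0: "x0 \<in> {0..l}"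
      "\<And>t. t \<in> {0..l} \<Longrightarrow> norm (fst (ivp l q a b z) t) \<le> norm (fst (ivp l q a b z) x0)"
      using continuous_attains_sup[of "{0..l}"] l by force
    define M where "M = norm (fst (ivp l q a b z) x0)"
    have "M \<le> m3 + norm (fst (ivp l q a b z) x0 - fst (ivp l q a b w) x0)"
      using m3[OF x0(1)] norm_triangle_sub[of "fst (ivp l q a b z) x0" "fst (ivp l q a b w) x0"] by (simp add: M_def)
    also have "\<dots> \<le> m3 + norm (z - w) * (k * M)" using *[OF x0(1), of z M] x0(2) by (simp add: M_def)
    also have "norm (z - w) * (k * M) \<le> 1 / (2 * k + 1) * (k * M)"
      using z k0 by (intro mult_right_mono) (auto simp: dist_norm M_def)
    also have "\<dots> \<le> M / 2" using k0 by (auto simp: field_simps M_def)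
    finally have "M \<le> 2 * m3" by simp
    thus ?thesis using x0(2)[OF x] by (simp add: M_def)
  qed
  show ?thesis
  proof (rule exI[of _ "k * (2 * m3)"], rule exI[of _ "1 / (2 * k + 1)"], intro conjI allI impI)
    fix z x assume "dist z w < 1 / (2 * k + 1)" "x \<in> {0..l}"
    thus "norm (fst (ivp l q a b z) x - fst (ivp l q a b w) x) \<le> k * (2 * m3) * norm (z - w)"
      using *[of x z "2 * m3"] bd by (simp add: mult.commute)
  qed (use k0 m0 in auto)
qed

lemma ivp_integral_isCont:
  assumes g: "continuous_on {0..l} g" and x: "x \<in> {0..l}"
  shows "isCont (\<lambda>z. integral {0..x} (\<lambda>t. fst (ivp l q a b z) t * g t)) w"
proof -
  obtain K d where K: "K \<ge> 0" "d > 0" "\<And>z x. dist z w < d \<Longrightarrow> x \<in> {0..l} \<Longrightarrow>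
     norm (fst (ivp l q a b z) x - fst (ivp l q a b w) x) \<le> K * norm (z - w)"
    using ivp_lipschitz[of w a b] by blast
  obtain m where "\<forall>x\<in>{0..l}. norm (g x) \<le> m"
    using compact_imp_bounded[OF compact_continuous_image[OF g compact_Icc]]
    by (auto simp: bounded_iff)
  hence m: "\<And>x. x \<in> {0..l} \<Longrightarrow> norm (g x) \<le> m" by blast
  have m0: "m \<ge> 0" using m[OF x] norm_ge_zero order_trans by blast
  let ?I = "\<lambda>z. integral {0..x} (\<lambda>t. fst (ivp l q a b z) t * g t)"
  have int: "(\<lambda>t. fst (ivp l q a b z) t * g t) integrable_on {0..x}" for z
    using ivp_continuous[of a b z] g x
    by (intro integrable_continuous_real continuous_intros) (auto intro: continuous_on_subset)
  have "norm (?I z - ?I w) \<le> (K * m * l) * norm (z - w)" if z: "dist z w < d" for z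
  proof -
    have "?I z - ?I w = integral {0..x} (\<lambda>t. fst (ivp l q a b z) t * g t - fst (ivp l q a b w) t * g t)"
      by (rule Henstock_Kurzweil_Integration.integral_diff[symmetric]) (rule int)+
    also have "norm \<dots> \<le> integral {0..x} (\<lambda>t. K * norm (z - w) * m)"
    proof (rule integral_norm_bound_integral)
      fix t assume "t \<in> {0..x}"
      hence "norm ((fst (ivp l q a b z) t - fst (ivp l q a b w) t) * g t) \<le> K * norm (z - w) * m"
        unfolding norm_mult using K(3)[OF z, of t] m[of t] x K(1) by (intro mult_mono) auto
      thus "norm (fst (ivp l q a b z) t * g t - fst (ivp l q a b w) t * g t) \<le> K * norm (z - w) * m"
        by (simp add: algebra_simps)
    qed (auto intro!: integrable_diff int)
    also have "\<dots> = x * (K * norm (z - w) * m)" using x by simp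
    also have "\<dots> \<le> l * (K * norm (z - w) * m)" using x K(1) m0 by (intro mult_right_mono) auto
    finally show ?thesis by (simp add: mult_ac)
  qed
  hence ev: "eventually (\<lambda>z. norm (?I z - ?I w) \<le> (K * m * l) * norm (z - w)) (at w)"
    using K(2) by (auto simp: eventually_at)
  have "((\<lambda>z. ?I z - ?I w) \<longlongrightarrow> 0) (at w)"
  proof (rule Lim_null_comparison[OF ev])
    show "((\<lambda>z. K * m * l * norm (z - w)) \<longlongrightarrow> 0) (at w)"
      by (rule tendsto_eq_intros refl | simp)+
  qed
  thus ?thesis unfolding isCont_def by (simp add: LIM_zero_iff)
qed

text \<open>By the variation formula the difference quotient at \<open>w\<close> is a combination of
  integrals that are continuous in \<open>z\<close>, so its limit exists. The coefficients
  \<open>c\<close>, \<open>s\<close> of \<open>H\<close> stand for values or for derivatives of the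
  fundamental solutions.\<close>

lemma ivp_holomorphic:
  assumes x: "x \<in> {0..l}"
  shows "(\<lambda>z. fst (ivp l q a b z) x) holomorphic_on UNIV" "(\<lambda>z. snd (ivp l q a b z) x) holomorphic_on UNIV"
proof -
  have T: "((\<lambda>z. c * integral {0..x} (\<lambda>t. fst (ivp l q a b z) t * fst S t) - s * integral {0..x} (\<lambda>t. fst (ivp l q a b z) t * fst C t))
      \<longlongrightarrow> c * integral {0..x} (\<lambda>t. fst (ivp l q a b w) t * fst S t) - s * integral {0..x} (\<lambda>t. fst (ivp l q a b w) t * fst C t)) (at w)"
    if "continuous_on {0..l} (fst C)" "continuous_on {0..l} (fst S)" for c s C w and S :: "(real \<Rightarrow> complex) \<times> (real \<Rightarrow> complex)"
    using ivp_integral_isCont[OF that(1) x, of w a b] ivp_integral_isCont[OF that(2) x, of w a b]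
    by (intro tendsto_intros) (auto simp: isCont_def)
  have H: "f holomorphic_on UNIV"
    if hf: "\<And>w z. f z = f w + (z - w) * (c w * integral {0..x} (\<lambda>t. fst (ivp l q a b z) t * fst (ivp l q 0 1 w) t)
      - s w * integral {0..x} (\<lambda>t. fst (ivp l q a b z) t * fst (ivp l q 1 0 w) t))" for f c s
    unfolding holomorphic_on_def field_differentiable_def
  proof safe
    fix w
    let ?D = "\<lambda>z. c w * integral {0..x} (\<lambda>t. fst (ivp l q a b z) t * fst (ivp l q 0 1 w) t)
      - s w * integral {0..x} (\<lambda>t. fst (ivp l q a b z) t * fst (ivp l q 1 0 w) t)"
    have "((\<lambda>z. (f z - f w) / (z - w)) \<longlongrightarrow> ?D w) (at w)"
    proof (rule Lim_transform_eventually[OF T[OF ivp_continuous(1) ivp_continuous(1)]])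
      have "?D z = (f z - f w) / (z - w)" if "z \<noteq> w" for z
        by (subst hf[of z w]) (use that in simp)
      thus "\<forall>\<^sub>F z in at w. ?D z = (f z - f w) / (z - w)"
        unfolding eventually_at_filter by (intro always_eventually) blast
    qed
    thus "\<exists>f'. (f has_field_derivative f') (at w)" unfolding has_field_derivative_iff by blast
  qed
  show "(\<lambda>z. fst (ivp l q a b z) x) holomorphic_on UNIV"
    by (rule H[OF ivp_variation(1)[OF x]])
  show "(\<lambda>z. snd (ivp l q a b z) x) holomorphic_on UNIV"
    by (rule H[OF ivp_variation(2)[OF x]])
qed

lemma transfer_holomorphic:
  "tr11 l q holomorphic_on UNIV" "tr12 l q holomorphic_on UNIV"
  "tr21 l q holomorphic_on UNIV" "tr22 l q holomorphic_on UNIV"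
  unfolding tr11_def[abs_def] tr12_def[abs_def] tr21_def[abs_def] tr22_def[abs_def]
  using l by (auto intro!: holomorphic_intros ivp_holomorphic)

text \<open>The symmetry comes from \<open>q\<close> being real; it makes the transfer matrix real
  on the real axis.\<close>

lemma ivp_cnj:
  assumes x: "x \<in> {0..l}"
  shows "fst (ivp l q (cnj a) (cnj b) (cnj z)) x = cnj (fst (ivp l q a b z) x)"
    "snd (ivp l q (cnj a) (cnj b) (cnj z)) x = cnj (snd (ivp l q a b z) x)"
proof -
  have "schroedinger l (\<lambda>x. complex_of_real (q x) - cnj z) (\<lambda>x. cnj (fst (ivp l q a b z) x)) (\<lambda>x. cnj (snd (ivp l q a b z) x))"
    using schroedinger_cnj[OF ivp(1)[of z a b]] by simp
  from ivp_unique[OF this x] ivp_lincomb[OF x, of "cnj a" "cnj b" "cnj z"]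
  show "fst (ivp l q (cnj a) (cnj b) (cnj z)) x = cnj (fst (ivp l q a b z) x)"
    "snd (ivp l q (cnj a) (cnj b) (cnj z)) x = cnj (snd (ivp l q a b z) x)"
    by (simp_all add: ivp)
qed

lemma transfer_cnj:
  "tr11 l q (cnj z) = cnj (tr11 l q z)" "tr12 l q (cnj z) = cnj (tr12 l q z)"
  "tr21 l q (cnj z) = cnj (tr21 l q z)" "tr22 l q (cnj z) = cnj (tr22 l q z)"
  using ivp_cnj[of l 0 1 z] ivp_cnj[of l 1 0 z] l
  by (auto simp: tr11_def tr12_def tr21_def tr22_def)

lemma evp:
  "schroedinger l (\<lambda>x. complex_of_real (q x) - z) (fst (evp l q a b z)) (snd (evp l q a b z))"
  "fst (evp l q a b z) l = a" "snd (evp l q a b z) l = b"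
  "fst (evp l q a b z) 0 = tr11 l q z * a + tr12 l q z * b"
  "snd (evp l q a b z) 0 = tr21 l q z * a + tr22 l q z * b"
proof -
  show "schroedinger l (\<lambda>x. complex_of_real (q x) - z) (fst (evp l q a b z)) (snd (evp l q a b z))"
    unfolding evp_def by (rule ivp)
  have "l \<in> {0..l}" using l by auto
  note L = ivp_lincomb[OF this] 
  have "fst (evp l q a b z) l = (tr11 l q z * a + tr12 l q z * b) * tr22 l q z - (tr21 l q z * a + tr22 l q z * b) * tr12 l q z"
    unfolding evp_def by (subst L) (simp add: tr11_def tr12_def tr21_def tr22_def algebra_simps)
  also have "\<dots> = a * (tr11 l q z * tr22 l q z - tr12 l q z * tr21 l q z)" by (simp add: algebra_simps)
  finally show "fst (evp l q a b z) l = a" by (simp add: transfer_det)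
  have "snd (evp l q a b z) l = - (tr11 l q z * a + tr12 l q z * b) * tr21 l q z + (tr21 l q z * a + tr22 l q z * b) * tr11 l q z"
    unfolding evp_def by (subst L) (simp add: tr11_def tr12_def tr21_def tr22_def algebra_simps)
  also have "\<dots> = b * (tr11 l q z * tr22 l q z - tr12 l q z * tr21 l q z)" by (simp add: algebra_simps)
  finally show "snd (evp l q a b z) l = b" by (simp add: transfer_det)
qed (simp_all add: evp_def ivp)

lemma evp_continuous: "continuous_on {0..l} (fst (evp l q a b z))" "continuous_on {0..l} (snd (evp l q a b z))"
  using schroedinger_continuous[OF evp(1)] by auto

lemma evp_unique:
  assumes y: "schroedinger l (\<lambda>x. complex_of_real (q x) - z) y y'" and x: "x \<in> {0..l}"
  shows "y x = fst (evp l q (y l) (y' l) z) x" "y' x = snd (evp l q (y l) (y' l) z) x"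
proof -
  have L: "l \<in> {0..l}" using l by auto
  have w: "tr11 l q z * tr22 l q z - tr12 l q z * tr21 l q z = 1" by (rule transfer_det)
  have yl: "y l = y 0 * tr22 l q z - y' 0 * tr12 l q z" "y' l = - y 0 * tr21 l q z + y' 0 * tr11 l q z"
    using ivp_unique[OF y L] by (simp_all add: tr11_def tr12_def tr21_def tr22_def)
  have "tr11 l q z * y l + tr12 l q z * y' l = y 0 * (tr11 l q z * tr22 l q z - tr12 l q z * tr21 l q z)"
    unfolding yl by (simp add: algebra_simps)
  moreover have "tr21 l q z * y l + tr22 l q z * y' l = y' 0 * (tr11 l q z * tr22 l q z - tr12 l q z * tr21 l q z)"
    unfolding yl by (simp add: algebra_simps)
  ultimately have "evp l q (y l) (y' l) z = ivp l q (y 0) (y' 0) z"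
    unfolding evp_def w by simp
  thus "y x = fst (evp l q (y l) (y' l) z) x" "y' x = snd (evp l q (y l) (y' l) z) x"
    using ivp_unique[OF y x] ivp_lincomb[OF x, of "y 0" "y' 0" z] by simp_all
qed

lemma evp_scale:
  assumes "x \<in> {0..l}"
  shows "fst (evp l q (c * a) (c * b) z) x = c * fst (evp l q a b z) x"
   "fst (evp l q (a + a') (b + b') z) x = fst (evp l q a b z) x + fst (evp l q a' b' z) x"
proof -
  have "fst (evp l q a b z) x = (tr11 l q z * a + tr12 l q z * b) * fst (ivp l q 1 0 z) x
      + (tr21 l q z * a + tr22 l q z * b) * fst (ivp l q 0 1 z) x" for a b
    unfolding evp_def by (rule ivp_lincomb[OF assms])
  thus "fst (evp l q (c * a) (c * b) z) x = c * fst (evp l q a b z) x"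
   "fst (evp l q (a + a') (b + b') z) x = fst (evp l q a b z) x + fst (evp l q a' b' z) x"
    by (simp_all add: algebra_simps)
qed

section \<open>Green's formula and the Nevanlinna property\<close>

lemma evp_green:
  "(a * b' - b * a') - (fst (evp l q a b z) 0 * snd (evp l q a' b' w) 0 - snd (evp l q a b z) 0 * fst (evp l q a' b' w) 0)
    = (z - w) * integral {0..l} (\<lambda>x. fst (evp l q a b z) x * fst (evp l q a' b' w) x)"
proof -
  have "l \<in> {0..l}" using l by auto
  from has_ac_derivative_integral[OF schroedinger_green[OF evp(1)[of z a b] evp(1)[of w a' b']] this] l
  show ?thesis by (simp add: evp(2,3))
qed

end

context edge_potential begin

lemma evp_cnj:
  assumes "x \<in> {0..l}"
  shows "fst (evp l q (cnj a) (cnj b) (cnj z)) x = cnj (fst (evp l q a b z) x)"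
    and "snd (evp l q (cnj a) (cnj b) (cnj z)) x = cnj (snd (evp l q a b z) x)"
  using ivp_cnj[OF assms] by (simp_all add: evp_def transfer_cnj flip: complex_cnj_mult complex_cnj_add)

text \<open>Conjugate data at the conjugate parameter give the conjugate solution, so the integral
  is the squared norm of the solution. It is positive if \<open>a \<noteq> 0\<close>, because the
  continuous integrand is then nonzero at \<open>l\<close>.\<close>

lemma evp_norm_integral:
  "\<exists>r\<ge>0. (a \<noteq> 0 \<longrightarrow> r > 0) \<and>
    integral {0..l} (\<lambda>x. fst (evp l q a b z) x * fst (evp l q (cnj a) (cnj b) (cnj z)) x) = complex_of_real r"
proof -
  let ?y = "fst (evp l q a b z)"
  let ?n = "\<lambda>x. (norm (?y x))\<^sup>2"
  have c: "continuous_on {0..l} ?n" by (intro continuous_intros evp_continuous)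
  have "integral {0..l} (\<lambda>x. ?y x * fst (evp l q (cnj a) (cnj b) (cnj z)) x) = integral {0..l} (\<lambda>x. complex_of_real (?n x))"
    by (intro integral_cong) (simp only: evp_cnj complex_norm_square)
  also have "\<dots> = complex_of_real (integral {0..l} ?n)"
    using integral_linear[OF integrable_continuous_real[OF c] bounded_linear_of_real[where 'a=complex]]
    by (simp add: o_def)
  finally have 1: "integral {0..l} (\<lambda>x. ?y x * fst (evp l q (cnj a) (cnj b) (cnj z)) x) = complex_of_real (integral {0..l} ?n)" .
  have 2: "integral {0..l} ?n \<ge> 0"
    by (intro Henstock_Kurzweil_Integration.integral_nonneg integrable_continuous_real c) auto
  have 3: "integral {0..l} ?n > 0" if "a \<noteq> 0"
  proof -
    have "integral {0..l} ?n \<noteq> 0"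
    proof
      assume "integral {0..l} ?n = 0"
      hence "(?n has_integral 0) (cbox 0 l)"
        using integrable_integral[OF integrable_continuous_real[OF c]] by simp
      hence "?n l = 0" using c l
        by (intro has_integral_0_cbox_imp_0[of 0 l ?n]) auto
      thus False using that by (simp add: evp)
    qed
    thus ?thesis using 2 by simp
  qed
  from 1 2 3 show ?thesis by blast
qed

text \<open>
  The Nevanlinna property, at a real point and off the real axis: passing through an edge adds the squared
  norm of the solution on the edge, by Green's formula.
\<close>

lemma transfer_wronskian:
  assumes z0: "z0 \<in> \<real>" and P: "P holomorphic_on UNIV" "P z0 \<in> \<real>" and Q: "Q holomorphic_on UNIV" "Q z0 \<in> \<real>"
  defines "a \<equiv> \<lambda>z. tr11 l q z * P z + tr12 l q z * Q z" and "b \<equiv> \<lambda>z. tr21 l q z * P z + tr22 l q z * Q z"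
  obtains r where "r \<ge> 0" "P z0 \<noteq> 0 \<Longrightarrow> r > 0"
    "a z0 * deriv b z0 - deriv a z0 * b z0 = P z0 * deriv Q z0 - deriv P z0 * Q z0 + complex_of_real r"
proof -
  define g where "g = fst (evp l q (P z0) (Q z0) z0)"
  define I where "I z = integral {0..l} (\<lambda>x. fst (evp l q (P z) (Q z) z) x * g x)" for z
  have gc: "continuous_on {0..l} g" unfolding g_def by (rule evp_continuous)
  have ah: "a holomorphic_on UNIV" "b holomorphic_on UNIV"
    unfolding a_def b_def by (intro holomorphic_intros transfer_holomorphic P Q)+
  have l0: "l \<in> {0..l}" using l by auto
  \<comment> \<open>The data at the far end move with \<open>z\<close>. Expanding in the solutions
    with fixed initial data reduces the continuity of \<open>I\<close> to
    \<open>ivp_integral_isCont\<close>.\<close>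
  have Isum: "I z = a z * integral {0..l} (\<lambda>t. fst (ivp l q 1 0 z) t * g t) + b z * integral {0..l} (\<lambda>t. fst (ivp l q 0 1 z) t * g t)" for z
  proof -
    have i: "(\<lambda>t. fst (ivp l q c d z) t * g t) integrable_on {0..l}" for c d
      by (intro integrable_continuous_real continuous_intros ivp_continuous gc)
    have "I z = integral {0..l} (\<lambda>t. a z * (fst (ivp l q 1 0 z) t * g t) + b z * (fst (ivp l q 0 1 z) t * g t))"
      unfolding I_def evp_def by (intro integral_cong) (subst ivp_lincomb, auto simp: a_def b_def algebra_simps)
    also have "\<dots> = a z * integral {0..l} (\<lambda>t. fst (ivp l q 1 0 z) t * g t) + b z * integral {0..l} (\<lambda>t. fst (ivp l q 0 1 z) t * g t)"
      by (subst Henstock_Kurzweil_Integration.integral_add) (auto intro!: integrable_on_mult_right i)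
    finally show ?thesis .
  qed
  have Icont: "(I \<longlongrightarrow> I z0) (at z0)"
  proof -
    have "isCont a z0" "isCont b z0"
      using ah by (auto intro!: continuous_on_interior[of UNIV] holomorphic_on_imp_continuous_on)
    thus ?thesis unfolding Isum using ivp_integral_isCont[OF gc l0]
      by (intro tendsto_intros) (auto simp: isCont_def)
  qed
  \<comment> \<open>The Wronskian of the solutions for \<open>z\<close> and \<open>z0\<close>, far
    end minus near end. Green's formula makes it \<open>(z - z0) * I z\<close>, so its derivative at
    \<open>z0\<close> is \<open>I z0\<close>; differentiating the formula directly gives the
    Wronskians in the parameter.\<close>
  define f where "f z = (P z * Q z0 - Q z * P z0) - (a z * b z0 - b z * a z0)" for z
  have f: "f z = (z - z0) * I z" for z
    using evp_green[of "P z" "Q z0" "Q z" "P z0" z z0]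
    by (simp add: f_def I_def g_def evp(4,5) a_def b_def)
  have "(f has_field_derivative I z0) (at z0)"
    unfolding has_field_derivative_iff
    by (rule Lim_transform_eventually[OF Icont]) (auto simp: f eventually_at_filter)
  moreover have "(f has_field_derivative (deriv P z0 * Q z0 - deriv Q z0 * P z0) - (deriv a z0 * b z0 - deriv b z0 * a z0)) (at z0)"
  proof -
    have D: "(h has_field_derivative deriv h z0) (at z0)" if "h holomorphic_on UNIV" for h
      using that holomorphic_derivI by blast
    show ?thesis unfolding f_def
      by (rule derivative_eq_intros D P Q ah refl | simp)+
  qed
  ultimately have "I z0 = (deriv P z0 * Q z0 - deriv Q z0 * P z0) - (deriv a z0 * b z0 - deriv b z0 * a z0)"
    by (rule DERIV_unique)
  moreover obtain r where r: "r \<ge> 0" "P z0 \<noteq> 0 \<Longrightarrow> r > 0" "I z0 = complex_of_real r"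
    using evp_norm_integral[of "P z0" "Q z0" z0] z0 P(2) Q(2) by (auto simp: I_def g_def Reals_cnj_iff)
  ultimately show ?thesis using that[of r] by (simp add: algebra_simps)
qed

lemma transfer_Im:
  fixes P Q z :: complex
  defines "a \<equiv> tr11 l q z * P + tr12 l q z * Q" and "b \<equiv> tr21 l q z * P + tr22 l q z * Q"
  obtains r where "r \<ge> 0" "P \<noteq> 0 \<Longrightarrow> r > 0" "Im (b * cnj a) = Im (Q * cnj P) + Im z * r"
proof -
  obtain r where r: "r \<ge> 0" "P \<noteq> 0 \<Longrightarrow> r > 0"
    "integral {0..l} (\<lambda>x. fst (evp l q P Q z) x * fst (evp l q (cnj P) (cnj Q) (cnj z)) x) = complex_of_real r"
    using evp_norm_integral[of P Q z] by blast
  have "(P * cnj Q - Q * cnj P) - (a * cnj b - b * cnj a) = (z - cnj z) * complex_of_real r"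
    using evp_green[of P "cnj Q" Q "cnj P" z "cnj z"]
    by (simp add: r evp(4,5) transfer_cnj a_def b_def)
  hence "Im ((P * cnj Q - Q * cnj P) - (a * cnj b - b * cnj a)) = Im ((z - cnj z) * complex_of_real r)" by simp
  hence "Im (b * cnj a) = Im (Q * cnj P) + Im z * r" by (simp add: algebra_simps)
  thus ?thesis using that r by blast
qed

end

section \<open>Asymptotics of the solutions for large spectral parameter\<close>

lemma norm_cos_sin_le:
  fixes z :: complex
  shows "norm (cos z) \<le> exp \<bar>Im z\<bar>" "norm (sin z) \<le> exp \<bar>Im z\<bar>"
proof -
  have e: "norm (exp (\<i> * z)) \<le> exp \<bar>Im z\<bar>" "norm (exp (- (\<i> * z))) \<le> exp \<bar>Im z\<bar>"
    by (simp_all add: norm_exp_eq_Re)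
  have "norm (exp (\<i> * z) + exp (- (\<i> * z))) \<le> exp \<bar>Im z\<bar> + exp \<bar>Im z\<bar>"
    by (rule order_trans[OF norm_triangle_ineq add_mono[OF e]])
  thus "norm (cos z) \<le> exp \<bar>Im z\<bar>" unfolding cos_exp_eq by (simp add: norm_divide)
  have "norm (exp (\<i> * z) - exp (- (\<i> * z))) \<le> exp \<bar>Im z\<bar> + exp \<bar>Im z\<bar>"
    by (rule order_trans[OF norm_triangle_ineq4 add_mono[OF e]])
  thus "norm (sin z) \<le> exp \<bar>Im z\<bar>" unfolding sin_exp_eq by (simp add: norm_divide norm_mult)
qed

lemma has_ac_derivative_C1:
  assumes "\<And>x. x \<in> {0..l} \<Longrightarrow> (f has_vector_derivative g x) (at x within {0..l})"
    and "continuous_on {0..l} g" and l: "0 \<le> l"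
  shows "has_ac_derivative l f g"
proof (rule has_ac_derivativeI[OF absolutely_integrable_continuous_real[OF assms(2)] _ l, where c="f 0"])
  fix x assume x: "x \<in> {0..l}"
  have "(g has_integral (f x - f 0)) {0..x}"
    using x by (intro fundamental_theorem_of_calculus has_vector_derivative_within_subset[OF assms(1)]) auto
  thus "f x = f 0 + integral {0..x} g" by (simp add: integral_unique)
qed

lemma fundamental_pair_free:
  assumes s: "s \<noteq> 0" and l: "0 \<le> l"
  shows "fundamental_pair l (\<lambda>_. - s\<^sup>2) (\<lambda>x. cos (s * of_real x)) (\<lambda>x. - s * sin (s * of_real x))
     (\<lambda>x. sin (s * of_real x) / s) (\<lambda>x. cos (s * of_real x))"
proof -
  have c: "((\<lambda>x. cos (s * of_real x)) has_vector_derivative - s * sin (s * of_real x)) (at x within A)" for x A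
    by (rule has_vector_derivative_real_field) (auto intro!: derivative_eq_intros)
  have d: "((\<lambda>x. - s * sin (s * of_real x)) has_vector_derivative - s\<^sup>2 * cos (s * of_real x)) (at x within A)" for x A
    by (rule has_vector_derivative_real_field) (auto intro!: derivative_eq_intros simp: power2_eq_square)
  have e: "((\<lambda>x. sin (s * of_real x) / s) has_vector_derivative cos (s * of_real x)) (at x within A)" for x A
    by (rule has_vector_derivative_real_field) (use s in \<open>auto intro!: derivative_eq_intros\<close>)
  have f: "((\<lambda>x. cos (s * of_real x)) has_vector_derivative - s\<^sup>2 * (sin (s * of_real x) / s)) (at x within A)" for x A
    using c[of x A] s by (simp add: power2_eq_square)
  show ?thesis unfolding fundamental_pair_def schroedinger_def
    by (intro conjI has_ac_derivative_C1 c d e f continuous_intros l) (use s in simp_all)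
qed

text \<open>The equation is a perturbation of the free one, \<open>y'' = - s\<^sup>2 y\<close>, by
  \<open>q\<close>. Here \<open>m\<close> bounds cosine and sine along the edge and \<open>B\<close>
  bounds the free solution. The sine-type solution carries a factor \<open>1 / s\<close>, which
  gives the gain in the first estimate; for the derivative this factor is compensated.\<close>

lemma (in edge_potential) ivp_asymptotics:
  assumes s: "s \<noteq> 0" and m: "exp (\<bar>Im s\<bar> * l) \<le> m"
    and big: "4 * m\<^sup>2 * integral {0..l} (\<lambda>x. \<bar>q x\<bar>) \<le> norm s"
    and B: "norm a * m + norm b * m / norm s \<le> B"
  shows "norm (fst (ivp l q a b (s\<^sup>2)) l - (a * cos (s * l) + b * sin (s * l) / s))
        \<le> 4 * m\<^sup>2 * integral {0..l} (\<lambda>x. \<bar>q x\<bar>) * B / norm s"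
    and "norm (snd (ivp l q a b (s\<^sup>2)) l - (- a * s * sin (s * l) + b * cos (s * l)))
        \<le> 4 * m\<^sup>2 * integral {0..l} (\<lambda>x. \<bar>q x\<bar>) * B"
proof -
  define N where "N = integral {0..l} (\<lambda>x. \<bar>q x\<bar>)"
  define y where "y = fst (ivp l q a b (s\<^sup>2))"
  define C where "C = (\<lambda>x. cos (s * complex_of_real x))"
  define S where "S = (\<lambda>x. sin (s * complex_of_real x) / s)"
  have m1: "m \<ge> 1" using m order_trans[of 1 "exp (\<bar>Im s\<bar> * l)" m] l by simp
  have N0: "N \<ge> 0" unfolding N_def using integral_norm_nonneg[of "{0..l}" q] by simp
  have tr: "norm (cos (s * complex_of_real x)) \<le> m" "norm (sin (s * complex_of_real x)) \<le> m" if "x \<in> {0..l}" for x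
  proof -
    have "exp \<bar>Im (s * complex_of_real x)\<bar> \<le> m"
      using that by (intro order_trans[OF _ m]) (auto simp: abs_mult intro!: mult_left_mono)
    thus "norm (cos (s * complex_of_real x)) \<le> m" "norm (sin (s * complex_of_real x)) \<le> m"
      using norm_cos_sin_le[of "s * complex_of_real x"] by linarith+
  qed
  have Cb: "norm (C x) \<le> m" and Sb: "norm (S x) \<le> m / norm s" if "x \<in> {0..l}" for x
    using tr[OF that] by (auto simp: C_def S_def norm_divide divide_right_mono)
  have cont: "continuous_on {0..l} y" "continuous_on {0..l} C" "continuous_on {0..l} S"
    unfolding y_def C_def S_def using s by (auto intro!: continuous_intros ivp_continuous(1))
  have qi: "(\<lambda>t. - complex_of_real (q t)) absolutely_integrable_on {0..l}"
    using set_integral_diff(1)[OF _ potential_integrable[of 0], of "\<lambda>_. 0"] by simp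
  have qN: "integral {0..l} (\<lambda>t. norm (- complex_of_real (q t))) = N" by (simp add: N_def)
  have qsub: "(\<lambda>t. (- s\<^sup>2 - (complex_of_real (q t) - s\<^sup>2)) * (y t * f t)) = (\<lambda>t. - complex_of_real (q t) * (y t * f t))" for f :: "real \<Rightarrow> complex"
    by simp
  have I: "norm (integral {0..x} (\<lambda>t. - complex_of_real (q t) * (y t * f t))) \<le> N * (Y * F)"
    if "x \<in> {0..l}" "continuous_on {0..l} f" "\<And>t. t \<in> {0..l} \<Longrightarrow> norm (f t) \<le> F"
      "\<And>t. t \<in> {0..l} \<Longrightarrow> norm (y t) \<le> Y" for x f F Y
  proof -
    have "Y \<ge> 0" using that(4)[OF that(1)] norm_ge_zero order_trans by blast
    thus ?thesis unfolding qN[symmetric] using cont that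
      by (intro integral_mult_norm_bound[OF qi]) (auto intro!: continuous_intros mult_mono simp: norm_mult)
  qed
  note V = variation_of_constants[OF fundamental_pair_free[OF s less_imp_le[OF l]] ivp(1)[of "s\<^sup>2" a b], folded C_def S_def y_def, unfolded qsub, unfolded ivp(3)]
  have y0: "y 0 = a" by (simp add: y_def ivp)
  have dec: "norm (y x - (a * C x + b * S x)) \<le> (2 * m\<^sup>2 * N / norm s) * Y"
    if x: "x \<in> {0..l}" and Y: "\<And>t. t \<in> {0..l} \<Longrightarrow> norm (y t) \<le> Y" for x Y
  proof -
    let ?IS = "integral {0..x} (\<lambda>t. - complex_of_real (q t) * (y t * S t))"
    let ?IC = "integral {0..x} (\<lambda>t. - complex_of_real (q t) * (y t * C t))"
    have "y x - (a * C x + b * S x) = ?IS * C x - ?IC * S x"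
      by (subst V(1)[OF x]) (simp add: y0 C_def S_def algebra_simps)
    also have "norm \<dots> \<le> N * (Y * (m / norm s)) * m + N * (Y * m) * (m / norm s)"
    proof (intro order_trans[OF norm_triangle_ineq4] add_mono)
      show "norm (?IS * C x) \<le> N * (Y * (m / norm s)) * m"
        unfolding norm_mult using I[OF x cont(3) Sb Y] Cb[OF x]
        by (rule mult_mono[OF _ _ order_trans[OF norm_ge_zero I[OF x cont(3) Sb Y]] norm_ge_zero])
      show "norm (?IC * S x) \<le> N * (Y * m) * (m / norm s)"
        unfolding norm_mult using I[OF x cont(2) Cb Y] Sb[OF x]
        by (rule mult_mono[OF _ _ order_trans[OF norm_ge_zero I[OF x cont(2) Cb Y]] norm_ge_zero])
    qed
    also have "\<dots> = (2 * m\<^sup>2 * N / norm s) * Y" by (simp add: power2_eq_square)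
    finally show ?thesis .
  qed
  have free: "norm (a * C x + b * S x) \<le> B" if x: "x \<in> {0..l}" for x
  proof -
    have "norm (a * C x + b * S x) \<le> norm a * m + norm b * (m / norm s)"
      using Cb[OF x] Sb[OF x]
      by (intro order_trans[OF norm_triangle_ineq] add_mono) (simp_all only: norm_mult mult_left_mono norm_ge_zero)
    thus ?thesis using B by simp
  qed
  have sn: "norm s > 0" using s by simp
  \<comment> \<open>Condition \<open>big\<close> makes the perturbation at most half of the maximum
    of \<open>norm (y x)\<close>, so this maximum can be absorbed.\<close>
  have Y: "norm (y x) \<le> 2 * B" if x: "x \<in> {0..l}" for x
  proof -
    have "continuous_on {0..l} (\<lambda>x. norm (y x))" by (intro continuous_intros cont)
    then obtain x0 where x0: "x0 \<in> {0..l}" "\<And>t. t \<in> {0..l} \<Longrightarrow> norm (y t) \<le> norm (y x0)"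
      using continuous_attains_sup[of "{0..l}"] l by force
    have "2 * m\<^sup>2 * N / norm s \<le> 1 / 2" using big sn by (simp add: N_def field_simps)
    hence "(2 * m\<^sup>2 * N / norm s) * norm (y x0) \<le> 1 / 2 * norm (y x0)" by (intro mult_right_mono) auto
    moreover have "norm (y x0) \<le> norm (a * C x0 + b * S x0) + norm (y x0 - (a * C x0 + b * S x0))"
      by (rule norm_triangle_sub)
    ultimately have "norm (y x0) \<le> 2 * B" using dec[OF x0(1,2)] free[OF x0(1)] by linarith
    thus ?thesis using x0(2)[OF x] by simp
  qed
  have lx: "l \<in> {0..l}" using l by auto
  show "norm (fst (ivp l q a b (s\<^sup>2)) l - (a * cos (s * l) + b * sin (s * l) / s)) \<le> 4 * m\<^sup>2 * integral {0..l} (\<lambda>x. \<bar>q x\<bar>) * B / norm s"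
    using dec[OF lx Y] by (simp add: y_def C_def S_def N_def algebra_simps)
  let ?IS = "integral {0..l} (\<lambda>t. - complex_of_real (q t) * (y t * S t))"
  let ?IC = "integral {0..l} (\<lambda>t. - complex_of_real (q t) * (y t * C t))"
  have "snd (ivp l q a b (s\<^sup>2)) l - (- a * s * sin (s * l) + b * cos (s * l)) = ?IS * (- s * sin (s * l)) - ?IC * cos (s * l)"
    by (subst V(2)[OF lx]) (simp add: y0 C_def S_def algebra_simps)
  also have "norm \<dots> \<le> N * (2 * B * (m / norm s)) * (norm s * m) + N * (2 * B * m) * m"
  proof (intro order_trans[OF norm_triangle_ineq4] add_mono)
    have "norm (- s * sin (s * complex_of_real l)) \<le> norm s * m"
      using tr(2)[OF lx] by (simp add: norm_mult mult_left_mono)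
    with I[OF lx cont(3) Sb Y] show "norm (?IS * (- s * sin (s * l))) \<le> N * (2 * B * (m / norm s)) * (norm s * m)"
      unfolding norm_mult[of ?IS]
      by (rule mult_mono[OF _ _ order_trans[OF norm_ge_zero I[OF lx cont(3) Sb Y]] norm_ge_zero])
    show "norm (?IC * cos (s * l)) \<le> N * (2 * B * m) * m"
      unfolding norm_mult using I[OF lx cont(2) Cb Y] tr(1)[OF lx]
      by (rule mult_mono[OF _ _ order_trans[OF norm_ge_zero I[OF lx cont(2) Cb Y]] norm_ge_zero])
  qed
  also have "\<dots> = 4 * m\<^sup>2 * N * B" using sn by (simp add: power2_eq_square)
  finally show "norm (snd (ivp l q a b (s\<^sup>2)) l - (- a * s * sin (s * l) + b * cos (s * l)))
        \<le> 4 * m\<^sup>2 * integral {0..l} (\<lambda>x. \<bar>q x\<bar>) * B" by (simp add: N_def)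
qed

section \<open>Solution spaces and characteristic functions of caterpillars\<close>

interpretation family: vector_space edge_scale
  by (rule vector_space_edge_scale)

text \<open>Extension by zero off the edge and off the interval, matching the normalisation in
  \<open>tree_solution\<close>.\<close>

definition on_edge :: "real \<Rightarrow> 'e \<Rightarrow> (real \<Rightarrow> complex) \<Rightarrow> 'e \<Rightarrow> real \<Rightarrow> complex" where
  "on_edge l e f = (\<lambda>j x. if j = e \<and> x \<in> {0..l} then f x else 0)"

text \<open>
  A caterpillar is read off its stalk, starting at the root: \<open>(True, e)\<close> is a stalk edge leading to
  the next stalk vertex, \<open>(False, e)\<close> is a pendant edge attached to the current one. For the part of
  the tree hanging at the current vertex, \<open>sol_space\<close> collects the triples \<open>(y, \<alpha>, \<beta>)\<close> where \<open>y\<close>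
  satisfies all conditions beyond this vertex, has the value \<open>\<alpha>\<close> there, and has \<open>\<beta>\<close> as the sum of the
  derivatives along the outgoing edges; \<open>charD\<close> and \<open>charN\<close> are the corresponding characteristic functions.
\<close>

fun sol_space :: "real \<Rightarrow> ('e \<Rightarrow> real \<Rightarrow> real) \<Rightarrow> complex \<Rightarrow> (bool \<times> 'e) list \<Rightarrow>
    (('e \<Rightarrow> real \<Rightarrow> complex) \<times> complex \<times> complex) set" where
  "sol_space l q z [] = {(0, t, 0) |t. True}"
| "sol_space l q z ((True, e) # os) =
     {(y + on_edge l e (fst (evp l (q e) a b z)), tr11 l (q e) z * a + tr12 l (q e) z * b,
        tr21 l (q e) z * a + tr22 l (q e) z * b) |y a b. (y, a, b) \<in> sol_space l q z os}"
| "sol_space l q z ((False, e) # os) =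
     {(y + on_edge l e (fst (evp l (q e) t 0 z)), a, b + tr21 l (q e) z * t) |y a b t.
        (y, a, b) \<in> sol_space l q z os \<and> a = tr11 l (q e) z * t}"

fun charD charN :: "real \<Rightarrow> ('e \<Rightarrow> real \<Rightarrow> real) \<Rightarrow> (bool \<times> 'e) list \<Rightarrow> complex \<Rightarrow> complex" where
  "charD l q [] = (\<lambda>z. 1)"
| "charN l q [] = (\<lambda>z. 0)"
| "charD l q ((True, e) # os) = (\<lambda>z. tr11 l (q e) z * charD l q os z + tr12 l (q e) z * charN l q os z)"
| "charN l q ((True, e) # os) = (\<lambda>z. tr21 l (q e) z * charD l q os z + tr22 l (q e) z * charN l q os z)"
| "charD l q ((False, e) # os) = (\<lambda>z. tr11 l (q e) z * charD l q os z)"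
| "charN l q ((False, e) # os) = (\<lambda>z. tr11 l (q e) z * charN l q os z + tr21 l (q e) z * charD l q os z)"

section \<open>Gluing solution spaces along an edge\<close>

text \<open>All boundary data are multiples of one pair \<open>(a, b)\<close>, realised by
  \<open>v\<close>; the elements of \<open>K\<close> contribute zero boundary data.\<close>

definition spanned_by where
  "spanned_by W K v a b \<longleftrightarrow> W = {(k + edge_scale t v, t * a, t * b) |k t. k \<in> K}"

lemma on_edge_scale: "edge_scale t (on_edge l e f) = on_edge l e (\<lambda>x. t * f x)"
  by (auto simp: edge_scale_def on_edge_def fun_eq_iff)

lemma on_edge_cong: "(\<And>x. x \<in> {0..l} \<Longrightarrow> f x = g x) \<Longrightarrow> on_edge l e f = on_edge l e g"
  by (auto simp: on_edge_def fun_eq_iff)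

lemma (in edge_potential) on_edge_evp_scale:
  "on_edge l e (fst (evp l q (t * a) (t * b) z)) = edge_scale t (on_edge l e (fst (evp l q a b z)))"
  unfolding on_edge_scale by (rule on_edge_cong) (rule evp_scale)

text \<open>If the solution vanishes, its derivative is constant by the equation and has integral
  zero, hence vanishes too.\<close>

lemma (in edge_potential) evp_eq_0_imp:
  assumes "\<And>x. x \<in> {0..l} \<Longrightarrow> fst (evp l q a b z) x = 0"
  shows "a = 0" "b = 0"
proof -
  show "a = 0" using assms[of l] l by (simp add: evp)
  let ?Q = "\<lambda>x. complex_of_real (q x) - z" and ?y = "fst (evp l q a b z)" and ?y' = "snd (evp l q a b z)"
  have y: "has_ac_derivative l ?y ?y'" "has_ac_derivative l ?y' (\<lambda>x. ?Q x * ?y x)"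
    using evp(1)[of z a b] by (auto simp: schroedinger_def)
  have c: "?y' x = ?y' 0" if "x \<in> {0..l}" for x
  proof -
    have "integral {0..x} (\<lambda>x. ?Q x * ?y x) = integral {0..x} (\<lambda>x. 0)"
      using that assms by (intro integral_cong) auto
    thus ?thesis using has_ac_derivative_integral[OF y(2) that] by simp
  qed
  have "integral {0..l} ?y' = integral {0..l} (\<lambda>x. ?y' 0)"
    by (intro integral_cong c)
  moreover have "integral {0..l} ?y' = 0"
    using has_ac_derivative_integral[OF y(1), of l] l assms[of l] assms[of 0] by simp
  ultimately have "?y' 0 = 0" using l by simp
  thus "b = 0" using c[of l] l by (simp add: evp)
qed

lemma (in edge_potential) spanned_by_stalk_edge:
  assumes "spanned_by W K v a b"
  shows "spanned_by {(y + on_edge l e (fst (evp l q a b z)), tr11 l q z * a + tr12 l q z * b,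
        tr21 l q z * a + tr22 l q z * b) |y a b. (y, a, b) \<in> W} K (v + on_edge l e (fst (evp l q a b z)))
        (tr11 l q z * a + tr12 l q z * b) (tr21 l q z * a + tr22 l q z * b)"
proof -
  have 1: "k + edge_scale t v + on_edge l e (fst (evp l q (t * a) (t * b) z))
      = k + edge_scale t (v + on_edge l e (fst (evp l q a b z)))" for k t
    by (simp add: on_edge_evp_scale family.scale_right_distrib add.assoc)
  have 2: "c * (t * a) + d * (t * b) = t * (c * a + d * b)" for c d t :: complex
    by (simp add: algebra_simps)
  show ?thesis
    using assms unfolding spanned_by_def
    by (auto simp: 1 2) (metis 1 2)+
qed

text \<open>Continuity at the vertex is one linear condition, \<open>s * a = tr11 l q z * t\<close>,
  on the scalars of the two glued parts. As its coefficients are not both zero, the solutions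
  \<open>(s, t)\<close> are the multiples of \<open>(tr11 l q z, a)\<close>.\<close>

lemma (in edge_potential) spanned_by_pendant_edge:
  fixes e :: 'e and z :: complex
  assumes W: "spanned_by W K v a b" and nz: "tr11 l q z \<noteq> 0 \<or> a \<noteq> 0"
  defines "u \<equiv> on_edge l e (fst (evp l q 1 0 z))"
  shows "spanned_by {(y + on_edge l e (fst (evp l q t 0 z)), a, b + tr21 l q z * t) |y a b t.
        (y, a, b) \<in> W \<and> a = tr11 l q z * t} K (edge_scale (tr11 l q z) v + edge_scale a u)
        (tr11 l q z * a) (tr11 l q z * b + tr21 l q z * a)"
    (is "spanned_by ?W' _ _ _ _")
proof -
  let ?c = "tr11 l q z" and ?c' = "tr21 l q z"
  have u: "on_edge l e (fst (evp l q t 0 z)) = edge_scale t u" for t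
    using on_edge_evp_scale[of e t 1 0 z] by (simp add: u_def)
  have "?W' = {(k + edge_scale s v + edge_scale t u, s * a, s * b + ?c' * t) |k s t. k \<in> K \<and> s * a = ?c * t}"
    unfolding W[unfolded spanned_by_def] u by blast
  also have "\<dots> = {(k + edge_scale r (edge_scale ?c v + edge_scale a u), r * (?c * a), r * (?c * b + ?c' * a)) |k r. k \<in> K}"
  proof (safe, goal_cases)
    case (1 _ _ _ k s t)
    obtain r where r: "s = r * ?c" "t = r * a"
    proof (cases "a = 0")
      case True
      thus ?thesis using that[of "s / ?c"] nz 1 by auto
    next
      case False
      thus ?thesis using that[of "t / a"] 1 by (auto simp: field_simps)
    qed
    show ?case
      by (rule exI[of _ k], rule exI[of _ r])
         (use 1 r in \<open>simp add: algebra_simps family.scale_right_distrib\<close>)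
  next
    case (2 _ _ _ k r)
    show ?case
      by (rule exI[of _ k], rule exI[of _ "r * ?c"], rule exI[of _ "r * a"])
         (use 2 in \<open>simp add: algebra_simps family.scale_right_distrib\<close>)
  qed
  finally show ?thesis unfolding spanned_by_def .
qed

text \<open>Both parts vanish at the vertex, so continuity is void and both scalars are free. The
  derivative sum is a linear functional of them: its kernel, spanned by
  \<open>(tr21 l q z, - b)\<close>, enlarges \<open>K\<close>, and \<open>(c1, p1)\<close> with
  functional value \<open>d\<close> supplies the new \<open>v\<close>.\<close>

lemma (in edge_potential) spanned_by_pendant_edge_degenerate:
  fixes e :: 'e and z :: complex
  assumes W: "spanned_by W K v 0 b" and z: "tr11 l q z = 0"
    and d: "d \<noteq> 0" "d = c1 * b + tr21 l q z * p1"
  defines "u \<equiv> on_edge l e (fst (evp l q 1 0 z))"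
  shows "spanned_by {(y + on_edge l e (fst (evp l q t 0 z)), a, b + tr21 l q z * t) |y a b t.
        (y, a, b) \<in> W \<and> a = tr11 l q z * t}
        {k + edge_scale r (edge_scale (tr21 l q z) v - edge_scale b u) |k r. k \<in> K}
        (edge_scale c1 v + edge_scale p1 u) 0 d"
    (is "spanned_by ?W' _ _ _ _")
proof -
  let ?c' = "tr21 l q z"
  have u: "on_edge l e (fst (evp l q t 0 z)) = edge_scale t u" for t
    using on_edge_evp_scale[of e t 1 0 z] by (simp add: u_def)
  have "?W' = {(k + edge_scale s v + edge_scale t u, s * 0, s * b + ?c' * t) |k s t. k \<in> K \<and> s * 0 = 0 * t}"
    unfolding W[unfolded spanned_by_def] u z by blast
  also have "\<dots> = {(k + edge_scale s v + edge_scale t u, 0, s * b + ?c' * t) |k s t. k \<in> K}"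
    by simp
  also have "\<dots> = {(k' + edge_scale s (edge_scale c1 v + edge_scale p1 u), s * 0, s * d) |k' s.
     k' \<in> {k + edge_scale r (edge_scale ?c' v - edge_scale b u) |k r. k \<in> K}}"
  proof (safe, goal_cases)
    case (1 _ _ _ k s t)
    \<comment> \<open>\<open>r\<close> and \<open>x\<close> are the coordinates of
      \<open>(s, t)\<close> in the basis \<open>(?c', - b)\<close>, \<open>(c1, p1)\<close>, found
      by Cramer's rule; the determinant is \<open>d\<close>.\<close>
    define x where "x = (s * b + ?c' * t) / d"
    define r where "r = (s * p1 - t * c1) / d"
    have "(r * ?c' + x * c1) * d = s * d" "(x * p1 - r * b) * d = t * d"
      unfolding x_def r_def using d(1) by (simp_all add: field_simps) (simp_all add: d(2) algebra_simps)
    hence e: "r * ?c' + x * c1 = s" "x * p1 - r * b = t" using d(1) by auto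
    have "k + edge_scale r (edge_scale ?c' v - edge_scale b u) + edge_scale x (edge_scale c1 v + edge_scale p1 u)
       = k + edge_scale s v + edge_scale t u"
      unfolding e[symmetric]
      by (simp add: algebra_simps family.scale_right_distrib family.scale_right_diff_distrib
          family.scale_left_distrib family.scale_left_diff_distrib)
    moreover have "x * d = s * b + ?c' * t" using d(1) by (simp add: x_def)
    ultimately show ?case using 1 by (intro exI[of _ "k + edge_scale r (edge_scale ?c' v - edge_scale b u)"] exI[of _ x]) auto
  next
    case (2 _ _ _ k' x k r)
    show ?case
    proof (rule exI[of _ k], rule exI[of _ "r * ?c' + x * c1"], rule exI[of _ "x * p1 - r * b"], intro conjI)
      have "k + edge_scale r (edge_scale ?c' v - edge_scale b u) + edge_scale x (edge_scale c1 v + edge_scale p1 u)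
       = k + edge_scale (r * ?c' + x * c1) v + edge_scale (x * p1 - r * b) u"
        by (simp add: algebra_simps family.scale_right_distrib family.scale_right_diff_distrib
          family.scale_left_distrib family.scale_left_diff_distrib)
      moreover have "x * d = (r * ?c' + x * c1) * b + ?c' * (x * p1 - r * b)" by (simp add: d(2) algebra_simps)
      ultimately show "(k + edge_scale r (edge_scale ?c' v - edge_scale b u) + edge_scale x (edge_scale c1 v + edge_scale p1 u), x * 0, x * d)
        = (k + edge_scale (r * ?c' + x * c1) v + edge_scale (x * p1 - r * b) u, 0, (r * ?c' + x * c1) * b + ?c' * (x * p1 - r * b))"
        by simp
    qed (use 2 in auto)
  qed
  finally show ?thesis unfolding spanned_by_def .
qed

section \<open>Multiplicities of eigenvalues\<close>

definition real_on_reals :: "(complex \<Rightarrow> complex) \<Rightarrow> bool" where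
  "real_on_reals f \<longleftrightarrow> (\<forall>z\<in>\<real>. f z \<in> \<real>)"

lemma real_on_realsD: "real_on_reals f \<Longrightarrow> z \<in> \<real> \<Longrightarrow> f z \<in> \<real>"
  by (simp add: real_on_reals_def)

text \<open>Division by a zero is a removable singularity. Realness of the quotient at
  \<open>z0\<close> itself follows by approaching \<open>z0\<close> along the real axis, since the
  reals are closed.\<close>

lemma entire_factor:
  assumes f: "f holomorphic_on UNIV" and z0: "f z0 = 0"
  obtains g where "g holomorphic_on UNIV" "\<And>z. f z = (z - z0) * g z" "g z0 = deriv f z0"
    "z0 \<in> \<real> \<Longrightarrow> real_on_reals f \<Longrightarrow> real_on_reals g"
proof -
  define g where "g z = (if z = z0 then deriv f z0 else (f z - f z0) / (z - z0))" for z
  have g: "g holomorphic_on UNIV"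
    unfolding g_def[abs_def] using f by (rule pole_lemma_open) auto
  have "real_on_reals g" if r: "z0 \<in> \<real>" "real_on_reals f"
  proof -
    have 1: "g z \<in> \<real>" if "z \<in> \<real>" "z \<noteq> z0" for z
      using that r real_on_realsD[OF r(2)] by (auto simp: g_def z0)
    have "(\<lambda>n. g (z0 + of_real (1 / real (Suc n)))) \<longlonglongrightarrow> g z0"
    proof -
      have "isCont g z0" using g
        by (auto intro!: continuous_on_interior[of UNIV] holomorphic_on_imp_continuous_on)
      moreover have "(\<lambda>n. z0 + of_real (1 / real (Suc n))) \<longlonglongrightarrow> z0 + of_real 0"
        by (intro tendsto_intros) (use lim_inverse_n' LIMSEQ_Suc in blast)
      ultimately show ?thesis using isCont_tendsto_compose by fastforce
    qed
    moreover have "g (z0 + of_real (1 / real (Suc n))) \<in> \<real>" for n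
    proof (rule 1)
      show "z0 + of_real (1 / real (Suc n)) \<in> \<real>" by (rule Reals_add[OF r(1) Reals_of_real])
      show "z0 + of_real (1 / real (Suc n)) \<noteq> z0" by (simp del: of_nat_Suc)
    qed
    ultimately have "g z0 \<in> \<real>"
      using closed_sequentially[OF closed_complex_Reals, of "\<lambda>n. g (z0 + of_real (1 / real (Suc n)))" "g z0"] by blast
    thus ?thesis using 1 unfolding real_on_reals_def by metis
  qed
  thus ?thesis using that[of g] g z0 by (auto simp: g_def)
qed

lemma (in edge_potential) transfer_real_on_reals:
  "real_on_reals (tr11 l q)" "real_on_reals (tr12 l q)" "real_on_reals (tr21 l q)" "real_on_reals (tr22 l q)"
  unfolding real_on_reals_def using transfer_cnj by (metis Reals_cnj_iff)+

text \<open>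
  \<open>B\<close> is a basis of the solutions whose value and derivative sum at the current vertex vanish. The characteristic
  functions have a common zero of order \<open>card B\<close>; the reduced pair \<open>(p, r)\<close> spans the remaining boundary values.
\<close>

definition regular_at where
  "regular_at l q os z0 B v p r \<longleftrightarrow>
     finite B \<and> family.independent B \<and> (\<forall>y\<in>insert v B. \<forall>j. j \<notin> snd ` set os \<longrightarrow> y j = (\<lambda>x. 0)) \<and>
     p holomorphic_on UNIV \<and> r holomorphic_on UNIV \<and> real_on_reals p \<and> real_on_reals r \<and>
     (\<forall>z. charD l q os z = (z - z0) ^ card B * p z) \<and> (\<forall>z. charN l q os z = (z - z0) ^ card B * r z) \<and>
     spanned_by (sol_space l q z0 os) (family.span B) v (p z0) (r z0) \<and>
     (\<exists>\<rho>>0. p z0 * deriv r z0 - deriv p z0 * r z0 = complex_of_real \<rho>)"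

lemma span_vanishes:
  assumes "\<And>y. y \<in> B \<Longrightarrow> y j = (\<lambda>x. 0)" "y \<in> family.span B"
  shows "y j = (\<lambda>x. 0)"
  using assms(2)
proof (induction rule: family.span_induct_alt)
  case base thus ?case by (simp add: zero_fun_def)
next
  case (step c x y) thus ?case using assms(1) by (auto simp: edge_scale_def fun_eq_iff plus_fun_def)
qed

lemma (in edge_potential) transfer_wronskian_leaf:
  assumes "z0 \<in> \<real>"
  obtains r where "r > 0" "tr11 l q z0 * deriv (tr21 l q) z0 - deriv (tr11 l q) z0 * tr21 l q z0 = complex_of_real r"
  using transfer_wronskian[OF assms, of "\<lambda>_. 1" "\<lambda>_. 0"] by auto

lemma regular_at_base:
  assumes "edge_potential l (q e)" and z0: "z0 \<in> \<real>"
  shows "regular_at l q [(True, e)] z0 {} (on_edge l e (fst (evp l (q e) 1 0 z0))) (tr11 l (q e)) (tr21 l (q e))"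
proof -
  interpret edge_potential l "q e" by fact
  have "spanned_by (sol_space l q z0 []) {0} 0 1 0"
    by (auto simp: spanned_by_def)
  from spanned_by_stalk_edge[OF this, of e z0]
  have "spanned_by (sol_space l q z0 [(True, e)]) {0} (on_edge l e (fst (evp l (q e) 1 0 z0))) (tr11 l (q e) z0) (tr21 l (q e) z0)"
    by simp
  moreover obtain r where "r > 0" "tr11 l (q e) z0 * deriv (tr21 l (q e)) z0 - deriv (tr11 l (q e)) z0 * tr21 l (q e) z0 = complex_of_real r"
    using transfer_wronskian_leaf[OF z0] by blast
  ultimately show ?thesis
    unfolding regular_at_def using transfer_holomorphic transfer_real_on_reals
    by (auto simp: on_edge_def fun_eq_iff family.independent_empty)
qed

text \<open>Solutions with zero data at the next vertex extend by zero over the edge, so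
  \<open>B\<close> is unchanged. The edge adds a nonnegative amount to the Wronskian, which stays
  positive.\<close>

lemma regular_at_stalk:
  assumes "edge_potential l (q e)" and z0: "z0 \<in> \<real>" and reg: "regular_at l q os z0 B v p r"
  shows "regular_at l q ((True, e) # os) z0 B (v + on_edge l e (fst (evp l (q e) (p z0) (r z0) z0)))
     (\<lambda>z. tr11 l (q e) z * p z + tr12 l (q e) z * r z) (\<lambda>z. tr21 l (q e) z * p z + tr22 l (q e) z * r z)"
    (is "regular_at _ _ _ _ _ ?v ?p ?r")
proof -
  interpret edge_potential l "q e" by fact
  from reg have p: "p holomorphic_on UNIV" "r holomorphic_on UNIV" "real_on_reals p" "real_on_reals r"
    and c: "\<And>z. charD l q os z = (z - z0) ^ card B * p z" "\<And>z. charN l q os z = (z - z0) ^ card B * r z"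
    and s: "spanned_by (sol_space l q z0 os) (family.span B) v (p z0) (r z0)"
    and B: "finite B" "family.independent B" "\<And>y j. y \<in> insert v B \<Longrightarrow> j \<notin> snd ` set os \<Longrightarrow> y j = (\<lambda>x. 0)"
    by (auto simp: regular_at_def)
  from reg obtain \<rho> where \<rho>: "\<rho> > 0" "p z0 * deriv r z0 - deriv p z0 * r z0 = complex_of_real \<rho>"
    by (auto simp: regular_at_def)
  obtain \<rho>' where \<rho>': "\<rho>' \<ge> 0"
    "?p z0 * deriv ?r z0 - deriv ?p z0 * ?r z0 = p z0 * deriv r z0 - deriv p z0 * r z0 + complex_of_real \<rho>'"
    by (rule transfer_wronskian[OF z0 p(1) real_on_realsD[OF p(3) z0] p(2) real_on_realsD[OF p(4) z0]]) (rule that)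
  have "?p z0 * deriv ?r z0 - deriv ?p z0 * ?r z0 = complex_of_real (\<rho> + \<rho>')" using \<rho> \<rho>' by simp
  moreover have "\<rho> + \<rho>' > 0" using \<rho> \<rho>' by simp
  moreover have "?p holomorphic_on UNIV" "?r holomorphic_on UNIV"
    by (intro holomorphic_intros transfer_holomorphic p)+
  moreover have "real_on_reals ?p" "real_on_reals ?r"
    using p(3,4) transfer_real_on_reals by (auto simp: real_on_reals_def intro!: Reals_add Reals_mult)
  moreover have "spanned_by (sol_space l q z0 ((True, e) # os)) (family.span B) ?v (?p z0) (?r z0)"
    using spanned_by_stalk_edge[OF s, of e z0] by simp
  moreover have "y j = (\<lambda>x. 0)" if "y \<in> insert ?v B" "j \<notin> snd ` set ((True, e) # os)" for y j
    using that B(3)[of y j] B(3)[of v j] by (auto simp: on_edge_def)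
  moreover have "charD l q ((True, e) # os) z = (z - z0) ^ card B * ?p z"
    "charN l q ((True, e) # os) z = (z - z0) ^ card B * ?r z" for z
    by (simp_all add: c algebra_simps)
  ultimately show ?thesis unfolding regular_at_def using B(1,2) by (intro conjI allI ballI impI) blast+
qed

text \<open>If \<open>tr11\<close> and \<open>p\<close> do not both vanish at \<open>z0\<close>,
  \<open>B\<close> is kept and the Wronskian becomes a combination of the two old ones with square
  weights. If both vanish, their zeros are simple; one factor \<open>z - z0\<close> splits off both
  characteristic functions, and \<open>B\<close> gains exactly one element.\<close>

lemma regular_at_pendant:
  assumes "edge_potential l (q e)" and z0: "z0 \<in> \<real>" and reg: "regular_at l q os z0 B v p r" and e: "e \<notin> snd ` set os"
  shows "\<exists>B v p r. regular_at l q ((False, e) # os) z0 B v p r"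
proof -
  interpret edge_potential l "q e" by fact
  let ?c = "tr11 l (q e)" and ?c' = "tr21 l (q e)"
  let ?u = "on_edge l e (fst (evp l (q e) 1 0 z0))"
  from reg have p: "p holomorphic_on UNIV" "r holomorphic_on UNIV" "real_on_reals p" "real_on_reals r"
    and c: "\<And>z. charD l q os z = (z - z0) ^ card B * p z" "\<And>z. charN l q os z = (z - z0) ^ card B * r z"
    and s: "spanned_by (sol_space l q z0 os) (family.span B) v (p z0) (r z0)"
    and B: "finite B" "family.independent B" "\<And>y j. y \<in> insert v B \<Longrightarrow> j \<notin> snd ` set os \<Longrightarrow> y j = (\<lambda>x. 0)"
    by (auto simp: regular_at_def)
  from reg obtain \<rho> where \<rho>: "\<rho> > 0" "p z0 * deriv r z0 - deriv p z0 * r z0 = complex_of_real \<rho>"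
    by (auto simp: regular_at_def)
  obtain \<sigma> where \<sigma>: "\<sigma> > 0" "?c z0 * deriv ?c' z0 - deriv ?c z0 * ?c' z0 = complex_of_real \<sigma>"
    using transfer_wronskian_leaf[OF z0] by blast
  note h = transfer_holomorphic p(1,2)
  have D: "(f has_field_derivative deriv f z0) (at z0)" if "f holomorphic_on UNIV" for f
    using that holomorphic_derivI by blast
  have u0: "?u j = (\<lambda>x. 0)" if "j \<noteq> e" for j using that by (simp add: on_edge_def)
  have rr: "?c z0 \<in> \<real>" "p z0 \<in> \<real>" "?c' z0 \<in> \<real>" "r z0 \<in> \<real>"
    using transfer_real_on_reals p(3,4) z0 by (auto simp: real_on_reals_def)
  show ?thesis
  proof (cases "?c z0 \<noteq> 0 \<or> p z0 \<noteq> 0")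
    case True
    define v' where "v' = edge_scale (?c z0) v + edge_scale (p z0) ?u"
    define p' where "p' = (\<lambda>z. ?c z * p z)"
    define r' where "r' = (\<lambda>z. ?c z * r z + ?c' z * p z)"
    have "spanned_by (sol_space l q z0 ((False, e) # os)) (family.span B) v' (p' z0) (r' z0)"
      using spanned_by_pendant_edge[OF s True, of e] by (simp add: p'_def r'_def v'_def)
    moreover have "p' holomorphic_on UNIV" "r' holomorphic_on UNIV"
      unfolding p'_def r'_def by (intro holomorphic_intros h)+
    moreover have "real_on_reals p'" "real_on_reals r'"
      using p(3,4) transfer_real_on_reals by (auto simp: p'_def r'_def real_on_reals_def intro!: Reals_add Reals_mult)
    moreover have "y j = (\<lambda>x. 0)" if "y \<in> insert v' B" "j \<notin> snd ` set ((False, e) # os)" for y j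
      using that B(3)[of y j] B(3)[of v j] u0[of j] by (auto simp: v'_def edge_scale_def fun_eq_iff)
    moreover have "\<exists>\<tau>>0. p' z0 * deriv r' z0 - deriv p' z0 * r' z0 = complex_of_real \<tau>"
    proof -
      have "deriv p' z0 = deriv ?c z0 * p z0 + deriv p z0 * ?c z0"
        "deriv r' z0 = deriv ?c z0 * r z0 + deriv r z0 * ?c z0 + (deriv ?c' z0 * p z0 + deriv p z0 * ?c' z0)"
        unfolding p'_def r'_def
        by (rule DERIV_imp_deriv, (rule derivative_eq_intros D h refl | simp)+)+
      hence "p' z0 * deriv r' z0 - deriv p' z0 * r' z0
        = (?c z0)\<^sup>2 * (p z0 * deriv r z0 - deriv p z0 * r z0) + (p z0)\<^sup>2 * (?c z0 * deriv ?c' z0 - deriv ?c z0 * ?c' z0)"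
        unfolding p'_def r'_def by (simp add: algebra_simps power2_eq_square)
      also have "\<dots> = complex_of_real ((Re (?c z0))\<^sup>2 * \<rho> + (Re (p z0))\<^sup>2 * \<sigma>)"
        unfolding \<rho> \<sigma> using rr by simp
      finally have *: "p' z0 * deriv r' z0 - deriv p' z0 * r' z0 = complex_of_real ((Re (?c z0))\<^sup>2 * \<rho> + (Re (p z0))\<^sup>2 * \<sigma>)" .
      have "Re (?c z0) \<noteq> 0 \<or> Re (p z0) \<noteq> 0" using True rr by (metis of_real_0 of_real_Re)
      hence "(Re (?c z0))\<^sup>2 * \<rho> + (Re (p z0))\<^sup>2 * \<sigma> > 0"
        using \<rho>(1) \<sigma>(1) by (auto intro: add_pos_nonneg add_nonneg_pos)
      thus ?thesis using * by blast
    qed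
    moreover have "charD l q ((False, e) # os) z = (z - z0) ^ card B * p' z"
      "charN l q ((False, e) # os) z = (z - z0) ^ card B * r' z" for z
      by (simp_all add: c p'_def r'_def algebra_simps)
    ultimately have "regular_at l q ((False, e) # os) z0 B v' p' r'"
      unfolding regular_at_def using B(1,2) by (intro conjI allI ballI impI) blast+
    thus ?thesis by blast
  next
    case False
    hence c0: "?c z0 = 0" and p0: "p z0 = 0" by auto
    obtain c1 where c1: "c1 holomorphic_on UNIV" "\<And>z. ?c z = (z - z0) * c1 z" "c1 z0 = deriv ?c z0" "real_on_reals c1"
      using entire_factor[OF h(1) c0] z0 transfer_real_on_reals by metis
    obtain p1 where p1: "p1 holomorphic_on UNIV" "\<And>z. p z = (z - z0) * p1 z" "p1 z0 = deriv p z0" "real_on_reals p1"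
      using entire_factor[OF p(1) p0] z0 p(3) by metis
    have rr1: "c1 z0 \<in> \<real>" "p1 z0 \<in> \<real>" using c1(4) p1(4) z0 by (auto simp: real_on_reals_def)
    \<comment> \<open>At common zeros of \<open>p\<close> and \<open>tr11\<close> only one term of
      each Wronskian is left. The equal signs of the two exclude cancellation in
      \<open>r' z0\<close>.\<close>
    have V: "- (p1 z0 * r z0) = complex_of_real \<rho>" "- (c1 z0 * ?c' z0) = complex_of_real \<sigma>"
      using \<rho>(2) \<sigma>(2) c0 p0 by (simp_all add: c1(3) p1(3))
    have nz: "p1 z0 \<noteq> 0" "r z0 \<noteq> 0" "c1 z0 \<noteq> 0" "?c' z0 \<noteq> 0"
      using V \<rho>(1) \<sigma>(1) by auto
    define p' where "p' = (\<lambda>z. (z - z0) * (c1 z * p1 z))"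
    define r' where "r' = (\<lambda>z. c1 z * r z + ?c' z * p1 z)"
    define \<tau> where "\<tau> = (Re (c1 z0))\<^sup>2 * \<rho> + (Re (p1 z0))\<^sup>2 * \<sigma>"
    have \<tau>0: "\<tau> > 0"
    proof -
      have "Re (c1 z0) \<noteq> 0" using rr1 nz(3) by (metis of_real_0 of_real_Re)
      thus ?thesis unfolding \<tau>_def using \<rho>(1) \<sigma>(1) by (intro add_pos_nonneg) auto
    qed
    have "- (c1 z0 * p1 z0 * r' z0) = (c1 z0)\<^sup>2 * (- (p1 z0 * r z0)) + (p1 z0)\<^sup>2 * (- (c1 z0 * ?c' z0))"
      by (simp add: r'_def algebra_simps power2_eq_square)
    also have "\<dots> = complex_of_real \<tau>" unfolding V \<tau>_def using rr1 by simp
    finally have W: "- (c1 z0 * p1 z0 * r' z0) = complex_of_real \<tau>" .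
    hence r'0: "r' z0 \<noteq> 0" using \<tau>0 by auto
    define w where "w = edge_scale (?c' z0) v - edge_scale (r z0) ?u"
    define v' where "v' = edge_scale (c1 z0) v + edge_scale (p1 z0) ?u"
    have sp: "spanned_by (sol_space l q z0 ((False, e) # os)) {k + edge_scale t w |k t. k \<in> family.span B} v' 0 (r' z0)"
      using spanned_by_pendant_edge_degenerate[where b="r z0" and ?c1.0="c1 z0" and ?p1.0="p1 z0" and d="r' z0" and e=e, OF s[unfolded p0] c0 r'0]
      by (simp add: w_def v'_def r'_def)
    \<comment> \<open>The old solutions vanish on the new edge while \<open>w\<close> does not; this
      makes \<open>w\<close> independent of \<open>B\<close>.\<close>
    have we: "w e l \<noteq> 0"
      using B(3)[of v e] e nz(2) l by (simp add: w_def edge_scale_def on_edge_def evp)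
    have wB: "w \<notin> family.span B"
    proof
      assume "w \<in> family.span B"
      hence "w e = (\<lambda>x. 0)" using span_vanishes[of B e w] B(3) e by auto
      thus False using we by simp
    qed
    have wB': "w \<notin> B" using wB family.span_base by blast
    have span: "{k + edge_scale t w |k t. k \<in> family.span B} = family.span (insert w B)"
      unfolding family.span_insert
      by (auto, metis add_diff_cancel_right') (metis diff_add_cancel)
    have "deriv p' z0 = c1 z0 * p1 z0" unfolding p'_def
      by (rule DERIV_imp_deriv, (rule derivative_eq_intros D c1(1) p1(1) refl | simp)+)
    hence "\<exists>\<tau>>0. p' z0 * deriv r' z0 - deriv p' z0 * r' z0 = complex_of_real \<tau>"
      using W \<tau>0 by (auto simp: p'_def)
    moreover have "p' holomorphic_on UNIV" "r' holomorphic_on UNIV"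
      unfolding p'_def r'_def by (intro holomorphic_intros h c1(1) p1(1))+
    moreover have "real_on_reals p'" "real_on_reals r'"
      using p(3,4) c1(4) p1(4) z0 transfer_real_on_reals
      by (auto simp: p'_def r'_def real_on_reals_def intro!: Reals_add Reals_mult Reals_diff)
    moreover have "y j = (\<lambda>x. 0)" if "y \<in> insert v' (insert w B)" "j \<notin> snd ` set ((False, e) # os)" for y j
      using that B(3)[of y j] B(3)[of v j] u0[of j] by (auto simp: v'_def w_def edge_scale_def fun_eq_iff)
    moreover have "family.independent (insert w B)"
      using B(2) wB family.independent_insertI by blast
    moreover have "charD l q ((False, e) # os) z = (z - z0) ^ card (insert w B) * p' z"
      "charN l q ((False, e) # os) z = (z - z0) ^ card (insert w B) * r' z" for z
    proof -
      have "card (insert w B) = Suc (card B)" using B(1) wB' by simp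
      thus "charD l q ((False, e) # os) z = (z - z0) ^ card (insert w B) * p' z"
        "charN l q ((False, e) # os) z = (z - z0) ^ card (insert w B) * r' z"
        by (simp_all add: c c1(2) p1(2) p'_def r'_def distrib_left mult_ac)
    qed
    moreover have "spanned_by (sol_space l q z0 ((False, e) # os)) (family.span (insert w B)) v' (p' z0) (r' z0)"
      using sp[unfolded span] by (simp add: p'_def)
    ultimately have "regular_at l q ((False, e) # os) z0 (insert w B) v' p' r'"
      unfolding regular_at_def using B(1) by (intro conjI allI ballI impI) blast+
    thus ?thesis by blast
  qed
qed

text \<open>The induction starts at the last stalk edge: the constant pair \<open>(1, 0)\<close> of
  the empty list has Wronskian zero, and positivity first arises from an edge.\<close>

lemma regular_at_exists:
  assumes "os \<noteq> []" "fst (last os)" "distinct (map snd os)" "z0 \<in> \<real>"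
    and "\<And>e. e \<in> snd ` set os \<Longrightarrow> edge_potential l (q e)"
  shows "\<exists>B v p r. regular_at l q os z0 B v p r"
  using assms
proof (induction os)
  case (Cons x os)
  obtain b e where x: "x = (b, e)" by (cases x)
  show ?case
  proof (cases "os = []")
    case True
    thus ?thesis using regular_at_base[of l q e z0] Cons.prems by (auto simp: x)
  next
    case False
    hence "\<exists>B v p r. regular_at l q os z0 B v p r" using Cons by auto
    then obtain B v p r where reg: "regular_at l q os z0 B v p r" by blast
    have ep: "edge_potential l (q e)" using Cons.prems by (auto simp: x)
    have "e \<notin> snd ` set os" using Cons.prems by (auto simp: x)
    thus ?thesis using regular_at_stalk[of l q e, OF ep Cons.prems(4) reg] regular_at_pendant[of l q e, OF ep Cons.prems(4) reg]
      by (cases b) (auto simp: x)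
  qed
qed simp

text \<open>On the first stalk edge the elements of \<open>B\<close> vanish, whereas
  \<open>v\<close> does not: its boundary data \<open>(p z0, r z0)\<close> beyond that edge are
  nonzero because their Wronskian is. Hence \<open>v\<close> counts as an additional
  dimension.\<close>

lemma regular_at_root:
  assumes "fst (last ((True, e) # os))" "distinct (map snd ((True, e) # os))" "z0 \<in> \<real>"
    and ep: "\<And>e'. e' \<in> snd ` set ((True, e) # os) \<Longrightarrow> edge_potential l (q e')"
  shows "\<exists>B v p r. regular_at l q ((True, e) # os) z0 B v p r \<and> v \<notin> family.span B"
proof -
  interpret edge_potential l "q e" using ep by auto
  have E: "edge_potential l (q e)" by unfold_locales
  show ?thesis
  proof (cases "os = []")
    case True
    have "on_edge l e (fst (evp l (q e) 1 0 z0)) e l \<noteq> 0" using l by (simp add: on_edge_def evp)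
    hence "on_edge l e (fst (evp l (q e) 1 0 z0)) \<notin> family.span {}" by auto
    thus ?thesis using regular_at_base[of l q e, OF E assms(3)] True by blast
  next
    case False
    hence "\<exists>B v p r. regular_at l q os z0 B v p r"
      using assms by (intro regular_at_exists) auto
    then obtain B v p r where reg: "regular_at l q os z0 B v p r" by blast
    have B: "y e = (\<lambda>x. 0)" if "y \<in> insert v B" for y
      using reg that assms(2) by (auto simp: regular_at_def image_iff)
    let ?f = "fst (evp l (q e) (p z0) (r z0) z0)"
    have "v + on_edge l e ?f \<notin> family.span B"
    proof
      assume "v + on_edge l e ?f \<in> family.span B"
      hence "(v + on_edge l e ?f) e = (\<lambda>x. 0)" by (rule span_vanishes[rotated]) (rule B, simp)
      hence h: "v e x + on_edge l e ?f e x = 0" for x by (metis plus_fun_apply)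
      have "?f x = 0" if "x \<in> {0..l}" for x
        using h[of x] B[of v] that by (simp add: on_edge_def)
      from evp_eq_0_imp[OF this] have "p z0 = 0" "r z0 = 0" by auto
      thus False using reg by (auto simp: regular_at_def)
    qed
    thus ?thesis using regular_at_stalk[of l q e, OF E assms(3) reg] by blast
  qed
qed

section \<open>Dimensions of eigenspaces as orders of zeros\<close>

lemma zorder_power_mult:
  assumes "g holomorphic_on UNIV" "g z0 \<noteq> 0" "\<And>z. f z = (z - z0) ^ n * g z"
  shows "zorder f z0 = int n"
  by (rule zorder_eqI[of UNIV z0 g]) (use assms in auto)

text \<open>The boundary condition excludes \<open>v\<close> unless the reduced function
  \<open>p\<close> vanishes; in that case the zero of \<open>p\<close> is simple, so order and
  dimension both exceed \<open>card B\<close> by one.\<close>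

lemma dim_eq_zorder:
  assumes B: "finite B" "family.independent B" and p: "p holomorphic_on UNIV"
    and f: "\<And>z. f z = (z - z0) ^ card B * p z"
    and z: "p z0 = 0 \<Longrightarrow> v \<notin> family.span B \<and> deriv p z0 \<noteq> 0"
  shows "family.dim {k + edge_scale t v |k t. k \<in> family.span B \<and> t * p z0 = 0} = nat (zorder f z0)"
proof (cases "p z0 = 0")
  case False
  hence "{k + edge_scale t v |k t. k \<in> family.span B \<and> t * p z0 = 0} = family.span B"
    by auto
  thus ?thesis using B zorder_power_mult[OF p False f] by (simp add: family.dim_eq_card_independent)
next
  case True
  with z have v: "v \<notin> family.span B" "deriv p z0 \<noteq> 0" by auto
  obtain p1 where p1: "p1 holomorphic_on UNIV" "\<And>z. p z = (z - z0) * p1 z" "p1 z0 = deriv p z0"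
    using entire_factor[OF p True] by metis
  have "{k + edge_scale t v |k t. k \<in> family.span B \<and> t * p z0 = 0} = family.span (insert v B)"
    unfolding family.span_insert using True
    by (auto, metis add_diff_cancel_right') (metis diff_add_cancel)
  moreover have "family.independent (insert v B)" using B v family.independent_insertI by blast
  moreover have "v \<notin> B" using v family.span_base by blast
  moreover have "zorder f z0 = int (Suc (card B))"
    by (rule zorder_power_mult[OF p1(1)]) (use v p1 f in auto)
  ultimately show ?thesis using B by (simp add: family.dim_eq_card_independent)
qed

text \<open>Off the real axis the Nevanlinna sign is propagated along the list. Since neither
  characteristic function can vanish there, the degenerate gluing never occurs and no solution with
  zero boundary data is created. At the point \<open>\<i>\<close> this also shows that the functions
  are not identically zero.\<close>

lemma nonreal_point:
  assumes "os \<noteq> []" "fst (last os)" "Im z \<noteq> 0"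
    and "\<And>e. e \<in> snd ` set os \<Longrightarrow> edge_potential l (q e)"
  shows "\<exists>v. spanned_by (sol_space l q z os) {0} v (charD l q os z) (charN l q os z)
    \<and> Im z * Im (charN l q os z * cnj (charD l q os z)) > 0"
  using assms
proof (induction os)
  case (Cons x os)
  obtain b e where x: "x = (b, e)" by (cases x)
  interpret edge_potential l "q e" using Cons.prems by (auto simp: x)
  show ?case
  proof (cases "os = []")
    case True
    hence b: b using Cons.prems by (auto simp: x)
    have "spanned_by (sol_space l q z []) {0} 0 1 0"
      by (auto simp: spanned_by_def)
    from spanned_by_stalk_edge[OF this, of e z]
    have "spanned_by (sol_space l q z [(True, e)]) {0} (on_edge l e (fst (evp l (q e) 1 0 z))) (tr11 l (q e) z) (tr21 l (q e) z)"
      by simp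
    moreover obtain s where "s > 0" "Im (tr21 l (q e) z * cnj (tr11 l (q e) z)) = Im z * s"
      using transfer_Im[of 1 z 0] by auto
    moreover have "Im z * (Im z * s) > 0" if "s > 0" for s
      using that Cons.prems(3) by (simp add: mult.assoc[symmetric] zero_less_mult_iff)
        (metis linorder_neqE_linordered_idom)
    ultimately have "spanned_by (sol_space l q z [(True, e)]) {0} (on_edge l e (fst (evp l (q e) 1 0 z)))
        (charD l q [(True, e)] z) (charN l q [(True, e)] z)
      \<and> Im z * Im (charN l q [(True, e)] z * cnj (charD l q [(True, e)] z)) > 0"
      by simp
    moreover have "x # os = [(True, e)]" using True b x by simp
    ultimately show ?thesis by metis
  next
    case False
    hence "\<exists>v. spanned_by (sol_space l q z os) {0} v (charD l q os z) (charN l q os z)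
    \<and> Im z * Im (charN l q os z * cnj (charD l q os z)) > 0"
      by (rule Cons.IH) (use False Cons.prems in auto)
    then obtain v where v: "spanned_by (sol_space l q z os) {0} v (charD l q os z) (charN l q os z)"
      "Im z * Im (charN l q os z * cnj (charD l q os z)) > 0" by blast
    show ?thesis
    proof (cases b)
      case True
      obtain s where s: "s \<ge> 0" "Im (charN l q (x # os) z * cnj (charD l q (x # os) z))
         = Im (charN l q os z * cnj (charD l q os z)) + Im z * s"
        using transfer_Im[of "charD l q os z" z "charN l q os z"] by (auto simp: x True)
      have "Im z * Im (charN l q (x # os) z * cnj (charD l q (x # os) z)) > 0"
        unfolding s(2) using v(2) s(1) by (simp add: distrib_left add_pos_nonneg mult.assoc[symmetric] del: mult.assoc)
      moreover have "spanned_by (sol_space l q z (x # os)) {0}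
          (v + on_edge l e (fst (evp l (q e) (charD l q os z) (charN l q os z) z))) (charD l q (x # os) z) (charN l q (x # os) z)"
        using spanned_by_stalk_edge[OF v(1), of e z] by (simp add: x True)
      ultimately show ?thesis by blast
    next
      case b: False
      obtain s where s: "s > 0" "Im (tr21 l (q e) z * cnj (tr11 l (q e) z)) = Im z * s"
        using transfer_Im[of 1 z 0] by auto
      have nz: "tr11 l (q e) z \<noteq> 0" using s Cons.prems(3) by auto
      have "charN l q (x # os) z * cnj (charD l q (x # os) z)
        = of_real ((norm (tr11 l (q e) z))\<^sup>2) * (charN l q os z * cnj (charD l q os z))
        + of_real ((norm (charD l q os z))\<^sup>2) * (tr21 l (q e) z * cnj (tr11 l (q e) z))"
        unfolding complex_norm_square by (simp add: x b algebra_simps)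
      hence "Im (charN l q (x # os) z * cnj (charD l q (x # os) z))
        = (norm (tr11 l (q e) z))\<^sup>2 * Im (charN l q os z * cnj (charD l q os z)) + (norm (charD l q os z))\<^sup>2 * (Im z * s)"
        by (simp only: s(2)[symmetric]) (simp only: plus_complex.sel Im_complex_of_real Re_complex_of_real times_complex.sel)
      hence "Im z * Im (charN l q (x # os) z * cnj (charD l q (x # os) z))
        = (norm (tr11 l (q e) z))\<^sup>2 * (Im z * Im (charN l q os z * cnj (charD l q os z))) + (norm (charD l q os z))\<^sup>2 * ((Im z)\<^sup>2 * s)"
        by (simp only: power2_eq_square distrib_left mult_ac)
      also have "\<dots> > 0" by (rule add_pos_nonneg[OF mult_pos_pos[OF _ v(2)] mult_nonneg_nonneg]) (use nz s(1) in simp_all)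
      finally have "Im z * Im (charN l q (x # os) z * cnj (charD l q (x # os) z)) > 0" .
      moreover have "\<exists>v. spanned_by (sol_space l q z (x # os)) {0} v (charD l q (x # os) z) (charN l q (x # os) z)"
        using spanned_by_pendant_edge[OF v(1), of z e] nz by (auto simp: x b)
      ultimately show ?thesis by blast
    qed
  qed
qed simp

lemma entire_char:
  assumes "\<And>e. e \<in> snd ` set os \<Longrightarrow> edge_potential l (q e)"
  shows "charD l q os holomorphic_on UNIV \<and> charN l q os holomorphic_on UNIV"
  using assms
proof (induction os)
  case (Cons x os)
  obtain b e where x: "x = (b, e)" by (cases x)
  interpret edge_potential l "q e" using Cons.prems by (auto simp: x)
  have "charD l q os holomorphic_on UNIV" "charN l q os holomorphic_on UNIV" using Cons by auto
  thus ?case unfolding x by (cases b) (auto intro!: holomorphic_intros transfer_holomorphic)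
qed auto

lemma dim_sol_space_eq_zorder:
  assumes os: "os \<noteq> []" "fst (hd os)" "fst (last os)" "distinct (map snd os)"
    and ep: "\<And>e. e \<in> snd ` set os \<Longrightarrow> edge_potential l (q e)"
  shows "family.dim {y. \<exists>b. (y, 0, b) \<in> sol_space l q z os} = nat (zorder (charD l q os) z)"
    and "family.dim {y. \<exists>a. (y, a, 0) \<in> sol_space l q z os} = nat (zorder (charN l q os) z)"
proof -
  have *: "{y. \<exists>b. (y, 0, b) \<in> sol_space l q z os} = {k + edge_scale t v |k t. k \<in> K \<and> t * a = 0}"
    "{y. \<exists>a. (y, a, 0) \<in> sol_space l q z os} = {k + edge_scale t v |k t. k \<in> K \<and> t * b = 0}"
    if "spanned_by (sol_space l q z os) K v a b" for K v a b
    using that unfolding spanned_by_def by auto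
  have "family.dim {y. \<exists>b. (y, 0, b) \<in> sol_space l q z os} = nat (zorder (charD l q os) z) \<and>
    family.dim {y. \<exists>a. (y, a, 0) \<in> sol_space l q z os} = nat (zorder (charN l q os) z)"
  proof (cases "z \<in> \<real>")
    case True
    obtain e os' where e: "os = (True, e) # os'" using os by (cases os) auto
    obtain B v p r where reg: "regular_at l q os z B v p r" and v: "v \<notin> family.span B"
      using regular_at_root[of e os' z l q] os ep True unfolding e by blast
    from reg have s: "spanned_by (sol_space l q z os) (family.span B) v (p z) (r z)" by (simp add: regular_at_def)
    from reg have nz: "p z = 0 \<Longrightarrow> deriv p z \<noteq> 0" "r z = 0 \<Longrightarrow> deriv r z \<noteq> 0" by (auto simp: regular_at_def)
    show ?thesis unfolding *[OF s]
      using reg v nz by (intro conjI dim_eq_zorder) (auto simp: regular_at_def)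
  next
    case False
    hence "Im z \<noteq> 0" by (simp add: complex_is_Real_iff)
    from nonreal_point[OF os(1,3) this, of l q] ep obtain v where
      s: "spanned_by (sol_space l q z os) (family.span {}) v (charD l q os z) (charN l q os z)"
      and "Im z * Im (charN l q os z * cnj (charD l q os z)) > 0" by (auto simp: family.span_empty)
    hence "charD l q os z \<noteq> 0" "charN l q os z \<noteq> 0" by auto
    thus ?thesis unfolding *[OF s] using entire_char[of os l q] ep
      by (intro conjI dim_eq_zorder) (auto simp: family.independent_empty)
  qed
  thus "family.dim {y. \<exists>b. (y, 0, b) \<in> sol_space l q z os} = nat (zorder (charD l q os) z)"
    "family.dim {y. \<exists>a. (y, a, 0) \<in> sol_space l q z os} = nat (zorder (charN l q os) z)" by auto
qed

lemma char_nonzero: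
  assumes "os \<noteq> []" "fst (last os)" "\<And>e. e \<in> snd ` set os \<Longrightarrow> edge_potential l (q e)"
  shows "charD l q os \<i> \<noteq> 0" "charN l q os \<i> \<noteq> 0"
  using nonreal_point[OF assms(1,2), of \<i> l q] assms(3) by auto

section \<open>The limit polynomials\<close>

text \<open>
  With \<open>X = cos(sl)\<close>, the functions \<open>charD(s\<^sup>2)\<close> and \<open>charN(s\<^sup>2) / s\<close> are asymptotic to \<open>A(X)\<close> and \<open>sin(sl) R(X)\<close>.
\<close>

fun polyA polyR :: "bool list \<Rightarrow> complex poly" where
  "polyA [] = 1"
| "polyR [] = 0"
| "polyA (True # bs) = [:0, 1:] * polyA bs - [:1, 0, -1:] * polyR bs"
| "polyR (True # bs) = polyA bs + [:0, 1:] * polyR bs"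
| "polyA (False # bs) = [:0, 1:] * polyA bs"
| "polyR (False # bs) = [:0, 1:] * polyR bs + polyA bs"

fun children :: "bool list \<Rightarrow> nat" where
  "children [] = 0"
| "children (True # bs) = 1"
| "children (False # bs) = Suc (children bs)"

lemma bool_list_induct [case_names Nil True False]:
  assumes "P []" "\<And>bs. P bs \<Longrightarrow> P (True # bs)" "\<And>bs. P bs \<Longrightarrow> P (False # bs)"
  shows "P bs"
  using assms by (induction bs) (metis (full_types))+

lemma poly_polyA_1: "poly (polyA bs) 1 = 1"
  by (induction bs rule: bool_list_induct) auto

text \<open>With \<open>X\<close> the variable, the stalk step reads
  \<open>A' = X (A + X R) - R\<close> and \<open>X R' = X (A + X R)\<close>. So \<open>X R\<close>
  and \<open>A\<close> are compared in the same degree, where the ratio of coefficients is the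
  number of children; positivity of \<mu> prevents the leading term from cancelling.\<close>

lemma poly_pair_leading:
  "\<exists>\<mu>>0. coeff (polyA bs) (length bs) = complex_of_real \<mu> \<and> (\<forall>k>length bs. coeff (polyA bs) k = 0)
    \<and> coeff (pCons 0 (polyR bs)) (length bs) = of_nat (children bs) * complex_of_real \<mu>
    \<and> (\<forall>k>length bs. coeff (pCons 0 (polyR bs)) k = 0)"
proof (induction bs rule: bool_list_induct)
  case Nil show ?case by (rule exI[of _ 1]) simp
next
  case (True bs)
  then obtain \<mu> where \<mu>: "\<mu> > 0" "coeff (polyA bs) (length bs) = complex_of_real \<mu>" "\<And>k. k > length bs \<Longrightarrow> coeff (polyA bs) k = 0"
     "coeff (pCons 0 (polyR bs)) (length bs) = of_nat (children bs) * complex_of_real \<mu>"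
     "\<And>k. k > length bs \<Longrightarrow> coeff (pCons 0 (polyR bs)) k = 0" by blast
  have R0: "coeff (polyR bs) k = 0" if "k \<ge> length bs" for k using \<mu>(5)[of "Suc k"] that by simp
  have A': "polyA (True # bs) = pCons 0 (polyA bs + pCons 0 (polyR bs)) - polyR bs"
    and R': "pCons 0 (polyR (True # bs)) = pCons 0 (polyA bs + pCons 0 (polyR bs))"
    by (simp_all add: algebra_simps)
  have pos: "(1 + of_nat (children bs)) * \<mu> > 0" using \<mu>(1) by (simp add: add_pos_nonneg)
  show ?case
    by (rule exI[of _ "(1 + of_nat (children bs)) * \<mu>"], rule conjI[OF pos], unfold A' R')
       (use \<mu> R0 in \<open>auto simp: algebra_simps coeff_pCons split: nat.splits\<close>)
next
  case (False bs)
  then obtain \<mu> where \<mu>: "\<mu> > 0" "coeff (polyA bs) (length bs) = complex_of_real \<mu>" "\<And>k. k > length bs \<Longrightarrow> coeff (polyA bs) k = 0"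
     "coeff (pCons 0 (polyR bs)) (length bs) = of_nat (children bs) * complex_of_real \<mu>"
     "\<And>k. k > length bs \<Longrightarrow> coeff (pCons 0 (polyR bs)) k = 0" by blast
  have A': "polyA (False # bs) = pCons 0 (polyA bs)"
    and R': "pCons 0 (polyR (False # bs)) = pCons 0 (pCons 0 (polyR bs) + polyA bs)"
    by (simp_all add: algebra_simps)
  show ?case
    by (rule exI[of _ \<mu>], unfold A' R')
       (use \<mu> in \<open>auto simp: algebra_simps coeff_pCons split: nat.splits\<close>)
qed

lemma polyA_nonzero: "polyA bs \<noteq> 0"
  using poly_polyA_1[of bs] by auto

lemma degree_polyA: "degree (polyA bs) = length bs"
proof -
  obtain \<mu> where "\<mu> > 0" "coeff (polyA bs) (length bs) = complex_of_real \<mu>" "\<forall>k>length bs. coeff (polyA bs) k = 0"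
    using poly_pair_leading by blast
  thus ?thesis by (intro antisym degree_le le_degree) auto
qed

lemma children_eq:
  assumes "polyA bs = polyA bs'" "polyR bs = polyR bs'"
  shows "children bs = children bs'"
proof -
  have l: "length bs = length bs'" using degree_polyA[of bs] degree_polyA[of bs'] assms by simp
  obtain \<mu> \<mu>' where "\<mu> > 0" "coeff (polyA bs) (length bs) = complex_of_real \<mu>"
     "coeff (pCons 0 (polyR bs)) (length bs) = of_nat (children bs) * complex_of_real \<mu>"
     "coeff (polyA bs') (length bs') = complex_of_real \<mu>'"
     "coeff (pCons 0 (polyR bs')) (length bs') = of_nat (children bs') * complex_of_real \<mu>'"
    using poly_pair_leading[of bs] poly_pair_leading[of bs'] by blast
  thus ?thesis using l assms by (auto simp: of_nat_eq_iff)
qed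

lemma children_0_iff: "children bs = 0 \<longleftrightarrow> bs = []"
  by (cases bs rule: children.cases) auto

text \<open>
  The number of children of a vertex is the limit of \<open>X R / A\<close> at infinity. It tells whether the
  list begins with a stalk edge or with a pendant edge, and both recursion steps can be undone.
\<close>

lemma poly_pair_inj:
  assumes "bs = [] \<or> last bs" "bs' = [] \<or> last bs'" "polyA bs = polyA bs'" "polyR bs = polyR bs'"
  shows "bs = bs'"
  using assms
proof (induction bs arbitrary: bs' rule: bool_list_induct)
  case Nil
  thus ?case using children_eq[OF Nil(3,4)] children_0_iff[of bs'] by simp
next
  case (True bs)
  have c: "children bs' = 1" using children_eq[OF True(4,5)] by simp
  \<comment> \<open>A single child could also come from a lone pendant edge, but then the list would
    end with \<open>False\<close>.\<close>
  obtain cs where bs': "bs' = True # cs"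
    using c True(3) by (cases bs' rule: children.cases) (auto simp: children_0_iff split: if_splits)
  \<comment> \<open>The matrix of the stalk step has determinant \<open>X^2 + (1 - X^2) = 1\<close>,
    so its inverse has polynomial entries.\<close>
  have X: "A = [:0, 1:] * ([:0, 1:] * A - [:1, 0, -1:] * R) + [:1, 0, -1:] * (A + [:0, 1:] * R)"
    "R = [:0, 1:] * (A + [:0, 1:] * R) - ([:0, 1:] * A - [:1, 0, -1:] * R)" for A R :: "complex poly"
  proof -
    have e: "[:1, 0, -1:] = (1 - [:0, 1:] * [:0, 1:] :: complex poly)" by (simp add: one_pCons)
    show "A = [:0, 1:] * ([:0, 1:] * A - [:1, 0, -1:] * R) + [:1, 0, -1:] * (A + [:0, 1:] * R)"
      "R = [:0, 1:] * (A + [:0, 1:] * R) - ([:0, 1:] * A - [:1, 0, -1:] * R)"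
      unfolding e by (simp_all only: ring_distribs) (simp_all only: mult_ac mult_1 mult_1_right, simp_all)
  qed
  have A: "polyA ds = [:0, 1:] * polyA (True # ds) + [:1, 0, -1:] * polyR (True # ds)"
    and R: "polyR ds = [:0, 1:] * polyR (True # ds) - polyA (True # ds)" for ds
    unfolding polyA.simps polyR.simps by (rule X)+
  have e: "polyA (True # bs) = polyA (True # cs)" "polyR (True # bs) = polyR (True # cs)"
    using True(4,5) unfolding bs' .
  have "polyA bs = polyA cs" by (rule trans[OF A[of bs, unfolded e] A[of cs, symmetric]])
  moreover have "polyR bs = polyR cs" by (rule trans[OF R[of bs, unfolded e] R[of cs, symmetric]])
  moreover have "bs = [] \<or> last bs" "cs = [] \<or> last cs" using True(2,3) by (auto simp: bs' split: if_splits)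
  ultimately show ?case using True(1)[of cs] bs' by simp
next
  case (False bs)
  have ne: "bs \<noteq> []" using False(2) by auto
  hence c: "children bs' > 1" using children_eq[OF False(4,5)] children_0_iff[of bs] by simp
  obtain cs where bs': "bs' = False # cs" "cs \<noteq> []"
    using c by (cases bs' rule: children.cases) (auto simp flip: children_0_iff)
  have A: "polyA bs = polyA cs" using False(4) by (simp add: bs')
  moreover have "polyR bs = polyR cs" using False(5) A by (simp add: bs')
  moreover have "last bs" "last cs" using False(2,3) ne bs' by auto
  ultimately show ?case using False(1)[of cs] bs' by simp
qed

lemma poly_eq_smult_of_order_eq:
  fixes p q :: "complex poly"
  assumes "p \<noteq> 0" "q \<noteq> 0" "\<And>x. order x p = order x q"
  obtains c where "c \<noteq> 0" "p = smult c q"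
proof -
  have roots: "{z. poly p z = 0} = {z. poly q z = 0}"
    using assms by (auto simp: order_root)
  define m where "m = (\<Prod>z|poly q z = 0. [:-z, 1:] ^ order z q)"
  have "p = smult (lead_coeff p) m" "q = smult (lead_coeff q) m"
    using complex_poly_decompose[of p] complex_poly_decompose[of q] assms(3) roots by (simp_all add: m_def)
  moreover have "lead_coeff p \<noteq> 0" "lead_coeff q \<noteq> 0" using assms by auto
  ultimately have "p = smult (lead_coeff p / lead_coeff q) q"
    by (metis nonzero_divide_eq_eq smult_smult)
  thus ?thesis using that[of "lead_coeff p / lead_coeff q"] \<open>lead_coeff p \<noteq> 0\<close> \<open>lead_coeff q \<noteq> 0\<close> by simp
qed

text \<open>The roots determine the polynomials up to constants, which are fixed by the value at 1 and the leading coefficients.\<close>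

lemma poly_pair_determined:
  assumes "bs \<noteq> []" "hd bs" "last bs" "bs' \<noteq> []" "hd bs'" "last bs'"
    and "\<And>x. order x (polyA bs) = order x (polyA bs')" "\<And>x. order x (polyR bs) = order x (polyR bs')"
    and R: "polyR bs \<noteq> 0" "polyR bs' \<noteq> 0"
  shows "bs = bs'"
proof -
  obtain c where c: "polyA bs = smult c (polyA bs')"
    using poly_eq_smult_of_order_eq[OF polyA_nonzero polyA_nonzero] assms(7) by metis
  have "c = 1" using arg_cong[OF c, of "\<lambda>p. poly p 1"] by (simp add: poly_polyA_1)
  hence A: "polyA bs = polyA bs'" using c by simp
  obtain d where d: "polyR bs = smult d (polyR bs')"
    using poly_eq_smult_of_order_eq[OF R] assms(8) by metis
  have l: "length bs = length bs'" using degree_polyA[of bs] degree_polyA[of bs'] A by simp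
  \<comment> \<open>With a single child at the root, the coefficients of \<open>X R\<close> and of
    \<open>A\<close> in the top degree agree. Equality of the \<open>A\<close> therefore fixes the
    constant \<open>d\<close>.\<close>
  have ch: "children bs = 1" "children bs' = 1"
    using assms(1,2,4,5) by (cases bs rule: children.cases; cases bs' rule: children.cases; simp)+
  obtain \<mu> \<mu>' where m: "\<mu> > 0" "coeff (polyA bs) (length bs) = complex_of_real \<mu>"
     "coeff (pCons 0 (polyR bs)) (length bs) = complex_of_real \<mu>"
     "coeff (polyA bs') (length bs') = complex_of_real \<mu>'"
     "coeff (pCons 0 (polyR bs')) (length bs') = complex_of_real \<mu>'"
    using poly_pair_leading[of bs] poly_pair_leading[of bs'] ch by auto
  have "coeff (pCons 0 (polyR bs)) (length bs) = d * coeff (pCons 0 (polyR bs')) (length bs')"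
    unfolding d l by (simp add: coeff_pCons split: nat.splits)
  hence "d = 1" using m A l by auto
  hence "polyR bs = polyR bs'" using d by simp
  thus ?thesis using poly_pair_inj A assms by blast
qed

section \<open>Asymptotics of the characteristic functions\<close>

lemma entire_zorder:
  assumes f: "f holomorphic_on UNIV" and nz: "f a \<noteq> 0"
  obtains g r where "r > 0" "g holomorphic_on ball z r" "\<And>w. w \<in> ball z r \<Longrightarrow> f w = g w * (w - z) ^ nat (zorder f z)"
    "\<And>w. w \<in> ball z r \<Longrightarrow> g w \<noteq> 0" "zorder f z \<ge> 0" "f z = 0 \<longleftrightarrow> zorder f z > 0"
proof -
  have "\<exists>w\<in>UNIV. f w \<noteq> 0" using nz by blast
  note Z = zorder_exist_zero[of f UNIV z, OF f open_UNIV connected_UNIV UNIV_I this]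
  from conjunct2[OF Z] obtain r where r: "r > 0" "zor_poly f z holomorphic_on cball z r"
    "\<forall>w\<in>cball z r. f w = zor_poly f z w * (w - z) ^ nat (zorder f z) \<and> zor_poly f z w \<noteq> 0"
    by blast
  show ?thesis
  proof (rule that[OF r(1)])
    show "zor_poly f z holomorphic_on ball z r" using r(2) ball_subset_cball holomorphic_on_subset by blast
    show "f w = zor_poly f z w * (w - z) ^ nat (zorder f z)" "zor_poly f z w \<noteq> 0" if "w \<in> ball z r" for w
      using r(3) that ball_subset_cball by blast+
    show "zorder f z \<ge> 0" "f z = 0 \<longleftrightarrow> zorder f z > 0" using conjunct1[OF Z] by (auto split: if_splits)
  qed
qed

lemma entire_zero_iff:
  assumes "f holomorphic_on UNIV" "f a \<noteq> 0"
  shows "f z = 0 \<longleftrightarrow> zorder f z > 0"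
  by (rule entire_zorder[OF assms])

text \<open>Substituting a square preserves orders away from the branch point:
  \<open>(s + c)\<^sup>2 - (p + c)\<^sup>2\<close> is \<open>s - p\<close> times
  \<open>s + p + 2 * c\<close>, which is nonzero at \<open>p\<close>. The zero-free factor
  \<open>h\<close> normalises the growth in \<open>s\<close>.\<close>

lemma zorder_comp_square:
  assumes f: "f holomorphic_on UNIV" "f a \<noteq> 0" and h: "h holomorphic_on - {0}" "\<And>s. s \<noteq> 0 \<Longrightarrow> h s \<noteq> 0"
    and p: "p + c \<noteq> 0"
  shows "zorder (\<lambda>s. f ((s + c)\<^sup>2) * h (s + c)) p = zorder f ((p + c)\<^sup>2)"
proof -
  define z where "z = (p + c)\<^sup>2"
  obtain g r where g: "r > 0" "g holomorphic_on ball z r"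
    "\<And>w. w \<in> ball z r \<Longrightarrow> f w = g w * (w - z) ^ nat (zorder f z)"
    "\<And>w. w \<in> ball z r \<Longrightarrow> g w \<noteq> 0" "zorder f z \<ge> 0"
    using entire_zorder[OF f, of z] by metis
  define n where "n = nat (zorder f z)"
  define S where "S = (\<lambda>s. (s + c)\<^sup>2) -` ball z r \<inter> - {- c}"
  have "open S" unfolding S_def
    by (intro open_Int open_vimage continuous_intros) auto
  moreover have "p \<in> S" using p g(1) by (auto simp: S_def z_def add_eq_0_iff)
  moreover have "(\<lambda>s. g ((s + c)\<^sup>2) * (s + p + 2 * c) ^ n * h (s + c)) holomorphic_on S"
  proof (intro holomorphic_intros)
    have "(\<lambda>s. (s + c)\<^sup>2) holomorphic_on S" by (intro holomorphic_intros)
    thus "(\<lambda>s. g ((s + c)\<^sup>2)) holomorphic_on S"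
      using holomorphic_on_compose_gen[OF _ g(2)] by (fastforce simp: S_def o_def)
    have "(\<lambda>s. s + c) holomorphic_on S" by (intro holomorphic_intros)
    thus "(\<lambda>s. h (s + c)) holomorphic_on S"
      using holomorphic_on_compose_gen[OF _ h(1)] by (fastforce simp: S_def o_def add_eq_0_iff)
  qed
  moreover have "g ((p + c)\<^sup>2) * (p + p + 2 * c) ^ n * h (p + c) \<noteq> 0"
  proof -
    have "p + p + 2 * c = 2 * (p + c)" by simp
    hence "p + p + 2 * c \<noteq> 0" using p by (metis mult_eq_0_iff zero_neq_numeral)
    thus ?thesis using g(4)[of "(p + c)\<^sup>2"] g(1) h(2)[OF p] by (simp add: z_def)
  qed
  moreover have "f ((s + c)\<^sup>2) * h (s + c) = g ((s + c)\<^sup>2) * (s + p + 2 * c) ^ n * h (s + c) * (s - p) powi int n"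
    if "s \<in> S" for s
  proof -
    have "(s + c)\<^sup>2 - z = (s + p + 2 * c) * (s - p)" by (simp add: z_def power2_eq_square algebra_simps)
    thus ?thesis using g(3)[of "(s + c)\<^sup>2", folded n_def] that by (simp add: S_def power_mult_distrib)
  qed
  ultimately have "zorder (\<lambda>s. f ((s + c)\<^sup>2) * h (s + c)) p = int n"
    using zorder_eqI[of S p "\<lambda>s. g ((s + c)\<^sup>2) * (s + p + 2 * c) ^ n * h (s + c)" "\<lambda>s. f ((s + c)\<^sup>2) * h (s + c)" "int n"] by blast
  thus ?thesis using g(5) by (simp add: n_def z_def)
qed

section \<open>Uniform approximation in horizontal strips\<close>

text \<open>Agreement up to an error of order \<open>1 / norm s\<close> on the strip of half-width
  \<open>H\<close>. Boundedness of \<open>g\<close> is included so that the relation is closed under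
  products.\<close>

definition strip_approx :: "real \<Rightarrow> (complex \<Rightarrow> complex) \<Rightarrow> (complex \<Rightarrow> complex) \<Rightarrow> bool" where
  "strip_approx H f g \<longleftrightarrow> (\<exists>M. \<forall>s. \<bar>Im s\<bar> \<le> H \<longrightarrow> norm (g s) \<le> M) \<and>
     (\<exists>K R. R > 0 \<and> (\<forall>s. \<bar>Im s\<bar> \<le> H \<longrightarrow> R \<le> norm s \<longrightarrow> norm (f s - g s) \<le> K / norm s))"

lemma strip_approx_const: "strip_approx H (\<lambda>_. c) (\<lambda>_. c)"
  unfolding strip_approx_def
  by (intro conjI, rule exI[of _ "norm c"], simp, rule exI[of _ 0], rule exI[of _ 1], simp)

lemma strip_approx_cong:
  assumes "strip_approx H f g" "\<And>s. s \<noteq> 0 \<Longrightarrow> f' s = f s" "\<And>s. g' s = g s"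
  shows "strip_approx H f' g'"
proof -
  obtain K R where "R > 0" "\<forall>s. \<bar>Im s\<bar> \<le> H \<longrightarrow> R \<le> norm s \<longrightarrow> norm (f s - g s) \<le> K / norm s"
    using assms(1) by (auto simp: strip_approx_def)
  moreover have "f' s = f s" if "R \<le> norm s" for s
  proof (rule assms(2))
    show "s \<noteq> 0" using that \<open>R > 0\<close> by auto
  qed
  ultimately have "\<exists>K R. R > 0 \<and> (\<forall>s. \<bar>Im s\<bar> \<le> H \<longrightarrow> R \<le> norm s \<longrightarrow> norm (f' s - g' s) \<le> K / norm s)"
    unfolding assms(3) by (intro exI[of _ K] exI[of _ R]) auto
  thus ?thesis using assms(1) unfolding strip_approx_def assms(3) by blast
qed

lemma strip_approx_add:
  assumes "strip_approx H f g" "strip_approx H f' g'"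
  shows "strip_approx H (\<lambda>s. f s + f' s) (\<lambda>s. g s + g' s)"
proof -
  obtain M M' where M: "\<And>s. \<bar>Im s\<bar> \<le> H \<Longrightarrow> norm (g s) \<le> M" "\<And>s. \<bar>Im s\<bar> \<le> H \<Longrightarrow> norm (g' s) \<le> M'"
    using assms unfolding strip_approx_def by blast
  obtain K R K' R' where K: "R > 0" "\<And>s. \<bar>Im s\<bar> \<le> H \<Longrightarrow> R \<le> norm s \<Longrightarrow> norm (f s - g s) \<le> K / norm s"
    "R' > 0" "\<And>s. \<bar>Im s\<bar> \<le> H \<Longrightarrow> R' \<le> norm s \<Longrightarrow> norm (f' s - g' s) \<le> K' / norm s"
    using assms unfolding strip_approx_def by blast
  have "norm (g s + g' s) \<le> M + M'" if "\<bar>Im s\<bar> \<le> H" for s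
    using norm_triangle_mono[OF M(1)[OF that] M(2)[OF that]] .
  moreover have "norm (f s + f' s - (g s + g' s)) \<le> (K + K') / norm s" if "\<bar>Im s\<bar> \<le> H" "max R R' \<le> norm s" for s
    using norm_triangle_mono[OF K(2)[of s] K(4)[of s]] that by (simp add: algebra_simps add_divide_distrib)
  ultimately show ?thesis unfolding strip_approx_def using K(1)
    by (intro conjI exI[of _ "M + M'"] exI[of _ "K + K'"] exI[of _ "max R R'"]) auto
qed

lemma strip_approx_mult:
  assumes "strip_approx H f g" "strip_approx H f' g'"
  shows "strip_approx H (\<lambda>s. f s * f' s) (\<lambda>s. g s * g' s)"
proof -
  obtain M0 M0' where M0: "\<And>s. \<bar>Im s\<bar> \<le> H \<Longrightarrow> norm (g s) \<le> M0" "\<And>s. \<bar>Im s\<bar> \<le> H \<Longrightarrow> norm (g' s) \<le> M0'"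
    using assms unfolding strip_approx_def by blast
  obtain K0 R K0' R' where K0: "R > 0" "\<And>s. \<bar>Im s\<bar> \<le> H \<Longrightarrow> R \<le> norm s \<Longrightarrow> norm (f s - g s) \<le> K0 / norm s"
    "R' > 0" "\<And>s. \<bar>Im s\<bar> \<le> H \<Longrightarrow> R' \<le> norm s \<Longrightarrow> norm (f' s - g' s) \<le> K0' / norm s"
    using assms unfolding strip_approx_def by blast
  define M M' K K' where "M = \<bar>M0\<bar>" and "M' = \<bar>M0'\<bar>" and "K = \<bar>K0\<bar>" and "K' = \<bar>K0'\<bar>"
  have pos: "M \<ge> 0" "M' \<ge> 0" "K \<ge> 0" "K' \<ge> 0" by (auto simp: M_def M'_def K_def K'_def)
  have M: "norm (g s) \<le> M" "norm (g' s) \<le> M'" if "\<bar>Im s\<bar> \<le> H" for s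
    using M0[OF that] by (auto simp: M_def M'_def)
  have K: "norm (f s - g s) \<le> K / norm s" if "\<bar>Im s\<bar> \<le> H" "R \<le> norm s" for s
    using K0(2)[OF that] by (rule order_trans) (auto simp: K_def intro!: divide_right_mono)
  have K': "norm (f' s - g' s) \<le> K' / norm s" if "\<bar>Im s\<bar> \<le> H" "R' \<le> norm s" for s
    using K0(4)[OF that] by (rule order_trans) (auto simp: K'_def intro!: divide_right_mono)
  have "norm (g s * g' s) \<le> M * M'" if "\<bar>Im s\<bar> \<le> H" for s
    unfolding norm_mult using M[OF that] pos by (intro mult_mono) auto
  moreover have "norm (f s * f' s - g s * g' s) \<le> (K * (M' + K' / R') + M * K') / norm s"
    if s: "\<bar>Im s\<bar> \<le> H" "max R R' \<le> norm s" for s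
  proof -
    have "K' / norm s \<le> K' / R'" using s K0(3) pos by (intro divide_left_mono) (auto intro!: mult_pos_pos)
    hence f': "norm (f' s) \<le> M' + K' / R'"
      using norm_triangle_sub[of "f' s" "g' s"] M(2)[OF s(1)] K'[of s] s by simp
    have "f s * f' s - g s * g' s = (f s - g s) * f' s + g s * (f' s - g' s)" by (simp add: algebra_simps)
    also have "norm \<dots> \<le> (K / norm s) * (M' + K' / R') + M * (K' / norm s)"
    proof (intro order_trans[OF norm_triangle_ineq] add_mono)
      show "norm ((f s - g s) * f' s) \<le> (K / norm s) * (M' + K' / R')"
        unfolding norm_mult using K[of s] s f' pos by (intro mult_mono) auto
      show "norm (g s * (f' s - g' s)) \<le> M * (K' / norm s)"
        unfolding norm_mult using K'[of s] M(1)[of s] s pos by (intro mult_mono) auto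
    qed
    also have "\<dots> = (K * (M' + K' / R') + M * K') / norm s" by (simp add: add_divide_distrib)
    finally show ?thesis .
  qed
  ultimately show ?thesis unfolding strip_approx_def using K0(1)
    by (intro conjI exI[of _ "M * M'"] exI[of _ "K * (M' + K' / R') + M * K'"] exI[of _ "max R R'"]) auto
qed

lemma strip_approx_cos_sin:
  assumes "0 \<le> l"
  shows "strip_approx H (\<lambda>s. cos (s * of_real l)) (\<lambda>s. cos (s * of_real l))"
    "strip_approx H (\<lambda>s. sin (s * of_real l)) (\<lambda>s. sin (s * of_real l))"
proof -
  have "exp \<bar>Im (s * complex_of_real l)\<bar> \<le> exp (H * l)" if "\<bar>Im s\<bar> \<le> H" for s
    using that assms by (auto simp: abs_mult intro!: mult_right_mono)
  hence b: "norm (cos (s * of_real l)) \<le> exp (H * l)" "norm (sin (s * of_real l)) \<le> exp (H * l)" if "\<bar>Im s\<bar> \<le> H" for s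
    using norm_cos_sin_le[of "s * of_real l"] that order_trans by blast+
  have a: "strip_approx H g g" if "\<And>s. \<bar>Im s\<bar> \<le> H \<Longrightarrow> norm (g s) \<le> M" for g M
    unfolding strip_approx_def
    by (intro conjI, use that in blast, rule exI[of _ 0], rule exI[of _ 1], simp)
  show "strip_approx H (\<lambda>s. cos (s * of_real l)) (\<lambda>s. cos (s * of_real l))"
    by (rule a) (rule b)
  show "strip_approx H (\<lambda>s. sin (s * of_real l)) (\<lambda>s. sin (s * of_real l))"
    by (rule a) (rule b)
qed

text \<open>The powers of \<open>s\<close> balance the off-diagonal entries, so that all four become
  bounded trigonometric functions. The same scaling, dividing \<open>charN\<close> by
  \<open>s\<close>, is compatible with the recursion.\<close>

lemma (in edge_potential) transfer_strip_approx:
  "strip_approx H (\<lambda>s. tr11 l q (s\<^sup>2)) (\<lambda>s. cos (s * of_real l))"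
  "strip_approx H (\<lambda>s. s * tr12 l q (s\<^sup>2)) (\<lambda>s. - sin (s * of_real l))"
  "strip_approx H (\<lambda>s. tr21 l q (s\<^sup>2) / s) (\<lambda>s. sin (s * of_real l))"
  "strip_approx H (\<lambda>s. tr22 l q (s\<^sup>2)) (\<lambda>s. cos (s * of_real l))"
proof -
  define m where "m = exp (H * l)"
  define N where "N = integral {0..l} (\<lambda>x. \<bar>q x\<bar>)"
  define K where "K = 4 * m ^ 3 * N"
  define R where "R = 4 * m\<^sup>2 * N + 1"
  have "N \<ge> 0" unfolding N_def using integral_norm_nonneg[of "{0..l}" q] by simp
  hence R0: "R > 0" by (simp add: R_def add_nonneg_pos)
  have "norm (tr11 l q (s\<^sup>2) - cos (s * of_real l)) \<le> K / norm s"
    "norm (s * tr12 l q (s\<^sup>2) - - sin (s * of_real l)) \<le> K / norm s"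
    "norm (tr21 l q (s\<^sup>2) / s - sin (s * of_real l)) \<le> K / norm s"
    "norm (tr22 l q (s\<^sup>2) - cos (s * of_real l)) \<le> K / norm s"
    if s: "\<bar>Im s\<bar> \<le> H" "R \<le> norm s" for s
  proof -
    have s0: "s \<noteq> 0" using s(2) R0 by auto
    have m: "exp (\<bar>Im s\<bar> * l) \<le> m" using s(1) l by (simp add: m_def mult_right_mono)
    have big: "4 * m\<^sup>2 * integral {0..l} (\<lambda>x. \<bar>q x\<bar>) \<le> norm s" using s(2) by (simp add: R_def N_def)
    \<comment> \<open>The free cosine and sine solutions are bounded by \<open>m\<close> and
      \<open>m / norm s\<close>; these are the respective values of \<open>B\<close>.\<close>
    note A = ivp_asymptotics[OF s0 m big, of 1 0 m, folded N_def] ivp_asymptotics[OF s0 m big, of 0 1 "m / norm s", folded N_def]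
    have A1: "norm (fst (ivp l q 1 0 (s\<^sup>2)) l - cos (s * of_real l)) \<le> K / norm s"
      using A(1) by (simp add: K_def power2_eq_square power3_eq_cube mult_ac)
    have A2: "norm (snd (ivp l q 1 0 (s\<^sup>2)) l + s * sin (s * of_real l)) \<le> K"
      using A(2) by (simp add: K_def power2_eq_square power3_eq_cube mult_ac)
    have A3: "norm (fst (ivp l q 0 1 (s\<^sup>2)) l - sin (s * of_real l) / s) \<le> K / norm s / norm s"
      using A(3) by (simp add: K_def power2_eq_square power3_eq_cube mult_ac)
    have A4: "norm (snd (ivp l q 0 1 (s\<^sup>2)) l - cos (s * of_real l)) \<le> K / norm s"
      using A(4) by (simp add: K_def power2_eq_square power3_eq_cube mult_ac)
    show "norm (tr11 l q (s\<^sup>2) - cos (s * of_real l)) \<le> K / norm s"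
      "norm (tr22 l q (s\<^sup>2) - cos (s * of_real l)) \<le> K / norm s"
      using A1 A4 by (simp_all add: tr11_def tr22_def)
    have "s * tr12 l q (s\<^sup>2) - - sin (s * of_real l) = - s * (fst (ivp l q 0 1 (s\<^sup>2)) l - sin (s * of_real l) / s)"
      using s0 by (simp add: tr12_def field_simps)
    also have "norm \<dots> \<le> norm s * (K / norm s / norm s)"
      unfolding norm_mult norm_minus_cancel by (rule mult_left_mono[OF A3]) simp
    also have "\<dots> = K / norm s" using s0 by simp
    finally show "norm (s * tr12 l q (s\<^sup>2) - - sin (s * of_real l)) \<le> K / norm s" .
    have "tr21 l q (s\<^sup>2) / s - sin (s * of_real l) = - (snd (ivp l q 1 0 (s\<^sup>2)) l + s * sin (s * of_real l)) / s"
      using s0 by (simp add: tr21_def field_simps)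
    also have "norm \<dots> \<le> K / norm s"
      unfolding norm_divide norm_minus_cancel by (rule divide_right_mono[OF A2]) simp
    finally show "norm (tr21 l q (s\<^sup>2) / s - sin (s * of_real l)) \<le> K / norm s" .
  qed
  moreover have "\<exists>M. \<forall>s. \<bar>Im s\<bar> \<le> H \<longrightarrow> norm (cos (s * complex_of_real l)) \<le> M"
    "\<exists>M. \<forall>s. \<bar>Im s\<bar> \<le> H \<longrightarrow> norm (sin (s * complex_of_real l)) \<le> M"
    "\<exists>M. \<forall>s. \<bar>Im s\<bar> \<le> H \<longrightarrow> norm (- sin (s * complex_of_real l)) \<le> M"
    using strip_approx_cos_sin[of l H] l by (auto simp: strip_approx_def)
  ultimately show "strip_approx H (\<lambda>s. tr11 l q (s\<^sup>2)) (\<lambda>s. cos (s * of_real l))"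
    "strip_approx H (\<lambda>s. s * tr12 l q (s\<^sup>2)) (\<lambda>s. - sin (s * of_real l))"
    "strip_approx H (\<lambda>s. tr21 l q (s\<^sup>2) / s) (\<lambda>s. sin (s * of_real l))"
    "strip_approx H (\<lambda>s. tr22 l q (s\<^sup>2)) (\<lambda>s. cos (s * of_real l))"
    unfolding strip_approx_def using R0 by blast+
qed

text \<open>The factor \<open>1 - X^2\<close> in \<open>polyA\<close> originates here: the limit of
  \<open>charN / s\<close> carries one sine, the entry \<open>tr12\<close> contributes another, and
  their product is \<open>1 - cos^2\<close>.\<close>

lemma char_strip_approx:
  assumes "\<And>e. e \<in> snd ` set os \<Longrightarrow> edge_potential l (q e)" "0 \<le> l"
  shows "strip_approx H (\<lambda>s. charD l q os (s\<^sup>2)) (\<lambda>s. poly (polyA (map fst os)) (cos (s * of_real l)))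
    \<and> strip_approx H (\<lambda>s. charN l q os (s\<^sup>2) / s) (\<lambda>s. sin (s * of_real l) * poly (polyR (map fst os)) (cos (s * of_real l)))"
  using assms
proof (induction os)
  case Nil
  show ?case using strip_approx_const[of H 1] strip_approx_const[of H 0] by simp
next
  case (Cons x os)
  obtain b e where x: "x = (b, e)" by (cases x)
  interpret edge_potential l "q e" using Cons.prems by (auto simp: x)
  let ?A = "\<lambda>s. poly (polyA (map fst os)) (cos (s * of_real l))"
  let ?R = "\<lambda>s. sin (s * of_real l) * poly (polyR (map fst os)) (cos (s * of_real l))"
  have A: "strip_approx H (\<lambda>s. charD l q os (s\<^sup>2)) ?A" and R: "strip_approx H (\<lambda>s. charN l q os (s\<^sup>2) / s) ?R"
    using Cons by auto
  note T = transfer_strip_approx[of H]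
  have sq: "(sin w)\<^sup>2 = 1 - (cos w)\<^sup>2" for w :: complex by (rule sin_squared_eq)
  show ?case
  proof (cases b)
    case True
    have "strip_approx H (\<lambda>s. charD l q (x # os) (s\<^sup>2)) (\<lambda>s. poly (polyA (map fst (x # os))) (cos (s * of_real l)))"
    proof (rule strip_approx_cong[OF strip_approx_add[OF strip_approx_mult[OF T(1) A] strip_approx_mult[OF T(2) R]]])
      fix s :: complex
      have "poly [:1, 0, -1:] (cos (s * of_real l)) = 1 - (cos (s * of_real l))\<^sup>2"
        by (simp add: power2_eq_square)
      hence "poly [:1, 0, -1:] (cos (s * of_real l)) = (sin (s * of_real l))\<^sup>2" by (simp only: sq)
      moreover have "poly (polyA (map fst (x # os))) w
          = poly [:0, 1:] w * poly (polyA (map fst os)) w - poly [:1, 0, -1:] w * poly (polyR (map fst os)) w" for w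
        by (simp only: x True list.map fst_conv polyA.simps poly_diff poly_mult)
      ultimately show "poly (polyA (map fst (x # os))) (cos (s * of_real l)) = cos (s * of_real l) * ?A s + - sin (s * of_real l) * ?R s"
        by (simp only:) (simp add: power2_eq_square)
    qed (auto simp: x True)
    moreover have "strip_approx H (\<lambda>s. charN l q (x # os) (s\<^sup>2) / s) (\<lambda>s. sin (s * of_real l) * poly (polyR (map fst (x # os))) (cos (s * of_real l)))"
      by (rule strip_approx_cong[OF strip_approx_add[OF strip_approx_mult[OF T(3) A] strip_approx_mult[OF T(4) R]]])
         (auto simp: x True algebra_simps add_divide_distrib)
    ultimately show ?thesis by blast
  next
    case False
    have "strip_approx H (\<lambda>s. charD l q (x # os) (s\<^sup>2)) (\<lambda>s. poly (polyA (map fst (x # os))) (cos (s * of_real l)))"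
      by (rule strip_approx_cong[OF strip_approx_mult[OF T(1) A]]) (auto simp: x False)
    moreover have "strip_approx H (\<lambda>s. charN l q (x # os) (s\<^sup>2) / s) (\<lambda>s. sin (s * of_real l) * poly (polyR (map fst (x # os))) (cos (s * of_real l)))"
      by (rule strip_approx_cong[OF strip_approx_add[OF strip_approx_mult[OF T(1) R] strip_approx_mult[OF T(3) A]]])
         (auto simp: x False algebra_simps add_divide_distrib)
    ultimately show ?thesis by blast
  qed
qed


section \<open>Counting zeros in far discs\<close>

lemma entire_zeros_finite:
  assumes "f holomorphic_on UNIV" "f a \<noteq> (0::complex)" "bounded S"
  shows "finite {p \<in> S. f p = 0}"
proof -
  obtain r where "\<forall>x\<in>S. norm x \<le> r" using assms(3) by (auto simp: bounded_iff)
  hence r: "S \<subseteq> cball 0 r" by auto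
  show ?thesis
  proof (cases "f constant_on UNIV")
    case True
    hence "{p \<in> S. f p = 0} = {}" using assms(2) by (auto simp: constant_on_def)
    thus ?thesis by (metis finite.emptyI)
  next
    case False
    have "finite {p \<in> cball 0 r. f p = 0}"
      by (rule holomorphic_compact_finite_zeros[OF assms(1) open_UNIV connected_UNIV compact_cball _ False]) simp
    thus ?thesis by (rule finite_subset[rotated]) (use r in auto)
  qed
qed

lemma isolated_zero_radius:
  assumes "g holomorphic_on UNIV" "g a \<noteq> (0::complex)"
  obtains r where "r > 0" "\<And>s. s \<in> ball s0 r \<Longrightarrow> s \<noteq> s0 \<Longrightarrow> g s \<noteq> 0"
proof -
  obtain h r where h: "r > 0" "\<And>w. w \<in> ball s0 r \<Longrightarrow> g w = h w * (w - s0) ^ nat (zorder g s0)"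
    "\<And>w. w \<in> ball s0 r \<Longrightarrow> h w \<noteq> 0" using entire_zorder[OF assms, of s0] by metis
  show ?thesis
  proof (rule that[OF h(1)])
    fix s assume "s \<in> ball s0 r" "s \<noteq> s0"
    thus "g s \<noteq> 0" using h(2,3)[of s] by simp
  qed
qed

text \<open>
  Rouche's theorem in the discs around \<open>s0 + k T\<close>: near these points the zeros of the characteristic function
  are close to the zeros of its periodic limit, with the same total multiplicity.
\<close>

lemma limit_zorder:
  assumes f: "f holomorphic_on UNIV" "f a \<noteq> 0"
    and h: "h holomorphic_on - {0}" "\<And>s. s \<noteq> 0 \<Longrightarrow> h s \<noteq> 0"
    and approx: "\<And>H. strip_approx H (\<lambda>s. f (s\<^sup>2) * h s) g"
    and g: "g holomorphic_on UNIV" and r: "r > 0" "\<And>s. s \<in> ball s0 (2 * r) \<Longrightarrow> s \<noteq> s0 \<Longrightarrow> g s \<noteq> 0"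
    and T: "(T :: real) > 0" "\<And>s k. g (s + of_nat k * of_real T) = g s"
  shows "\<forall>\<^sub>F k in sequentially. of_int (zorder g s0) =
    (\<Sum>p | p \<in> ball s0 (2 * r) \<and> f ((p + of_nat k * of_real T)\<^sup>2) = 0.
       winding_number (circlepath s0 r) p * of_int (zorder f ((p + of_nat k * of_real T)\<^sup>2)))"
proof -
  define H where "H = \<bar>Im s0\<bar> + r"
  obtain K R where KR: "R > 0" "\<And>s. \<bar>Im s\<bar> \<le> H \<Longrightarrow> R \<le> norm s \<Longrightarrow> norm (f (s\<^sup>2) * h s - g s) \<le> K / norm s"
    using approx[of H] unfolding strip_approx_def by blast
  have gc: "continuous_on UNIV g" using g holomorphic_on_imp_continuous_on by blast
  obtain x0 where x0: "x0 \<in> sphere s0 r" "\<And>s. s \<in> sphere s0 r \<Longrightarrow> norm (g x0) \<le> norm (g s)"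
  proof -
    have "continuous_on (sphere s0 r) (\<lambda>s. norm (g s))"
      by (intro continuous_intros continuous_on_subset[OF gc]) auto
    thus ?thesis using continuous_attains_inf[of "sphere s0 r" "\<lambda>s. norm (g s)"] r(1) that by (auto simp: sphere_eq_empty)
  qed
  \<comment> \<open>The minimum of \<open>norm (g s)\<close> on the circle, positive because
    \<open>s0\<close> is the only possible zero of \<open>g\<close> in the larger disc.\<close>
  define \<delta> where "\<delta> = norm (g x0)"
  have \<delta>: "\<delta> > 0" using r x0(1) by (auto simp: \<delta>_def)
  \<comment> \<open>\<open>B\<close> bounds \<open>norm s\<close> on the disc. The threshold for
    \<open>k\<close> below then moves the shifted disc so far out that the approximation holds there
    with error less than \<delta>.\<close>
  define B where "B = norm s0 + 2 * r"
  have "\<forall>\<^sub>F k in sequentially. real k \<ge> (max R (\<bar>K\<bar> / \<delta> + 1) + B) / T"     using filterlim_real_sequentially unfolding filterlim_at_top by blast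
  moreover have "of_int (zorder g s0) =
    (\<Sum>p | p \<in> ball s0 (2 * r) \<and> f ((p + of_nat k * of_real T)\<^sup>2) = 0.
       winding_number (circlepath s0 r) p * of_int (zorder f ((p + of_nat k * of_real T)\<^sup>2)))"
    if k: "real k \<ge> (max R (\<bar>K\<bar> / \<delta> + 1) + B) / T" for k
  proof -
    define c where "c = complex_of_nat k * complex_of_real T"
    have kT: "max R (\<bar>K\<bar> / \<delta> + 1) + B \<le> real k * T" using k T(1) by (simp add: pos_divide_le_eq)
    have cn: "norm c = real k * T" using T(1) by (simp add: c_def norm_mult)
    have Imc: "Im c = 0" by (simp add: c_def)
    have far: "norm (s + c) \<ge> max R (\<bar>K\<bar> / \<delta> + 1)" if "s \<in> ball s0 (2 * r)" for s
    proof -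
      have "norm s \<le> B" using that norm_triangle_sub[of s s0] by (simp add: B_def dist_norm norm_minus_commute)
      moreover have "norm c \<le> norm (s + c) + norm s" using norm_triangle_ineq4[of "s + c" s] by simp
      ultimately show ?thesis using kT cn by linarith
    qed
    have nz: "s + c \<noteq> 0" if "s \<in> ball s0 (2 * r)" for s
      using far[OF that] KR(1) by auto
    define F where "F s = f ((s + c)\<^sup>2) * h (s + c)" for s
    have sqh: "(\<lambda>s. f ((s + c)\<^sup>2)) holomorphic_on A" for A
    proof -
      have "(\<lambda>s. (s + c)\<^sup>2) holomorphic_on A" by (intro holomorphic_intros)
      from holomorphic_on_compose_gen[OF this f(1)] show ?thesis by (simp add: o_def)
    qed
    have Fh: "F holomorphic_on ball s0 (2 * r)"
    proof -
      have t: "(\<lambda>s. s + c) holomorphic_on ball s0 (2 * r)" by (intro holomorphic_intros)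
      have img: "(\<lambda>s. s + c) ` ball s0 (2 * r) \<subseteq> - {0}"
      proof
        fix w assume "w \<in> (\<lambda>s. s + c) ` ball s0 (2 * r)"
        then obtain s where "s \<in> ball s0 (2 * r)" "w = s + c" by (rule imageE)
        thus "w \<in> - {0}" using nz[of s] by simp
      qed
      have "(\<lambda>s. h (s + c)) holomorphic_on ball s0 (2 * r)"
        using holomorphic_on_compose_gen[OF t h(1) img] by (simp add: o_def)
      with sqh[of "ball s0 (2 * r)"] show ?thesis unfolding F_def[abs_def] by (intro holomorphic_intros)
    qed
    have F0: "F p = 0 \<longleftrightarrow> f ((p + c)\<^sup>2) = 0" if "p \<in> ball s0 (2 * r)" for p
      using h(2)[OF nz[OF that]] by (simp add: F_def)
    have fin: "finite {p \<in> ball s0 (2 * r). F p = 0}"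
    proof -
      \<comment> \<open>A witness that the substituted function is not identically zero: it takes
        the value \<open>f a\<close> at \<open>csqrt a - c\<close>.\<close>
      have "f ((csqrt a - c + c)\<^sup>2) \<noteq> 0" using f(2) by simp
      hence "finite {p \<in> ball s0 (2 * r). f ((p + c)\<^sup>2) = 0}"
        by (rule entire_zeros_finite[OF sqh, of "csqrt a - c"]) simp
      moreover have "{p \<in> ball s0 (2 * r). F p = 0} = {p \<in> ball s0 (2 * r). f ((p + c)\<^sup>2) = 0}" using F0 by blast
      ultimately show ?thesis by simp
    qed
    have ge: "g (s + c) = g s" for s unfolding c_def by (rule T(2))
    have less: "norm (F s - g s) < norm (g s)" if s: "s \<in> sphere s0 r" for s
    proof -
      have sb: "s \<in> ball s0 (2 * r)" using s r(1) by auto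
      have "\<bar>Im (s + c)\<bar> \<le> H"
      proof -
        have "\<bar>Im (s - s0)\<bar> \<le> r" using s abs_Im_le_cmod[of "s - s0"] by (simp add: dist_norm norm_minus_commute)
        thus ?thesis by (simp add: H_def Imc)
      qed
      hence "norm (F s - g s) \<le> K / norm (s + c)"
        using KR(2)[of "s + c"] far[OF sb] by (simp add: F_def ge)
      also have "\<dots> \<le> \<bar>K\<bar> / norm (s + c)" by (intro divide_right_mono) auto
      also have "\<dots> < \<delta>"
      proof -
        have "\<bar>K\<bar> / \<delta> < norm (s + c)" using far[OF sb] by auto
        moreover have "norm (s + c) > 0" using nz[OF sb] by simp
        ultimately show ?thesis using \<delta> by (simp add: divide_simps mult.commute split: if_splits)
      qed
      finally show ?thesis using x0(2)[OF s] by (simp add: \<delta>_def)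
    qed
    have gz: "{p \<in> ball s0 (2 * r). g p = 0} \<subseteq> {s0}" using r(2) by auto
    have R: "(\<Sum>p | p \<in> ball s0 (2 * r) \<and> g p + (F p - g p) = 0. winding_number (circlepath s0 r) p * of_int (zorder (\<lambda>p. g p + (F p - g p)) p))
       = (\<Sum>p | p \<in> ball s0 (2 * r) \<and> g p = 0. winding_number (circlepath s0 r) p * of_int (zorder g p))"
    proof (rule Rouche_theorem)
      show "finite {p \<in> ball s0 (2 * r). g p = 0}" using gz finite_subset by blast
      show "finite {p \<in> ball s0 (2 * r). g p + (F p - g p) = 0}" using fin by simp
      show "g holomorphic_on ball s0 (2 * r)" using g holomorphic_on_subset by blast
      thus "(\<lambda>p. F p - g p) holomorphic_on ball s0 (2 * r)" using Fh by (intro holomorphic_intros)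
      show "path_image (circlepath s0 r) \<subseteq> ball s0 (2 * r)" using r(1) by auto
      show "\<forall>z\<in>path_image (circlepath s0 r). cmod (F z - g z) < cmod (g z)" using less r(1) by simp
      show "\<forall>z. z \<notin> ball s0 (2 * r) \<longrightarrow> winding_number (circlepath s0 r) z = 0"
      proof (intro allI impI)
        fix z assume "z \<notin> ball s0 (2 * r)"
        hence "z \<notin> cball s0 r" using r(1) by auto
        thus "winding_number (circlepath s0 r) z = 0"
          by (intro winding_number_zero_outside[of _ "cball s0 r"]) (use r(1) in auto)
      qed
    qed (use r(1) in auto)
    have "(\<Sum>p | p \<in> ball s0 (2 * r) \<and> g p = 0. winding_number (circlepath s0 r) p * of_int (zorder g p)) = of_int (zorder g s0)"
    proof (cases "g s0 = 0")
      case True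
      hence "{p \<in> ball s0 (2 * r). g p = 0} = {s0}" using gz r(1) by auto
      thus ?thesis using r(1) by (simp add: winding_number_circlepath_centre)
    next
      case False
      hence "{p \<in> ball s0 (2 * r). g p = 0} = {}" using gz by auto
      moreover have "zorder g s0 = 0" using entire_zorder[OF g False, of s0] False by (metis order_le_imp_less_or_eq)
      ultimately show ?thesis by (simp only: sum.empty of_int_0)
    qed
    moreover have "(\<Sum>p | p \<in> ball s0 (2 * r) \<and> g p + (F p - g p) = 0. winding_number (circlepath s0 r) p * of_int (zorder (\<lambda>p. g p + (F p - g p)) p))
      = (\<Sum>p | p \<in> ball s0 (2 * r) \<and> f ((p + c)\<^sup>2) = 0. winding_number (circlepath s0 r) p * of_int (zorder f ((p + c)\<^sup>2)))"
    proof (rule sum.cong)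
      show "{p \<in> ball s0 (2 * r). g p + (F p - g p) = 0} = {p \<in> ball s0 (2 * r). f ((p + c)\<^sup>2) = 0}" using F0 by auto
      fix p assume "p \<in> {p \<in> ball s0 (2 * r). f ((p + c)\<^sup>2) = 0}"
      hence "zorder F p = zorder f ((p + c)\<^sup>2)"
        unfolding F_def[abs_def] using zorder_comp_square[OF f h nz] by blast
      thus "winding_number (circlepath s0 r) p * of_int (zorder (\<lambda>p. g p + (F p - g p)) p) = winding_number (circlepath s0 r) p * of_int (zorder f ((p + c)\<^sup>2))"
        by simp
    qed
    ultimately show ?thesis using R by (simp add: c_def)
  qed
  ultimately show ?thesis by (rule eventually_mono)
qed

text \<open>Equal orders of \<open>f\<close> and \<open>f'\<close> at every point make the two
  weighted sums over zeros identical for each \<open>k\<close>, provided one radius isolates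
  \<open>s0\<close> for both limits. A single large \<open>k\<close> then equates the two
  orders.\<close>

lemma limit_zorder_eq:
  assumes f: "f holomorphic_on UNIV" "f a \<noteq> 0" "f' holomorphic_on UNIV" "f' a' \<noteq> 0" "\<And>z. zorder f z = zorder f' z"
    and h: "h holomorphic_on - {0}" "\<And>s. s \<noteq> 0 \<Longrightarrow> h s \<noteq> 0"
    and approx: "\<And>H. strip_approx H (\<lambda>s. f (s\<^sup>2) * h s) g" "\<And>H. strip_approx H (\<lambda>s. f' (s\<^sup>2) * h s) g'"
    and g: "g holomorphic_on UNIV" "g b \<noteq> 0" "g' holomorphic_on UNIV" "g' b' \<noteq> 0"
    and T: "(T :: real) > 0" "\<And>s k. g (s + of_nat k * of_real T) = g s" "\<And>s k. g' (s + of_nat k * of_real T) = g' s"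
  shows "zorder g s0 = zorder g' s0"
proof -
  obtain r1 where r1: "r1 > 0" "\<And>s. s \<in> ball s0 r1 \<Longrightarrow> s \<noteq> s0 \<Longrightarrow> g s \<noteq> 0"
    using isolated_zero_radius[OF g(1,2), of s0] by metis
  obtain r2 where r2: "r2 > 0" "\<And>s. s \<in> ball s0 r2 \<Longrightarrow> s \<noteq> s0 \<Longrightarrow> g' s \<noteq> 0"
    using isolated_zero_radius[OF g(3,4), of s0] by metis
  define r where "r = min r1 r2 / 2"
  have r: "r > 0" using r1 r2 by (simp add: r_def)
  have rg: "g s \<noteq> 0" "g' s \<noteq> 0" if "s \<in> ball s0 (2 * r)" "s \<noteq> s0" for s
    using r1(2)[of s] r2(2)[of s] that by (auto simp: r_def)
  have zeros: "f z = 0 \<longleftrightarrow> f' z = 0" for z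
    using entire_zero_iff[OF f(1,2), of z] entire_zero_iff[OF f(3,4), of z] f(5)[of z] by simp
  define S where "S k = (\<Sum>p | p \<in> ball s0 (2 * r) \<and> f' ((p + of_nat k * of_real T)\<^sup>2) = 0.
       winding_number (circlepath s0 r) p * of_int (zorder f' ((p + of_nat k * of_real T)\<^sup>2)))" for k
  have "\<forall>\<^sub>F k in sequentially. of_int (zorder g s0) = S k"
    unfolding S_def f(5)[symmetric] zeros[symmetric]
    by (rule limit_zorder[OF f(1,2) h approx(1) g(1) r rg(1) T(1,2)])
  moreover have "\<forall>\<^sub>F k in sequentially. of_int (zorder g' s0) = S k"
    unfolding S_def by (rule limit_zorder[OF f(3,4) h approx(2) g(3) r rg(2) T(1,3)])
  ultimately have "\<forall>\<^sub>F k in sequentially. complex_of_int (zorder g s0) = S k \<and> complex_of_int (zorder g' s0) = S k"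
    by (rule eventually_conj)
  from eventually_happens'[OF sequentially_bot this] show ?thesis by (metis of_int_eq_iff)
qed

section \<open>The spectra determine the shape\<close>

text \<open>Splitting off the power of \<open>X - x\<close> from \<open>p\<close> leaves a factor
  that is nonzero at \<open>x\<close>. The order of the cosine at \<open>s0\<close>, which is 2 at
  its turning points, enters as a positive multiplier and can be cancelled later.\<close>

lemma zorder_mult_poly_cos:
  assumes w: "w holomorphic_on UNIV" "w a \<noteq> 0" and p: "p \<noteq> 0" and l: "(l::real) > 0"
    and x: "x = cos (s0 * of_real l)"
  shows "zorder (\<lambda>s. w s * poly p (cos (s * of_real l))) s0
    = zorder w s0 + int (order x p) * zorder (\<lambda>s. cos (s * of_real l) - x) s0"
    and "zorder (\<lambda>s. cos (s * of_real l) - x) s0 > 0"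
proof -
  let ?k = "\<lambda>s. cos (s * of_real l) - x"
  have kh: "?k holomorphic_on UNIV" by (intro holomorphic_intros)
  \<comment> \<open>The cosine takes the values 1 and -1 at the points 0 and \<open>pi / l\<close>,
    so one of them serves.\<close>
  obtain b where kb: "?k b \<noteq> 0"
  proof (cases "x = 1")
    case True
    have "complex_of_real (pi / l) * complex_of_real l = complex_of_real pi" using l by simp
    hence "?k (of_real (pi / l)) \<noteq> 0" unfolding True by (simp only: cos_of_real) simp
    thus ?thesis using that by blast
  next
    case False
    have "?k 0 \<noteq> 0" using False by simp
    thus ?thesis using that by blast
  qed
  obtain g r where g: "r > 0" "g holomorphic_on ball s0 r" "\<And>s. s \<in> ball s0 r \<Longrightarrow> w s = g s * (s - s0) ^ nat (zorder w s0)"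
    "\<And>s. s \<in> ball s0 r \<Longrightarrow> g s \<noteq> 0" "zorder w s0 \<ge> 0"
    using entire_zorder[OF w, of s0] by metis
  obtain h r' where h: "r' > 0" "h holomorphic_on ball s0 r'" "\<And>s. s \<in> ball s0 r' \<Longrightarrow> ?k s = h s * (s - s0) ^ nat (zorder ?k s0)"
    "\<And>s. s \<in> ball s0 r' \<Longrightarrow> h s \<noteq> 0" "zorder ?k s0 \<ge> 0"
    using entire_zorder[OF kh kb, of s0] by metis
  show pos: "zorder ?k s0 > 0" using entire_zero_iff[OF kh kb, of s0] x by simp
  define n where "n = order x p"
  define i where "i = nat (zorder w s0)"
  define j where "j = nat (zorder ?k s0)"
  obtain c where c: "p = [:- x, 1:] ^ n * c" "\<not> [:- x, 1:] dvd c"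
    using order_decomp[OF p] unfolding n_def by blast
  have c0: "poly c x \<noteq> 0" using c(2) by (simp add: poly_eq_0_iff_dvd)
  let ?S = "ball s0 (min r r')"
  let ?G = "\<lambda>s. g s * h s ^ n * poly c (cos (s * of_real l))"
  have "zorder (\<lambda>s. w s * poly p (cos (s * of_real l))) s0 = int (i + j * n)"
  proof (rule zorder_eqI[of ?S s0 ?G])
    show "open ?S" "s0 \<in> ?S" using g(1) h(1) by auto
    have "g holomorphic_on ?S" "h holomorphic_on ?S"
      using g(2) h(2) by (auto intro: holomorphic_on_subset)
    thus "?G holomorphic_on ?S" by (intro holomorphic_intros)
    show "?G s0 \<noteq> 0" using g(1,4) h(1,4) c0 x by simp
    fix s assume s: "s \<in> ?S" "s \<noteq> s0"
    have "poly p (cos (s * of_real l)) = ?k s ^ n * poly c (cos (s * of_real l))"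
      by (subst c(1)) (simp add: poly_power)
    thus "w s * poly p (cos (s * of_real l)) = ?G s * (s - s0) powi int (i + j * n)"
      using g(3)[of s, folded i_def] h(3)[of s, folded j_def] s
      by (simp only: power_int_of_nat) (simp add: power_mult_distrib power_add power_mult mult_ac)
  qed
  thus "zorder (\<lambda>s. w s * poly p (cos (s * of_real l))) s0 = zorder w s0 + int (order x p) * zorder ?k s0"
    using g(5) h(5) by (simp add: i_def j_def n_def)
qed

text \<open>The complex cosine is surjective, so each \<open>x\<close> is tested at a preimage.
  There the order of \<open>w\<close> and the multiplier from the cosine are the same for both
  polynomials.\<close>

lemma order_eq_of_zorder_eq:
  assumes w: "w holomorphic_on UNIV" "w a \<noteq> 0" and p: "p \<noteq> 0" "p' \<noteq> 0" and l: "(l::real) > 0"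
    and eq: "\<And>s. zorder (\<lambda>s. w s * poly p (cos (s * of_real l))) s = zorder (\<lambda>s. w s * poly p' (cos (s * of_real l))) s"
  shows "order x p = order x p'"
proof -
  have x: "x = cos (Arccos x / of_real l * of_real l)" using l by simp
  show ?thesis
    using eq[of "Arccos x / of_real l"] zorder_mult_poly_cos[OF w p(1) l x] zorder_mult_poly_cos[OF w p(2) l x]
    by simp
qed

lemma cos_sin_periodic:
  assumes "(l::real) > 0"
  shows "cos ((s + of_nat k * of_real (2 * pi / l)) * of_real l) = cos (s * of_real l)"
    "sin ((s + of_nat k * of_real (2 * pi / l)) * of_real l) = sin (s * complex_of_real l)"
proof -
  have e: "(s + of_nat k * of_real (2 * pi / l)) * of_real l = s * of_real l + complex_of_real (2 * real k * pi)"
    using assms by (simp add: field_simps)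
  show "cos ((s + of_nat k * of_real (2 * pi / l)) * of_real l) = cos (s * of_real l)"
    "sin ((s + of_nat k * of_real (2 * pi / l)) * of_real l) = sin (s * complex_of_real l)"
    unfolding e cos_add sin_add cos_of_real sin_of_real by (simp_all only: cos_2npi sin_2npi) simp_all
qed

lemma polyR_nonzero:
  assumes "bs \<noteq> []"
  shows "polyR bs \<noteq> 0"
proof
  assume "polyR bs = 0"
  moreover obtain \<mu> where "\<mu> > 0" "coeff (pCons 0 (polyR bs)) (length bs) = of_nat (children bs) * complex_of_real \<mu>"
    using poly_pair_leading[of bs] by blast
  ultimately show False using assms children_0_iff[of bs] by simp
qed

lemma sin_poly_cos_nonzero:
  assumes "p \<noteq> 0" "(l::real) > 0"
  obtains s where "sin (s * of_real l) * poly p (cos (s * complex_of_real l)) \<noteq> 0"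
proof -
  \<comment> \<open>A point that is no root of \<open>p\<close> and differs from 1 and -1 makes the
    sine factor nonzero as well.\<close>
  have "p * [:1, 0, -1:] \<noteq> 0" by (rule no_zero_divisors[OF assms(1)]) simp
  then obtain x where x: "poly (p * [:1, 0, -1:]) x \<noteq> 0"
    using poly_all_0_iff_0 by blast
  define s where "s = Arccos x / of_real l"
  have c: "cos (s * of_real l) = x" using assms by (simp add: s_def)
  have "(sin (s * of_real l))\<^sup>2 = 1 - x\<^sup>2" using sin_squared_eq[of "s * of_real l"] c by simp
  moreover have "1 - x\<^sup>2 \<noteq> 0" "poly p x \<noteq> 0" using x by (auto simp: power2_eq_square)
  ultimately have "sin (s * of_real l) * poly p (cos (s * of_real l)) \<noteq> 0" using c by auto
  thus ?thesis using that by blast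
qed

lemma shape_determined:
  assumes l: "l > 0"
    and os: "os \<noteq> []" "fst (hd os)" "fst (last os)" "distinct (map snd os)"
      "\<And>e. e \<in> snd ` set os \<Longrightarrow> edge_potential l (q e)"
    and os': "os' \<noteq> []" "fst (hd os')" "fst (last os')" "distinct (map snd os')"
      "\<And>e. e \<in> snd ` set os' \<Longrightarrow> edge_potential l (q' e)"
    and D: "\<And>z. family.dim {y. \<exists>b. (y, 0, b) \<in> sol_space l q z os} = family.dim {y. \<exists>b. (y, 0, b) \<in> sol_space l q' z os'}"
    and N: "\<And>z. family.dim {y. \<exists>a. (y, a, 0) \<in> sol_space l q z os} = family.dim {y. \<exists>a. (y, a, 0) \<in> sol_space l q' z os'}"
  shows "map fst os = map fst os'"
proof -
  let ?bs = "map fst os" and ?bs' = "map fst os'"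
  note E = entire_char[of os l q, OF os(5)] entire_char[of os' l q', OF os'(5)]
  note nz = char_nonzero[of os l q, OF os(1,3,5)] char_nonzero[of os' l q', OF os'(1,3,5)]
  \<comment> \<open>Nonnegativity makes \<open>nat\<close> injective on the orders, so equal
    dimensions give equal orders.\<close>
  have zge: "zorder f z \<ge> 0" if "f holomorphic_on UNIV" "f a \<noteq> 0" for f z and a :: complex
    by (rule entire_zorder[OF that])
  have zD: "zorder (charD l q os) z = zorder (charD l q' os') z" for z
    using D[of z] dim_sol_space_eq_zorder(1)[of os l q z, OF os] dim_sol_space_eq_zorder(1)[of os' l q' z, OF os']
      zge[OF conjunct1[OF E(1)] nz(1), of z] zge[OF conjunct1[OF E(2)] nz(3), of z] by simp
  have zN: "zorder (charN l q os) z = zorder (charN l q' os') z" for z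
    using N[of z] dim_sol_space_eq_zorder(2)[of os l q z, OF os] dim_sol_space_eq_zorder(2)[of os' l q' z, OF os']
      zge[OF conjunct2[OF E(1)] nz(2), of z] zge[OF conjunct2[OF E(2)] nz(4), of z] by simp
  note S = char_strip_approx[of os l q, OF os(5) less_imp_le[OF l]] char_strip_approx[of os' l q', OF os'(5) less_imp_le[OF l]]
  have T: "2 * pi / l > 0" using l by simp
  define gA where "gA bs s = poly (polyA bs) (cos (s * complex_of_real l))" for bs s
  define gR where "gR bs s = sin (s * of_real l) * poly (polyR bs) (cos (s * complex_of_real l))" for bs s
  \<comment> \<open>The two normalising factors: 1 for \<open>charD\<close> and \<open>1 / s\<close>
    for \<open>charN\<close>, neither of which has zeros away from the origin.\<close>
  have h1: "(\<lambda>s::complex. 1::complex) holomorphic_on - {0}" "\<And>s::complex. s \<noteq> 0 \<Longrightarrow> (1::complex) \<noteq> 0" by auto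
  have h2: "(\<lambda>s::complex. 1 / s) holomorphic_on - {0}" "\<And>s::complex. s \<noteq> 0 \<Longrightarrow> 1 / s \<noteq> 0"
    by (auto intro!: holomorphic_intros)
  have gh: "gA bs holomorphic_on UNIV" "gR bs holomorphic_on UNIV" for bs
    unfolding gA_def[abs_def] gR_def[abs_def] by (intro holomorphic_intros)+
  have gA0: "gA bs 0 \<noteq> 0" for bs by (simp add: gA_def poly_polyA_1)
  have gper: "gA bs (s + of_nat k * of_real (2 * pi / l)) = gA bs s" "gR bs (s + of_nat k * of_real (2 * pi / l)) = gR bs s" for bs s k
    unfolding gA_def gR_def cos_sin_periodic[OF l] by simp_all
  have Rnz: "polyR ?bs \<noteq> 0" "polyR ?bs' \<noteq> 0" using polyR_nonzero os(1) os'(1) by simp_all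
  obtain b where b: "gR ?bs b \<noteq> 0" using sin_poly_cos_nonzero[OF Rnz(1) l] unfolding gR_def by metis
  obtain b' where b': "gR ?bs' b' \<noteq> 0" using sin_poly_cos_nonzero[OF Rnz(2) l] unfolding gR_def by metis
  have SA: "strip_approx H (\<lambda>s. charD l q os (s\<^sup>2) * 1) (gA ?bs)" "strip_approx H (\<lambda>s. charD l q' os' (s\<^sup>2) * 1) (gA ?bs')"
    "strip_approx H (\<lambda>s. charN l q os (s\<^sup>2) * (1 / s)) (gR ?bs)" "strip_approx H (\<lambda>s. charN l q' os' (s\<^sup>2) * (1 / s)) (gR ?bs')" for H
    using S[of H] by (simp_all add: gA_def[abs_def] gR_def[abs_def])
  have A: "zorder (gA ?bs) s = zorder (gA ?bs') s" for s
    by (rule limit_zorder_eq[OF conjunct1[OF E(1)] nz(1) conjunct1[OF E(2)] nz(3) zD h1 SA(1,2) gh(1) gA0 gh(1) gA0 T gper(1) gper(1)])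
  have R: "zorder (gR ?bs) s = zorder (gR ?bs') s" for s
    by (rule limit_zorder_eq[OF conjunct2[OF E(1)] nz(2) conjunct2[OF E(2)] nz(4) zN h2 SA(3,4) gh(2) b gh(2) b' T gper(2) gper(2)])
  show ?thesis
  proof (rule poly_pair_determined)
    show "order x (polyA ?bs) = order x (polyA ?bs')" for x
    proof (rule order_eq_of_zorder_eq[where w = "\<lambda>_. 1" and l = l])
      show "zorder (\<lambda>s. 1 * poly (polyA ?bs) (cos (s * of_real l))) s = zorder (\<lambda>s. 1 * poly (polyA ?bs') (cos (s * of_real l))) s" for s
        using A[of s] by (simp add: gA_def[abs_def])
    qed (auto simp: polyA_nonzero l)
    show "order x (polyR ?bs) = order x (polyR ?bs')" for x
    proof (rule order_eq_of_zorder_eq[where w = "\<lambda>s. sin (s * of_real l)" and l = l and a = "of_real (pi / 2 / l)"])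
      show "zorder (\<lambda>s. sin (s * of_real l) * poly (polyR ?bs) (cos (s * of_real l))) s = zorder (\<lambda>s. sin (s * of_real l) * poly (polyR ?bs') (cos (s * of_real l))) s" for s
        using R[of s] by (simp add: gR_def[abs_def])
      have "complex_of_real (pi / 2 / l) * complex_of_real l = complex_of_real (pi / 2)" using l by simp
      thus "sin (complex_of_real (pi / 2 / l) * complex_of_real l) \<noteq> 0" by (simp only: sin_of_real) simp
    qed (auto intro!: holomorphic_intros simp: Rnz l)
  qed (use os(1-3) os'(1-3) Rnz in \<open>auto simp: hd_map last_map\<close>)
qed

section \<open>Presentations of rooted trees\<close>

text \<open>Simple paths as nonempty vertex lists, which can be cut, extended and indexed more
  directly than the arc lists of \<open>apath\<close>.\<close>

definition is_path :: "'a pair_pre_digraph \<Rightarrow> 'a list \<Rightarrow> bool" where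
  "is_path G vs \<longleftrightarrow> vs \<noteq> [] \<and> distinct vs \<and> set vs \<subseteq> pverts G \<and> successively (\<lambda>a b. (a, b) \<in> parcs G) vs"

context pair_wf_digraph
begin

lemma apath_imp_is_path:
  assumes "apath u p v"
  shows "is_path G (pawalk_verts u p) \<and> hd (pawalk_verts u p) = u \<and> last (pawalk_verts u p) = v
    \<and> p = zip (pawalk_verts u p) (tl (pawalk_verts u p))"
  using assms
proof (induction p arbitrary: u)
  case Nil
  thus ?case by (auto simp: is_path_def apath_simps)
next
  case (Cons e p)
  have e: "e \<in> parcs G" "fst e = u" "apath (snd e) p v" "u \<notin> set (pawalk_verts (snd e) p)"
    using Cons.prems by (auto simp: apath_simps)
  note IH = Cons.IH[OF e(3)]
  obtain vs where vs: "pawalk_verts (snd e) p = snd e # vs"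
    using IH by (cases "pawalk_verts (snd e) p") (auto simp: is_path_def)
  have V: "pawalk_verts u (e # p) = u # snd e # vs" using vs e(2) by simp
  have "(u, snd e) \<in> parcs G" using e(1,2) by (cases e) auto
  hence "is_path G (u # snd e # vs)"
    using conjunct1[OF IH] e(4) arc_fst_in_verts[OF e(1)] e(2) unfolding vs by (auto simp: is_path_def)
  moreover have "e # p = zip (u # snd e # vs) (tl (u # snd e # vs))"
    using IH e(2) unfolding vs by (cases e) simp
  ultimately show ?case using IH unfolding V vs by simp
qed

lemma is_path_imp_apath:
  assumes "is_path G vs"
  shows "apath (hd vs) (zip vs (tl vs)) (last vs) \<and> pawalk_verts (hd vs) (zip vs (tl vs)) = vs"
  using assms
proof (induction vs rule: induct_list012)
  case (3 a b vs)
  have "is_path G (b # vs)" using 3 by (auto simp: is_path_def)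
  hence "apath b (zip (b # vs) vs) (last (b # vs)) \<and> pawalk_verts b (zip (b # vs) vs) = b # vs"
    using 3 by simp
  thus ?case using 3(3) by (auto simp: is_path_def apath_simps)
qed (auto simp: is_path_def apath_simps)

end

text \<open>Closing the path by the arc from its end to its start would give a forbidden cycle; the
  bound 2 leaves room for an edge traversed back and forth. This is the form in which acyclicity is
  used.\<close>

lemma is_path_closed_imp_short:
  assumes T: "undirected_tree G" and p: "is_path G vs" and c: "(last vs, hd vs) \<in> parcs G"
  shows "length vs \<le> 2"
proof (rule ccontr)
  assume len: "\<not> length vs \<le> 2"
  interpret pair_graph G using T by (simp add: undirected_tree_def)
  let ?p = "zip vs (tl vs)"
  have a: "apath (hd vs) ?p (last vs)" "pawalk_verts (hd vs) ?p = vs" using is_path_imp_apath[OF p] by auto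
  have aw: "awalk (hd vs) ?p (last vs)" using a(1) by (simp add: apath_def)
  have last: "last (pawalk_verts (hd vs) ?p) = last vs" using a(2) by simp
  have w: "awalk (hd vs) (?p @ [(last vs, hd vs)]) (hd vs)"
    using aw c in_arcsD2[OF c] by (intro awalk_appendI[OF aw]) (auto simp: awalk_simps)
  have pne: "?p \<noteq> []" using len by (cases vs; cases "tl vs") auto
  have "pawalk_verts (hd vs) (?p @ [(last vs, hd vs)]) = vs @ [hd vs]"
    using a(2) awalk_verts_append[OF w] last by (simp)
  moreover have "distinct (tl (vs @ [hd vs]))"
    using p by (cases vs) (auto simp: is_path_def)
  ultimately have "cycle (?p @ [(last vs, hd vs)])"
    unfolding cycle_def using w by auto
  moreover have "length (?p @ [(last vs, hd vs)]) \<ge> 3" using len by simp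
  ultimately show False using T by (auto simp: undirected_tree_def)
qed

section \<open>Edge lists directed away from the root\<close>

definition edges :: "(bool \<times> 'a \<times> 'a) list \<Rightarrow> ('a \<times> 'a) set" where
  "edges es = snd ` set es"

definition vertices :: "(bool \<times> 'a \<times> 'a) list \<Rightarrow> 'a set" where
  "vertices es = fst ` edges es \<union> snd ` edges es"

text \<open>
  The edge list of a tree in the format of \<open>sol_space\<close>, with current vertex \<open>w\<close>: after a stalk edge the
  walk moves on and never comes back to \<open>w\<close>.
\<close>

fun ordered :: "'a \<Rightarrow> (bool \<times> 'a \<times> 'a) list \<Rightarrow> bool" where
  "ordered w [] = True"
| "ordered w ((True, e) # es) \<longleftrightarrow> fst e = w \<and> snd e \<noteq> w \<and> w \<notin> vertices es \<and> ordered (snd e) es"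
| "ordered w ((False, e) # es) \<longleftrightarrow> fst e = w \<and> snd e \<noteq> w \<and> snd e \<notin> vertices es \<and> ordered w es"

lemma edges_simps [simp]: "edges [] = {}" "edges ((b, e) # es) = insert e (edges es)"
  "edges (es @ es') = edges es \<union> edges es'"
  by (auto simp: edges_def)

lemma vertices_simps [simp]: "vertices [] = {}" "vertices ((b, e) # es) = {fst e, snd e} \<union> vertices es"
  "vertices (es @ es') = vertices es \<union> vertices es'"
  by (auto simp: vertices_def)

lemma finite_edges [simp]: "finite (edges es)" by (simp add: edges_def)

lemma edges_in_vertices: "e \<in> edges es \<Longrightarrow> fst e \<in> vertices es" "e \<in> edges es \<Longrightarrow> snd e \<in> vertices es"
  by (auto simp: vertices_def)

lemma ordered_root: "ordered w es \<Longrightarrow> w \<notin> snd ` edges es"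
  by (induction w es rule: ordered.induct) (auto dest: edges_in_vertices)

lemma ordered_distinct: "ordered w es \<Longrightarrow> distinct (map (snd \<circ> snd) es)"
proof (induction w es rule: ordered.induct)
  case (2 w e es)
  have "snd e \<notin> snd ` edges es" using ordered_root[of "snd e" es] 2 by auto
  thus ?case using 2 by (auto simp: edges_def image_image)
next
  case (3 w e es)
  have "snd e \<notin> snd ` edges es" using 3 by (auto simp: vertices_def)
  thus ?case using 3 by (auto simp: edges_def image_image)
qed simp

lemma ordered_inj: "ordered w es \<Longrightarrow> inj_on snd (edges es)"
  using ordered_distinct[of w es] by (auto simp: edges_def distinct_map inj_on_def)

lemma ordered_antisym: "ordered w es \<Longrightarrow> (a, b) \<in> edges es \<Longrightarrow> (b, a) \<notin> edges es"
  by (induction w es rule: ordered.induct) (auto dest: edges_in_vertices)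

text \<open>Provides the path from the root with last step \<open>e\<close> that membership in
  \<open>tree_edges\<close> requires.\<close>

lemma ordered_reach:
  assumes "ordered w es" "e \<in> edges es"
  shows "\<exists>us. successively (\<lambda>a b. (a, b) \<in> edges es) (us @ [fst e, snd e]) \<and> hd (us @ [fst e, snd e]) = w
    \<and> distinct (us @ [fst e, snd e]) \<and> set (us @ [fst e, snd e]) \<subseteq> insert w (vertices es)"
  using assms
proof (induction w es rule: ordered.induct)
  case (2 w e' es)
  show ?case
  proof (cases "e = e'")
    case True
    thus ?thesis using 2 by (intro exI[of _ "[]"]) auto
  next
    case False
    then obtain us where us: "successively (\<lambda>a b. (a, b) \<in> edges es) (us @ [fst e, snd e])" "hd (us @ [fst e, snd e]) = snd e'"
      "distinct (us @ [fst e, snd e])" "set (us @ [fst e, snd e]) \<subseteq> insert (snd e') (vertices es)"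
      using 2 by auto
    have "successively (\<lambda>a b. (a, b) \<in> edges ((True, e') # es)) (us @ [fst e, snd e])"
      by (rule successively_mono[OF us(1)]) auto
    hence "successively (\<lambda>a b. (a, b) \<in> edges ((True, e') # es)) (w # us @ [fst e, snd e])"
      using us(2) 2(2) by (auto simp: successively_Cons)
    moreover have "w \<notin> set (us @ [fst e, snd e])" using us(4) 2(2) by auto
    ultimately show ?thesis using us(3,4) 2(2) by (intro exI[of _ "w # us"]) auto
  qed
next
  case (3 w e' es)
  show ?case
  proof (cases "e = e'")
    case True
    thus ?thesis using 3 by (intro exI[of _ "[]"]) auto
  next
    case False
    then obtain us where us: "successively (\<lambda>a b. (a, b) \<in> edges es) (us @ [fst e, snd e])" "hd (us @ [fst e, snd e]) = w"
      "distinct (us @ [fst e, snd e])" "set (us @ [fst e, snd e]) \<subseteq> insert w (vertices es)"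
      using 3 by auto
    have "successively (\<lambda>a b. (a, b) \<in> edges ((False, e') # es)) (us @ [fst e, snd e])"
      by (rule successively_mono[OF us(1)]) auto
    thus ?thesis using us(2-4) by (intro exI[of _ us]) auto
  qed
qed simp

definition presents :: "'a pair_pre_digraph \<Rightarrow> 'a \<Rightarrow> (bool \<times> 'a \<times> 'a) list \<Rightarrow> bool" where
  "presents G r es \<longleftrightarrow> ordered r es \<and> pverts G = insert r (vertices es) \<and> parcs G = edges es \<union> prod.swap ` edges es"

text \<open>A path from the root never runs against the orientation. The root has no incoming edge,
  and at any other vertex the unique incoming edge is the one just used, so a step against it would
  revisit the previous vertex.\<close>

lemma presents_path_edges:
  assumes "presents G r es" "is_path G us" "hd us = r"
  shows "successively (\<lambda>a b. (a, b) \<in> edges es) us"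
  using assms(2,3)
proof (induction us rule: rev_induct)
  case (snoc x us)
  show ?case
  proof (cases "us = []")
    case False
    have us: "is_path G us" "hd us = r" "(last us, x) \<in> parcs G" "x \<notin> set us"
      using snoc.prems False by (auto simp: is_path_def successively_append_iff)
    have IH: "successively (\<lambda>a b. (a, b) \<in> edges es) us" using snoc.IH us by blast
    have "(last us, x) \<in> edges es"
    proof (rule ccontr)
      assume "(last us, x) \<notin> edges es"
      hence sw: "(x, last us) \<in> edges es" using us(3) assms(1) by (auto simp: presents_def)
      have ord: "ordered r es" using assms(1) by (simp add: presents_def)
      show False
      proof (cases "butlast us = []")
        case True
        hence "last us = r" using us(2) False by (metis append_butlast_last_id append_Nil list.sel(1))
        thus False using ordered_root[OF ord] sw by force
      next
        case bl: False
        let ?u = "last (butlast us)"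
        have e: "us = butlast us @ [last us]" using False by simp
        have "successively (\<lambda>a b. (a, b) \<in> edges es) (butlast us @ [last us])" using IH e by simp
        hence "(?u, last us) \<in> edges es" using bl by (simp add: successively_append_iff)
        hence "(?u, last us) = (x, last us)"
          using inj_onD[OF ordered_inj[OF ord], of "(?u, last us)" "(x, last us)"] sw by simp
        hence "?u = x" by simp
        thus False using us(4) bl by (metis in_set_butlastD last_in_set)
      qed
    qed
    thus ?thesis using IH False by (simp add: successively_append_iff)
  qed simp
qed simp

lemma presents_tree_edges:
  assumes wf: "pair_wf_digraph G" and p: "presents G r es"
  shows "tree_edges G r = edges es"
proof -
  interpret pair_wf_digraph G by (rule wf)
  show ?thesis
  proof (intro equalityI subsetI)
    fix e assume "e \<in> tree_edges G r"
    then obtain p' where e: "e \<in> parcs G" and a: "apath r (p' @ [e]) (snd e)" by (auto simp: tree_edges_def)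
    let ?vs = "pawalk_verts r (p' @ [e])"
    have vs: "is_path G ?vs" "hd ?vs = r" "p' @ [e] = zip ?vs (tl ?vs)"
      using apath_imp_is_path[OF a] by auto
    have s: "successively (\<lambda>a b. (a, b) \<in> edges es) ?vs" by (rule presents_path_edges[OF p vs(1,2)])
    have "e \<in> set (zip ?vs (tl ?vs))" unfolding vs(3)[symmetric] by simp
    moreover have "set (zip vs (tl vs)) \<subseteq> E" if "successively (\<lambda>a b. (a, b) \<in> E) vs" for vs :: "'a list" and E
      using that by (induction vs rule: induct_list012) auto
    ultimately show "e \<in> edges es" using s by blast
  next
    fix e assume e: "e \<in> edges es"
    then obtain us where us: "successively (\<lambda>a b. (a, b) \<in> edges es) (us @ [fst e, snd e])" "hd (us @ [fst e, snd e]) = r"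
      "distinct (us @ [fst e, snd e])" "set (us @ [fst e, snd e]) \<subseteq> insert r (vertices es)"
      using ordered_reach[of r es e] p by (auto simp: presents_def)
    have "successively (\<lambda>a b. (a, b) \<in> parcs G) (us @ [fst e, snd e])"
      by (rule successively_mono[OF us(1)]) (use p in \<open>auto simp: presents_def\<close>)
    hence ip: "is_path G (us @ [fst e, snd e])" using us p by (auto simp: is_path_def presents_def)
    have z: "zip (us @ [a, b]) (tl (us @ [a, b])) = zip (us @ [a]) (tl (us @ [a])) @ [(a, b)]" for us and a b :: 'a
      by (induction us rule: induct_list012) auto
    have "apath r (zip (us @ [fst e]) (tl (us @ [fst e])) @ [e]) (snd e)"
      using is_path_imp_apath[OF ip] us(2) z[of us "fst e" "snd e"] by simp
    thus "e \<in> tree_edges G r" using e p by (auto simp: tree_edges_def presents_def)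
  qed
qed

text \<open>Besides the outgoing tree edges, exactly the reversal of \<open>j\<close> leaves
  \<open>snd j\<close>; so degree 1 means that no tree edge goes out.\<close>

lemma presents_out_degree:
  assumes p: "presents G r es" and j: "j \<in> edges es"
  shows "out_degree (with_proj G) (snd j) = 1 \<longleftrightarrow> {k \<in> edges es. fst k = snd j} = {}"
proof -
  have ord: "ordered r es" using p by (simp add: presents_def)
  have "out_arcs (with_proj G) (snd j) = insert (prod.swap j) {k \<in> edges es. fst k = snd j}"
    using p j ordered_inj[OF ord] by (force simp: out_arcs_def presents_def inj_on_def)
  moreover have "prod.swap j \<notin> edges es" using ordered_antisym[OF ord, of "fst j" "snd j"] j by (cases j) auto
  ultimately show ?thesis by (simp add: out_degree_def)
qed

text \<open>The list of flags alone fixes the tree. Each step adds one fresh vertex, the current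
  vertex for a stalk edge and the leaf for a pendant edge, and the bijection is extended by sending
  it to its counterpart.\<close>

lemma ordered_isomorphic:
  assumes "ordered w es" "ordered w' es'" "map fst es = map fst es'"
  shows "\<exists>h. bij_betw h (insert w (vertices es)) (insert w' (vertices es')) \<and> h w = w' \<and> map_prod h h ` edges es = edges es'"
  using assms
proof (induction w es arbitrary: w' es' rule: ordered.induct)
  case (1 w)
  thus ?case by (intro exI[of _ "\<lambda>_. w'"]) (auto simp: bij_betw_def)
next
  case (2 w e es)
  obtain e' fs where es': "es' = (True, e') # fs" using 2(4) by (cases es') auto
  obtain h where h: "bij_betw h (insert (snd e) (vertices es)) (insert (snd e') (vertices fs))" "h (snd e) = snd e'"
    "map_prod h h ` edges es = edges fs" using 2 unfolding es' by fastforce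
  have w: "fst e = w" "snd e \<noteq> w" "w \<notin> vertices es" "fst e' = w'" "snd e' \<noteq> w'" "w' \<notin> vertices fs"
    using 2 by (auto simp: es')
  let ?h = "h(w := w')"
  have "bij_betw ?h (insert w (insert (snd e) (vertices es))) (insert w' (insert (snd e') (vertices fs)))"
  proof -
    have "bij_betw ?h (insert (snd e) (vertices es)) (insert (snd e') (vertices fs))"
      using h(1) w by (subst bij_betw_cong[of _ _ h]) auto
    thus ?thesis using w by (subst notIn_Un_bij_betw3[of w _ ?h, symmetric, simplified]) auto
  qed
  moreover have "map_prod ?h ?h ` edges es = map_prod h h ` edges es"
    using w edges_in_vertices by (intro image_cong) (force simp: map_prod_def split: prod.splits)+
  moreover have "map_prod ?h ?h e = e'" using w h(2) by (cases e; cases e') auto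
  moreover have "?h w = w'" by simp
  moreover have "insert w (vertices ((True, e) # es)) = insert w (insert (snd e) (vertices es))"
    "insert w' (vertices es') = insert w' (insert (snd e') (vertices fs))" using w by (auto simp: es')
  moreover have "edges ((True, e) # es) = insert e (edges es)" "edges es' = insert e' (edges fs)" by (simp_all add: es')
  ultimately show ?case using h(3) by (metis image_insert)
next
  case (3 w e es)
  obtain e' fs where es': "es' = (False, e') # fs" using 3(4) by (cases es') auto
  obtain h where h: "bij_betw h (insert w (vertices es)) (insert w' (vertices fs))" "h w = w'"
    "map_prod h h ` edges es = edges fs" using 3 unfolding es' by fastforce
  have w: "fst e = w" "snd e \<noteq> w" "snd e \<notin> vertices es" "fst e' = w'" "snd e' \<noteq> w'" "snd e' \<notin> vertices fs"
    using 3 by (auto simp: es')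
  let ?h = "h(snd e := snd e')"
  have "bij_betw ?h (insert (snd e) (insert w (vertices es))) (insert (snd e') (insert w' (vertices fs)))"
  proof -
    have "bij_betw ?h (insert w (vertices es)) (insert w' (vertices fs))"
      using h(1) w by (subst bij_betw_cong[of _ _ h]) auto
    thus ?thesis using w by (subst notIn_Un_bij_betw3[of "snd e" _ ?h, symmetric, simplified]) auto
  qed
  moreover have "map_prod ?h ?h ` edges es = map_prod h h ` edges es"
    using w edges_in_vertices by (intro image_cong) (force simp: map_prod_def split: prod.splits)+
  moreover have "map_prod ?h ?h e = e'" using w h(2) by (cases e; cases e') auto
  moreover have "?h w = w'" using w h(2) by simp
  moreover have "insert w (vertices ((False, e) # es)) = insert (snd e) (insert w (vertices es))"
    "insert w' (vertices es') = insert (snd e') (insert w' (vertices fs))" using w by (auto simp: es')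
  moreover have "edges ((False, e) # es) = insert e (edges es)" "edges es' = insert e' (edges fs)" by (simp_all add: es')
  ultimately show ?case using h(3) by (metis image_insert)
qed

lemma presents_isomorphic:
  assumes wf: "pair_wf_digraph G" and p: "presents G r es" "presents G' r' es'" and eq: "map fst es = map fst es'"
  shows "digraph_iso (with_proj G) (with_proj G')"
proof -
  interpret pair_wf_digraph G by (rule wf)
  obtain h where h: "bij_betw h (pverts G) (pverts G')" "map_prod h h ` edges es = edges es'"
    using ordered_isomorphic[of r es r' es'] p eq by (auto simp: presents_def)
  let ?f = "\<lparr> iso_verts = h, iso_arcs = map_prod h h, iso_head = snd, iso_tail = fst \<rparr>"
  have inj: "inj_on h (pverts G)" using h(1) by (simp add: bij_betw_def)
  have "parcs G \<subseteq> pverts G \<times> pverts G" using in_arcsD1 in_arcsD2 by auto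
  hence "inj_on (map_prod h h) (parcs G)"
    using map_prod_inj_on[OF inj inj] inj_on_subset by blast
  hence "digraph_isomorphism ?f"
    unfolding digraph_isomorphism_def using inj wf_digraph_wp_iff wf by auto
  moreover have "parcs G' = map_prod h h ` parcs G"
  proof -
    have "map_prod h h ` prod.swap ` E = prod.swap ` map_prod h h ` E" for E by force
    thus ?thesis using p h(2) by (simp add: presents_def image_Un)
  qed
  moreover have "pverts G' = h ` pverts G" using h(1) by (simp add: bij_betw_def)
  ultimately have "pre_digraph.digraph_isomorphism (with_proj G) ?f \<and> with_proj G' = app_iso ?f (with_proj G)"
    by (simp add: app_iso_def with_proj_def)
  thus ?thesis unfolding digraph_iso_def by blast
qed

section \<open>Presentations of caterpillars\<close>

text \<open>The leaves \<open>L w\<close> are listed on arrival at \<open>w\<close>, before the next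
  stalk edge. None are listed at the first vertex, since the root of a caterpillar carries
  none.\<close>

fun stalk_ops :: "('a \<Rightarrow> 'a list) \<Rightarrow> 'a list \<Rightarrow> (bool \<times> 'a \<times> 'a) list" where
  "stalk_ops L (v # w # vs) = (True, (v, w)) # map (\<lambda>x. (False, (w, x))) (L w) @ stalk_ops L (w # vs)"
| "stalk_ops L vs = []"

lemma ordered_pendants:
  assumes "ordered w es" "distinct xs" "w \<notin> set xs" "set xs \<inter> vertices es = {}"
  shows "ordered w (map (\<lambda>x. (False, (w, x))) xs @ es)
    \<and> vertices (map (\<lambda>x. (False, (w, x))) xs @ es) \<subseteq> insert w (set xs \<union> vertices es)"
  using assms by (induction xs) auto

lemma stalk_ops_vertices:
  "vertices (stalk_ops L vs) \<subseteq> set vs \<union> (\<Union>w\<in>set (tl vs). set (L w))"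
proof (induction L vs rule: stalk_ops.induct)
  case (1 L v w vs)
  have "vertices (map (\<lambda>x. (False, (w, x))) xs) \<subseteq> insert w (set xs)" for xs by (induction xs) auto
  from this[of "L w"] show ?case using 1 by auto
qed auto

lemma stalk_ops_ordered:
  assumes "distinct vs" "\<And>w. distinct (L w)" "\<And>w. w \<in> set vs \<Longrightarrow> set (L w) \<inter> set vs = {}"
    and "\<And>w w'. w \<in> set vs \<Longrightarrow> w' \<in> set vs \<Longrightarrow> w \<noteq> w' \<Longrightarrow> set (L w) \<inter> set (L w') = {}" "vs \<noteq> []"
  shows "ordered (hd vs) (stalk_ops L vs)"
  using assms
proof (induction L vs rule: stalk_ops.induct)
  case (1 L v w vs)
  have IH: "ordered w (stalk_ops L (w # vs))"
  proof -
    have "ordered (hd (w # vs)) (stalk_ops L (w # vs))"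
    proof (rule 1(1))
      show "set (L u) \<inter> set (w # vs) = {}" if "u \<in> set (w # vs)" for u using 1(4)[of u] that by auto
      show "set (L u) \<inter> set (L u') = {}" if "u \<in> set (w # vs)" "u' \<in> set (w # vs)" "u \<noteq> u'" for u u'
        using 1(5)[of u u'] that by auto
    qed (use 1 in auto)
    thus ?thesis by simp
  qed
  have V: "vertices (stalk_ops L (w # vs)) \<subseteq> set (w # vs) \<union> (\<Union>u\<in>set vs. set (L u))"
    using stalk_ops_vertices[of L "w # vs"] by simp
  have d: "set (L w) \<inter> vertices (stalk_ops L (w # vs)) = {}"
  proof -
    have *: "x \<notin> set (L u)" if "u \<in> set vs" "x \<in> set (L w)" for u x using 1(2) 1(5)[of w u] that by auto
    have **: "x \<notin> set (w # vs)" if "x \<in> set (L w)" for x using 1(4)[of w] that by auto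
    show ?thesis
    proof (rule equals0I)
      fix x assume "x \<in> set (L w) \<inter> vertices (stalk_ops L (w # vs))"
      thus False using V * ** by blast
    qed
  qed
  have wn: "w \<notin> set (L w)" using 1(4)[of w] by auto
  note P = ordered_pendants[OF IH 1(3) wn d]
  have "v \<notin> insert w (set (L w) \<union> vertices (stalk_ops L (w # vs)))"
  proof -
    have "v \<notin> set (L u)" if "u \<in> set (w # vs)" for u using 1(4)[of u] that by auto
    thus ?thesis using V 1(2) by auto
  qed
  hence "v \<notin> vertices (map (\<lambda>x. (False, (w, x))) (L w) @ stalk_ops L (w # vs))" using P by blast
  thus ?case using P 1(2) by auto
qed auto

lemma stalk_ops_edges:
  "edges (stalk_ops L vs) = set (zip vs (tl vs)) \<union> {(w, x). w \<in> set (tl vs) \<and> x \<in> set (L w)}"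
proof (induction L vs rule: stalk_ops.induct)
  case (1 L v w vs)
  have "edges (map (\<lambda>x. (False, (w, x))) (L w)) = {w} \<times> set (L w)" by (auto simp: edges_def image_image)
  thus ?case using 1 by auto
qed auto

text \<open>Establishes the normal form, stalk edges at both ends of the list, under which the shape
  is recoverable from the polynomials.\<close>

lemma stalk_ops_last:
  assumes "length vs \<ge> 2" "L (last vs) = []"
  shows "stalk_ops L vs \<noteq> [] \<and> fst (hd (stalk_ops L vs)) \<and> fst (last (stalk_ops L vs))"
  using assms
proof (induction L vs rule: stalk_ops.induct)
  case (1 L v w vs)
  show ?case
  proof (cases vs)
    case Nil thus ?thesis using 1 by simp
  next
    case (Cons a vs')
    hence "stalk_ops L (w # vs) \<noteq> [] \<and> fst (last (stalk_ops L (w # vs)))" using 1 by simp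
    thus ?thesis by simp
  qed
qed auto

lemma is_path_take_drop:
  assumes "is_path G vs" "i < length vs" "n > 0"
  shows "is_path G (take n (drop i vs))"
proof -
  have e: "vs = take i vs @ take n (drop i vs) @ drop n (drop i vs)" by (simp only: append_take_drop_id)
  have "successively (\<lambda>a b. (a, b) \<in> parcs G) (take i vs @ take n (drop i vs) @ drop n (drop i vs))"
    using assms(1) unfolding e[symmetric] by (simp add: is_path_def)
  hence "successively (\<lambda>a b. (a, b) \<in> parcs G) (take n (drop i vs))"
    by (simp only: successively_append_iff)
  moreover have "set (take n (drop i vs)) \<subseteq> set vs" using set_take_subset set_drop_subset by (metis subset_trans)
  moreover have "distinct (take n (drop i vs))" using assms(1) by (simp add: is_path_def)
  ultimately show ?thesis using assms by (auto simp: is_path_def)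
qed

lemma is_path_Cons:
  assumes "is_path G vs" "v \<notin> set vs" "v \<in> pverts G" "(v, hd vs) \<in> parcs G"
  shows "is_path G (v # vs)"
  using assms by (auto simp: is_path_def successively_Cons)

lemma is_path_snoc:
  assumes "is_path G vs" "v \<notin> set vs" "v \<in> pverts G" "(last vs, v) \<in> parcs G"
  shows "is_path G (vs @ [v])"
  using assms by (auto simp: is_path_def successively_append_iff)

text \<open>Acyclicity excludes chords of the stalk, vertices attached to it twice and edges off it;
  maximal length excludes leaves at its two end vertices. What remains are the stalk edges and
  leaves at inner stalk vertices, which \<open>stalk_ops\<close> lists.\<close>

lemma rooted_caterpillar_presents:
  assumes "rooted_caterpillar G r"
  shows "\<exists>es. presents G r es \<and> es \<noteq> [] \<and> fst (hd es) \<and> fst (last es)"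
proof -
  obtain p w where T: "undirected_tree G" and card: "2 \<le> card (pverts G)" and st: "stalk G r p w"
    using assms by (auto simp: rooted_caterpillar_def caterpillar_def)
  interpret pair_graph G using T by (simp add: undirected_tree_def)
  note sym = arcs_symmetric
  define vs where "vs = pawalk_verts r p"
  have ap: "apath r p w" using st by (simp add: stalk_def)
  have vs: "is_path G vs" "hd vs = r" "p = zip vs (tl vs)" using apath_imp_is_path[OF ap] by (auto simp: vs_def)
  have near: "\<exists>a\<in>set vs. v = a \<or> (a, v) \<in> parcs G" if "v \<in> pverts G" for v
    using st that by (auto simp: stalk_def within_distance_1_def vs_def)
  have longest: "length us \<le> length vs" if us: "is_path G us" for us
  proof -
    have "apath (hd us) (zip us (tl us)) (last us)" using is_path_imp_apath[OF us] by simp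
    hence "length (zip us (tl us)) \<le> length p" using st unfolding stalk_def by blast
    hence "length us - 1 \<le> length vs - 1" using vs(3) by simp
    moreover have "length vs > 0" using vs(1) by (simp add: is_path_def)
    ultimately show ?thesis by linarith
  qed
  have short: "length us \<le> 2" if "is_path G us" "(last us, hd us) \<in> parcs G" for us
    using is_path_closed_imp_short[OF T that] .
  have vne: "vs \<noteq> []" and vd: "distinct vs" and vsub: "set vs \<subseteq> pverts G" using vs(1) by (auto simp: is_path_def)
  have consec: "(vs ! i, vs ! Suc i) \<in> parcs G" if "Suc i < length vs" for i
    using vs(1) that by (auto simp: is_path_def successively_conv_nth)
  \<comment> \<open>The part of the stalk from index \<open>i\<close> to index \<open>j\<close>,
    both included.\<close>
  define seg where "seg i j = take (Suc j - i) (drop i vs)" for i j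
  have seg: "is_path G (seg i j)" "hd (seg i j) = vs ! i" "last (seg i j) = vs ! j" "length (seg i j) = Suc j - i"
    "set (seg i j) \<subseteq> set vs" if "i \<le> j" "j < length vs" for i j
  proof -
    show "is_path G (seg i j)" unfolding seg_def using that by (intro is_path_take_drop[OF vs(1)]) auto
    show l: "length (seg i j) = Suc j - i" using that by (simp add: seg_def)
    show "hd (seg i j) = vs ! i" using that by (simp add: seg_def hd_drop_conv_nth)
    have ne: "seg i j \<noteq> []" using l that by auto
    show "last (seg i j) = vs ! j" unfolding last_conv_nth[OF ne] l using that by (simp add: seg_def)
    show "set (seg i j) \<subseteq> set vs" unfolding seg_def by (metis set_take_subset set_drop_subset subset_trans)
  qed
  \<comment> \<open>An edge joining the ends of a segment closes a cycle unless the segment has only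
    two vertices.\<close>
  have chord: "j = Suc i" if "i < j" "j < length vs" "(vs ! j, vs ! i) \<in> parcs G" for i j
    using short[of "seg i j"] seg[of i j] that by simp
  have leaf_unique: "i = j" if x: "x \<in> pverts G" "x \<notin> set vs" and ij: "i < length vs" "j < length vs" "(vs ! i, x) \<in> parcs G" "(vs ! j, x) \<in> parcs G" for x i j
  proof -
    have *: False if ij: "i < j" "j < length vs" "(vs ! i, x) \<in> parcs G" "(vs ! j, x) \<in> parcs G" for i j
    proof -
      have "is_path G (x # seg i j)"
        using seg[of i j] ij x sym[OF ij(3)] by (intro is_path_Cons) auto
      moreover have "(last (x # seg i j), hd (x # seg i j)) \<in> parcs G" using seg[of i j] ij by (auto simp: is_path_def)
      ultimately have "length (x # seg i j) \<le> 2" by (rule short)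
      thus False using seg(4)[of i j] ij by simp
    qed
    show ?thesis using *[of i j] *[of j i] ij by (meson linorder_neqE_nat)
  qed
  \<comment> \<open>Both vertices have neighbours on the stalk, so the edge between them would close
    a cycle of at least three vertices through the segment joining these neighbours.\<close>
  have off: False if xy: "x \<notin> set vs" "y \<notin> set vs" "(x, y) \<in> parcs G" for x y
  proof -
    have xv: "x \<in> pverts G" "y \<in> pverts G" "x \<noteq> y" using xy(3) in_arcsD1 in_arcsD2 no_loops' by auto
    obtain i where i: "i < length vs" "(vs ! i, x) \<in> parcs G" using near[OF xv(1)] xy(1) by (auto simp: in_set_conv_nth)
    obtain j where j: "j < length vs" "(vs ! j, y) \<in> parcs G" using near[OF xv(2)] xy(2) by (auto simp: in_set_conv_nth)
    have *: False if "i \<le> j" "j < length vs" "(vs ! i, x) \<in> parcs G" "(vs ! j, y) \<in> parcs G" "x \<notin> set vs" "y \<notin> set vs" "(x, y) \<in> parcs G"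
      "x \<in> pverts G" "y \<in> pverts G" "x \<noteq> y" for i j x y
    proof -
      have "is_path G (x # seg i j)"
        using seg[of i j] that sym[OF that(3)] by (intro is_path_Cons) auto
      hence "is_path G ((x # seg i j) @ [y])"
        using seg[of i j] that by (intro is_path_snoc) (auto simp: is_path_def)
      moreover have "(last ((x # seg i j) @ [y]), hd ((x # seg i j) @ [y])) \<in> parcs G" using sym[OF that(7)] by simp
      ultimately have "length ((x # seg i j) @ [y]) \<le> 2" by (rule short)
      thus False using seg(4)[of i j] that by simp
    qed
    show False
    proof (cases "i \<le> j")
      case True thus False using *[of i j x y] i j xy xv by blast
    next
      case False thus False using *[of j i y x] i j xy xv sym by auto
    qed
  qed
  \<comment> \<open>A leaf here could be prepended to the stalk, giving a longer path.\<close>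
  have leaf_hd: "(hd vs, x) \<notin> parcs G" if "x \<notin> set vs" for x
  proof
    assume a: "(hd vs, x) \<in> parcs G"
    hence "is_path G (x # vs)" using that sym[OF a] in_arcsD2[OF a] by (intro is_path_Cons vs(1)) auto
    from longest[OF this] show False by simp
  qed
  have leaf_last: "(last vs, x) \<notin> parcs G" if "x \<notin> set vs" for x
  proof
    assume a: "(last vs, x) \<in> parcs G"
    hence "is_path G (vs @ [x])" using that in_arcsD2[OF a] by (intro is_path_snoc vs(1)) auto
    from longest[OF this] show False by simp
  qed
  have len: "length vs \<ge> 2"
  proof (rule ccontr)
    assume "\<not> length vs \<ge> 2"
    hence v1: "vs = [r]" using vne vs(2) by (cases vs; cases "tl vs") auto
    have "pverts G \<subseteq> {r}"
    proof
      fix x assume "x \<in> pverts G"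
      thus "x \<in> {r}" using near[of x] leaf_hd[of x] v1 by auto
    qed
    hence "card (pverts G) \<le> 1" using card_mono[of "{r}" "pverts G"] by simp
    thus False using card by simp
  qed
  define A where "A v = {x. (v, x) \<in> parcs G \<and> x \<notin> set vs}" for v
  have finA: "finite (A v)" for v
    by (rule finite_subset[OF _ pair_finite_verts]) (auto simp: A_def dest: in_arcsD2)
  define L where "L v = (SOME xs. set xs = A v \<and> distinct xs)" for v
  have L: "set (L v) = A v" "distinct (L v)" for v
    using someI_ex[OF finite_distinct_list[OF finA[of v]]] by (auto simp: L_def)
  have Lhd: "A (hd vs) = {}" using leaf_hd by (auto simp: A_def)
  have "A (last vs) = {}" using leaf_last by (auto simp: A_def)
  hence Llast: "L (last vs) = []" using L(1)[of "last vs"] by simp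
  let ?es = "stalk_ops L vs"
  have Adisj: "A w1 \<inter> A w2 = {}" if w12: "w1 \<in> set vs" "w2 \<in> set vs" "w1 \<noteq> w2" for w1 w2
  proof -
    have False if "x \<in> A w1" "x \<in> A w2" for x
    proof -
      obtain i where i: "i < length vs" "vs ! i = w1" using w12(1) by (auto simp: in_set_conv_nth)
      obtain j where j: "j < length vs" "vs ! j = w2" using w12(2) by (auto simp: in_set_conv_nth)
      have "i = j" using leaf_unique[of x i j] i j that in_arcsD2 by (auto simp: A_def)
      thus False using i j w12 by simp
    qed
    thus ?thesis by blast
  qed
  have ord: "ordered r ?es"
  proof -
    have "ordered (hd vs) ?es"
    proof (rule stalk_ops_ordered[OF vd L(2) _ _ vne])
      show "set (L u) \<inter> set vs = {}" for u by (auto simp: L A_def)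
      show "set (L u) \<inter> set (L u') = {}" if "u \<in> set vs" "u' \<in> set vs" "u \<noteq> u'" for u u'
        unfolding L using Adisj that .
    qed
    thus ?thesis using vs(2) by simp
  qed
  have E: "edges ?es = set (zip vs (tl vs)) \<union> {(w, x). w \<in> set (tl vs) \<and> x \<in> A w}"
    unfolding stalk_ops_edges L ..
  have zipE: "set (zip vs (tl vs)) = {(vs ! i, vs ! Suc i) |i. Suc i < length vs}"
    by (auto simp: set_zip nth_tl)
  have tlset: "set vs = insert r (set (tl vs))" using vne vs(2) by (cases vs) auto
  have E': "(v, x) \<in> edges ?es" if "v \<in> set vs" "x \<in> A v" for v x
    using that Lhd vs(2) tlset by (auto simp: E)
  have Esub: "edges ?es \<subseteq> parcs G" unfolding E zipE using consec by (auto simp: A_def)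
  have arcs: "parcs G = edges ?es \<union> prod.swap ` edges ?es"
  proof (intro equalityI subsetI)
    fix e assume e: "e \<in> parcs G"
    obtain a b where ab: "e = (a, b)" by (cases e)
    consider "a \<in> set vs" "b \<in> set vs" | "a \<in> set vs" "b \<notin> set vs" | "a \<notin> set vs" "b \<in> set vs"
      using off e ab by blast
    thus "e \<in> edges ?es \<union> prod.swap ` edges ?es"
    proof cases
      case 1
      then obtain i j where ij: "i < length vs" "a = vs ! i" "j < length vs" "b = vs ! j" by (auto simp: in_set_conv_nth)
      have "i \<noteq> j" using no_loops' e ab ij by auto
      then consider "i < j" | "j < i" by linarith
      thus ?thesis
      proof cases
        case 1
        have "j = Suc i" by (rule chord[OF 1 ij(3)]) (use sym e ab ij in auto)
        thus ?thesis using ij ab by (auto simp: E zipE)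
      next
        case 2
        have "i = Suc j" by (rule chord[OF 2 ij(1)]) (use e ab ij in auto)
        hence "(b, a) \<in> edges ?es" using ij by (auto simp: E zipE)
        thus ?thesis using ab by force
      qed
    next
      case 2
      thus ?thesis using E'[of a b] e ab by (auto simp: A_def)
    next
      case 3
      hence "(b, a) \<in> edges ?es" using E'[of b a] sym e ab by (auto simp: A_def)
      thus ?thesis using ab by force
    qed
  next
    fix e assume "e \<in> edges ?es \<union> prod.swap ` edges ?es"
    thus "e \<in> parcs G" using Esub sym by (auto simp: prod.swap_def)
  qed
  have verts: "pverts G = insert r (vertices ?es)"
  proof (intro equalityI subsetI)
    fix x assume x: "x \<in> pverts G"
    show "x \<in> insert r (vertices ?es)"
    proof (cases "x \<in> set vs")
      case True
      then obtain i where i: "i < length vs" "x = vs ! i" by (auto simp: in_set_conv_nth)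
      show ?thesis
      proof (cases i)
        case 0 thus ?thesis using i vs(2) vne by (simp add: hd_conv_nth)
      next
        case (Suc k)
        hence "(vs ! k, x) \<in> edges ?es" using i by (auto simp: E zipE)
        thus ?thesis using edges_in_vertices by fastforce
      qed
    next
      case False
      then obtain a where "a \<in> set vs" "(a, x) \<in> parcs G" using near[OF x] by auto
      hence "(a, x) \<in> edges ?es" using E'[of a x] False by (auto simp: A_def)
      thus ?thesis using edges_in_vertices by fastforce
    qed
  next
    fix x assume "x \<in> insert r (vertices ?es)"
    thus "x \<in> pverts G" using vsub tlset
      by (auto simp: vertices_def dest!: subsetD[OF Esub] dest: in_arcsD1 in_arcsD2)
  qed
  have "presents G r ?es" using ord verts arcs by (simp add: presents_def)
  thus ?thesis using stalk_ops_last[of vs L, OF len Llast] by blast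
qed

section \<open>Eigenspaces of caterpillars\<close>

text \<open>The description of \<open>sol_space\<close> by conditions instead of recursion. At a
  leaf the Kirchhoff sum is empty and becomes the Neumann condition, so no case distinction is
  needed. For empty \<open>E\<close> the value \<open>a\<close> is free and \<open>b\<close> is 0,
  as at the end of the stalk.\<close>

definition branch_solutions where
  "branch_solutions l q z E w = {(y, a, b).
     \<exists>y'. (\<forall>j\<in>E. sturm_liouville_solution l (q j) z (y j) (y' j)) \<and>
       (\<forall>j x. j \<notin> E \<or> x \<notin> {0..l} \<longrightarrow> y j x = 0) \<and>
       (\<forall>j\<in>E. (\<forall>k\<in>E. fst k = snd j \<longrightarrow> y j l = y k 0) \<and> y' j l = (\<Sum>k | k \<in> E \<and> fst k = snd j. y' k 0)) \<and>
       (\<forall>k\<in>E. fst k = w \<longrightarrow> y k 0 = a) \<and> b = (\<Sum>k | k \<in> E \<and> fst k = w. y' k 0)}"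

lemma schroedinger_cong:
  assumes "schroedinger l Q y y'" "\<And>x. x \<in> {0..l} \<Longrightarrow> u x = y x" and l: "0 \<le> l"
  shows "schroedinger l Q u y'"
proof -
  have "has_ac_derivative l u y'" unfolding has_ac_derivative_def
  proof (intro conjI ballI)
    show "y' absolutely_integrable_on {0..l}" using assms(1) by (simp add: schroedinger_def has_ac_derivative_def)
    fix x assume x: "x \<in> {0..l}"
    have "u x = y x" "u 0 = y 0" using assms(2)[of x] assms(2)[of 0] x l by auto
    thus "(y' has_integral (u x - u 0)) {0..x}"
      using assms(1) x by (simp add: schroedinger_def has_ac_derivative_def)
  qed
  moreover have "has_ac_derivative l y' (\<lambda>x. Q x * u x)"
  proof (rule has_ac_derivative_AE_cong)
    show "has_ac_derivative l y' (\<lambda>x. Q x * y x)" using assms(1) by (simp add: schroedinger_def)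
    show "AE x in lebesgue. x \<in> {0<..<l} \<longrightarrow> Q x * u x = Q x * y x"
      by (rule AE_I2) (use assms(2) in simp)
  qed
  ultimately show ?thesis by (simp add: schroedinger_def)
qed

lemma branch_solutions_empty: "branch_solutions l q z {} w = {(0, t, 0) |t. True}"
  by (auto simp: branch_solutions_def fun_eq_iff)

text \<open>The edge \<open>e\<close> is the only one at \<open>v\<close>. Its solution is
  determined by value and derivative at the far end, and the conditions at \<open>w\<close> identify
  these with the boundary data of the remaining branch.\<close>

lemma branch_solutions_stalk:
  assumes fin: "finite E" and e: "fst e = v" "snd e = w" "w \<noteq> v" and v: "v \<notin> fst ` E" "v \<notin> snd ` E"
    and ep: "edge_potential l (q e)"
  shows "branch_solutions l q z (insert e E) v =
     {(y + on_edge l e (fst (evp l (q e) a b z)), tr11 l (q e) z * a + tr12 l (q e) z * b,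
        tr21 l (q e) z * a + tr22 l (q e) z * b) |y a b. (y, a, b) \<in> branch_solutions l q z E w}"
    (is "_ = ?R")
proof -
  interpret edge_potential l "q e" by (rule ep)
  have eE: "e \<notin> E" using v e by auto
  have v': "fst k \<noteq> v" if "k \<in> E" for k using v(1) that by blast
  have out_v: "{k \<in> insert e E. fst k = v} = {e}" using v' e by auto
  have out: "{k \<in> insert e E. fst k = u} = {k \<in> E. fst k = u}" if "u \<noteq> v" for u using e that by auto
  have lx: "0 \<in> {0..l}" "l \<in> {0..l}" using l by auto
  show ?thesis
  proof (intro equalityI subsetI)
    fix t assume "t \<in> branch_solutions l q z (insert e E) v"
    then obtain y y' a b where t: "t = (y, a, b)"
      and sol: "\<And>j. j \<in> insert e E \<Longrightarrow> sturm_liouville_solution l (q j) z (y j) (y' j)"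
      and supp: "\<And>j x. j \<notin> insert e E \<or> x \<notin> {0..l} \<Longrightarrow> y j x = 0"
      and cont: "\<And>j k. j \<in> insert e E \<Longrightarrow> k \<in> insert e E \<Longrightarrow> fst k = snd j \<Longrightarrow> y j l = y k 0"
      and kirch: "\<And>j. j \<in> insert e E \<Longrightarrow> y' j l = (\<Sum>k | k \<in> insert e E \<and> fst k = snd j. y' k 0)"
      and a: "\<And>k. k \<in> insert e E \<Longrightarrow> fst k = v \<Longrightarrow> y k 0 = a" and b: "b = (\<Sum>k | k \<in> insert e E \<and> fst k = v. y' k 0)"
      unfolding branch_solutions_def by blast
    let ?f = "evp l (q e) (y e l) (y' e l) z"
    have u: "y e x = fst ?f x" "y' e x = snd ?f x" if "x \<in> {0..l}" for x
      using evp_unique[OF _ that, of z "y e" "y' e"] sol[of e] by (auto simp: sturm_liouville_solution_iff)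
    define y0 where "y0 = y(e := (\<lambda>x. 0))"
    have "y = y0 + on_edge l e (fst ?f)"
    proof (intro ext)
      fix j x
      show "y j x = (y0 + on_edge l e (fst ?f)) j x"
        using u(1)[of x] supp[of e x] by (cases "j = e"; cases "x \<in> {0..l}") (auto simp: y0_def on_edge_def)
    qed
    moreover have "a = tr11 l (q e) z * y e l + tr12 l (q e) z * y' e l"
      using a[of e] e u(1)[OF lx(1)] by (simp add: evp)
    moreover have "b = tr21 l (q e) z * y e l + tr22 l (q e) z * y' e l"
      unfolding b out_v using u(2)[OF lx(1)] by (simp add: evp)
    moreover have "(y0, y e l, y' e l) \<in> branch_solutions l q z E w"
    proof -
      have 1: "sturm_liouville_solution l (q j) z (y0 j) (y' j)" if "j \<in> E" for j
        using sol[of j] that eE by (auto simp: y0_def)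
      have 2: "y0 j x = 0" if "j \<notin> E \<or> x \<notin> {0..l}" for j x using supp[of j x] that by (auto simp: y0_def)
      have 3: "y0 j l = y0 k 0" if "j \<in> E" "k \<in> E" "fst k = snd j" for j k
        using cont[of j k] that eE by (auto simp: y0_def)
      have 4: "y' j l = (\<Sum>k | k \<in> E \<and> fst k = snd j. y' k 0)" if "j \<in> E" for j
        using kirch[of j] out[of "snd j"] that v(2) by (auto simp: image_iff)
      have 5: "y0 k 0 = y e l" if "k \<in> E" "fst k = w" for k
        using cont[of e k] that e eE by (auto simp: y0_def)
      have 6: "y' e l = (\<Sum>k | k \<in> E \<and> fst k = w. y' k 0)"
        using kirch[of e] out[of w] e by auto
      show ?thesis unfolding branch_solutions_def using 1 2 3 4 5 6 by blast
    qed
    ultimately show "t \<in> ?R" unfolding t by blast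
  next
    fix t assume "t \<in> ?R"
    then obtain y0 a b where t: "t = (y0 + on_edge l e (fst (evp l (q e) a b z)), tr11 l (q e) z * a + tr12 l (q e) z * b,
        tr21 l (q e) z * a + tr22 l (q e) z * b)" and "(y0, a, b) \<in> branch_solutions l q z E w" by blast
    then obtain y' where
      sol: "\<And>j. j \<in> E \<Longrightarrow> sturm_liouville_solution l (q j) z (y0 j) (y' j)"
      and supp: "\<And>j x. j \<notin> E \<or> x \<notin> {0..l} \<Longrightarrow> y0 j x = 0"
      and cont: "\<And>j k. j \<in> E \<Longrightarrow> k \<in> E \<Longrightarrow> fst k = snd j \<Longrightarrow> y0 j l = y0 k 0"
      and kirch: "\<And>j. j \<in> E \<Longrightarrow> y' j l = (\<Sum>k | k \<in> E \<and> fst k = snd j. y' k 0)"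
      and a: "\<And>k. k \<in> E \<Longrightarrow> fst k = w \<Longrightarrow> y0 k 0 = a" and b: "b = (\<Sum>k | k \<in> E \<and> fst k = w. y' k 0)"
      unfolding branch_solutions_def by blast
    let ?f = "evp l (q e) a b z"
    define y where "y = y0 + on_edge l e (fst ?f)"
    define u' where "u' = y'(e := snd ?f)"
    have ye: "y e x = fst ?f x" if "x \<in> {0..l}" for x using supp[of e x] eE that by (simp add: y_def on_edge_def)
    have yj: "y j = y0 j" if "j \<noteq> e" for j using that by (auto simp: y_def on_edge_def)
    have u'j: "u' j = y' j" if "j \<noteq> e" for j using that by (simp add: u'_def)
    have sumE: "(\<Sum>k | k \<in> E \<and> fst k = u. u' k 0) = (\<Sum>k | k \<in> E \<and> fst k = u. y' k 0)" for u
      using eE by (intro sum.cong refl) (auto simp: u'_def)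
    have "schroedinger l (\<lambda>x. complex_of_real (q e x) - z) (y e) (snd ?f)"
      by (rule schroedinger_cong[OF evp(1) ye]) (use l in auto)
    hence 1: "sturm_liouville_solution l (q j) z (y j) (u' j)" if "j \<in> insert e E" for j
      using sol[of j] yj[of j] u'j[of j] that eE by (cases "j = e") (auto simp: sturm_liouville_solution_iff u'_def)
    have 2: "y j x = 0" if "j \<notin> insert e E \<or> x \<notin> {0..l}" for j x
      using supp[of j x] that by (auto simp: y_def on_edge_def)
    have 3: "y j l = y k 0" if jk: "j \<in> insert e E" "k \<in> insert e E" "fst k = snd j" for j k
    proof -
      have kE: "k \<in> E" "k \<noteq> e" using jk e v eE by (auto simp: image_iff)
      show ?thesis
      proof (cases "j = e")
        case True
        thus ?thesis using a[of k] kE jk e ye[OF lx(2)] yj[of k] by (simp add: evp)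
      next
        case False
        thus ?thesis using cont[of j k] kE jk yj by auto
      qed
    qed
    have 4: "u' j l = (\<Sum>k | k \<in> insert e E \<and> fst k = snd j. u' k 0)" if j: "j \<in> insert e E" for j
    proof -
      have sj: "snd j \<noteq> v" using j e v by (auto simp: image_iff)
      show ?thesis unfolding out[OF sj] sumE
        using kirch[of j] b j e u'j[of j] eE by (cases "j = e") (auto simp: u'_def evp)
    qed
    have 5: "y k 0 = tr11 l (q e) z * a + tr12 l (q e) z * b" if "k \<in> insert e E" "fst k = v" for k
    proof -
      have "k = e" using that v by (auto simp: image_iff)
      thus ?thesis using ye[OF lx(1)] by (simp add: evp)
    qed
    have 6: "tr21 l (q e) z * a + tr22 l (q e) z * b = (\<Sum>k | k \<in> insert e E \<and> fst k = v. u' k 0)"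
      unfolding out_v by (simp add: u'_def evp)
    show "t \<in> branch_solutions l q z (insert e E) v"
      unfolding t y_def[symmetric] branch_solutions_def using 1 2 3 4 5 6 by blast
  qed
qed

text \<open>The derivative vanishes at the leaf, so the leaf value \<open>t\<close> determines the
  solution on \<open>e\<close>. Continuity at \<open>w\<close> ties \<open>t\<close> to the value
  \<open>a\<close>, and the edge adds its derivative to the sum there.\<close>

lemma branch_solutions_pendant:
  assumes fin: "finite E" and e: "fst e = w" "snd e = x" "w \<noteq> x" and x: "x \<notin> fst ` E" "x \<notin> snd ` E"
    and w: "w \<notin> snd ` E" and ep: "edge_potential l (q e)"
  shows "branch_solutions l q z (insert e E) w =
     {(y + on_edge l e (fst (evp l (q e) t 0 z)), a, b + tr21 l (q e) z * t) |y a b t.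
        (y, a, b) \<in> branch_solutions l q z E w \<and> a = tr11 l (q e) z * t}"
    (is "_ = ?R")
proof -
  interpret edge_potential l "q e" by (rule ep)
  have eE: "e \<notin> E" using x e by force
  have out_w: "{k \<in> insert e E. fst k = w} = insert e {k \<in> E. fst k = w}" using e by auto
  have "fst k \<noteq> x" if "k \<in> E" for k using that x(1) by blast
  hence "fst k \<noteq> x" if "k \<in> insert e E" for k using that e by (cases "k = e") auto
  hence out_x: "{k \<in> insert e E. fst k = x} = {}" by blast
  have out: "{k \<in> insert e E. fst k = u} = {k \<in> E. fst k = u}" if "u \<noteq> w" for u using e that by auto
  have lx: "0 \<in> {0..l}" "l \<in> {0..l}" using l by auto
  show ?thesis
  proof (intro equalityI subsetI)
    fix s assume "s \<in> branch_solutions l q z (insert e E) w"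
    then obtain y y' a b where s: "s = (y, a, b)"
      and sol: "\<And>j. j \<in> insert e E \<Longrightarrow> sturm_liouville_solution l (q j) z (y j) (y' j)"
      and supp: "\<And>j x. j \<notin> insert e E \<or> x \<notin> {0..l} \<Longrightarrow> y j x = 0"
      and cont: "\<And>j k. j \<in> insert e E \<Longrightarrow> k \<in> insert e E \<Longrightarrow> fst k = snd j \<Longrightarrow> y j l = y k 0"
      and kirch: "\<And>j. j \<in> insert e E \<Longrightarrow> y' j l = (\<Sum>k | k \<in> insert e E \<and> fst k = snd j. y' k 0)"
      and a: "\<And>k. k \<in> insert e E \<Longrightarrow> fst k = w \<Longrightarrow> y k 0 = a" and b: "b = (\<Sum>k | k \<in> insert e E \<and> fst k = w. y' k 0)"
      unfolding branch_solutions_def by blast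
    define t where "t = y e l"
    have "y' e l = 0" using kirch[of e] e unfolding e(2) out_x by simp
    let ?f = "evp l (q e) t 0 z"
    have u: "y e x = fst ?f x" "y' e x = snd ?f x" if "x \<in> {0..l}" for x
      using evp_unique[OF _ that, of z "y e" "y' e"] sol[of e] \<open>y' e l = 0\<close> by (auto simp: sturm_liouville_solution_iff t_def)
    define y0 where "y0 = y(e := (\<lambda>x. 0))"
    have "y = y0 + on_edge l e (fst ?f)"
    proof (intro ext)
      fix j x
      show "y j x = (y0 + on_edge l e (fst ?f)) j x"
        using u(1)[of x] supp[of e x] by (cases "j = e"; cases "x \<in> {0..l}") (auto simp: y0_def on_edge_def)
    qed
    moreover have "a = tr11 l (q e) z * t"
      using a[of e] e u(1)[OF lx(1)] by (simp add: evp)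
    moreover have "b = (\<Sum>k | k \<in> E \<and> fst k = w. y' k 0) + tr21 l (q e) z * t"
      unfolding b out_w using u(2)[OF lx(1)] fin eE by (simp add: evp)
    moreover have "(y0, a, \<Sum>k | k \<in> E \<and> fst k = w. y' k 0) \<in> branch_solutions l q z E w"
    proof -
      have 1: "sturm_liouville_solution l (q j) z (y0 j) (y' j)" if "j \<in> E" for j
        using sol[of j] that eE by (auto simp: y0_def)
      have 2: "y0 j x = 0" if "j \<notin> E \<or> x \<notin> {0..l}" for j x using supp[of j x] that by (auto simp: y0_def)
      have 3: "y0 j l = y0 k 0" if "j \<in> E" "k \<in> E" "fst k = snd j" for j k
        using cont[of j k] that eE by (auto simp: y0_def)
      have 4: "y' j l = (\<Sum>k | k \<in> E \<and> fst k = snd j. y' k 0)" if "j \<in> E" for j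
        using kirch[of j] out[of "snd j"] that w by (auto simp: image_iff)
      have 5: "y0 k 0 = a" if "k \<in> E" "fst k = w" for k
        using a[of k] that eE by (auto simp: y0_def)
      show ?thesis unfolding branch_solutions_def using 1 2 3 4 5 by blast
    qed
    ultimately show "s \<in> ?R" unfolding s by blast
  next
    fix s assume "s \<in> ?R"
    then obtain y0 a b t where s: "s = (y0 + on_edge l e (fst (evp l (q e) t 0 z)), a, b + tr21 l (q e) z * t)"
      and at: "a = tr11 l (q e) z * t" and "(y0, a, b) \<in> branch_solutions l q z E w" by blast
    then obtain y' where
      sol: "\<And>j. j \<in> E \<Longrightarrow> sturm_liouville_solution l (q j) z (y0 j) (y' j)"
      and supp: "\<And>j x. j \<notin> E \<or> x \<notin> {0..l} \<Longrightarrow> y0 j x = 0"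
      and cont: "\<And>j k. j \<in> E \<Longrightarrow> k \<in> E \<Longrightarrow> fst k = snd j \<Longrightarrow> y0 j l = y0 k 0"
      and kirch: "\<And>j. j \<in> E \<Longrightarrow> y' j l = (\<Sum>k | k \<in> E \<and> fst k = snd j. y' k 0)"
      and a: "\<And>k. k \<in> E \<Longrightarrow> fst k = w \<Longrightarrow> y0 k 0 = a" and b: "b = (\<Sum>k | k \<in> E \<and> fst k = w. y' k 0)"
      unfolding branch_solutions_def by blast
    let ?f = "evp l (q e) t 0 z"
    define y where "y = y0 + on_edge l e (fst ?f)"
    define u' where "u' = y'(e := snd ?f)"
    have ye: "y e x = fst ?f x" if "x \<in> {0..l}" for x using supp[of e x] eE that by (simp add: y_def on_edge_def)
    have yj: "y j = y0 j" if "j \<noteq> e" for j using that by (auto simp: y_def on_edge_def)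
    have u'j: "u' j = y' j" if "j \<noteq> e" for j using that by (simp add: u'_def)
    have sumE: "(\<Sum>k | k \<in> E \<and> fst k = u. u' k 0) = (\<Sum>k | k \<in> E \<and> fst k = u. y' k 0)" for u
      using eE by (intro sum.cong refl) (auto simp: u'_def)
    have "schroedinger l (\<lambda>x. complex_of_real (q e x) - z) (y e) (snd ?f)"
      by (rule schroedinger_cong[OF evp(1) ye]) (use l in auto)
    hence 1: "sturm_liouville_solution l (q j) z (y j) (u' j)" if "j \<in> insert e E" for j
      using sol[of j] yj[of j] u'j[of j] that eE by (cases "j = e") (auto simp: sturm_liouville_solution_iff u'_def)
    have 2: "y j x = 0" if "j \<notin> insert e E \<or> x \<notin> {0..l}" for j x
      using supp[of j x] that by (auto simp: y_def on_edge_def)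
    have 3: "y j l = y k 0" if jk: "j \<in> insert e E" "k \<in> insert e E" "fst k = snd j" for j k
    proof -
      have "j \<noteq> e" using jk e x by (auto simp: image_iff)
      moreover have "k \<noteq> e" using jk e w \<open>j \<noteq> e\<close> by (auto simp: image_iff)
      ultimately show ?thesis using cont[of j k] jk yj by auto
    qed
    have 4: "u' j l = (\<Sum>k | k \<in> insert e E \<and> fst k = snd j. u' k 0)" if j: "j \<in> insert e E" for j
    proof (cases "j = e")
      case True
      thus ?thesis unfolding True e(2) out_x by (simp add: u'_def evp)
    next
      case False
      hence sj: "snd j \<noteq> w" using j w by (auto simp: image_iff)
      show ?thesis unfolding out[OF sj] sumE using kirch[of j] j False u'j[of j] by auto
    qed
    have 5: "y k 0 = a" if "k \<in> insert e E" "fst k = w" for k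
      using a[of k] that ye[OF lx(1)] yj[of k] at by (cases "k = e") (auto simp: evp)
    have 6: "b + tr21 l (q e) z * t = (\<Sum>k | k \<in> insert e E \<and> fst k = w. u' k 0)"
      unfolding out_w using fin eE sumE[of w] b by (simp add: u'_def evp)
    show "s \<in> branch_solutions l q z (insert e E) w"
      unfolding s y_def[symmetric] branch_solutions_def using 1 2 3 4 5 6 by blast
  qed
qed

lemma sol_space_eq_branch_solutions:
  assumes "ordered w es" "\<And>e. e \<in> edges es \<Longrightarrow> edge_potential l (q e)"
  shows "sol_space l q z es = branch_solutions l q z (edges es) w"
  using assms
proof (induction w es rule: ordered.induct)
  case (1 w)
  show ?case by (simp add: branch_solutions_empty)
next
  case (2 w e es)
  have "branch_solutions l q z (insert e (edges es)) w =
     {(y + on_edge l e (fst (evp l (q e) a b z)), tr11 l (q e) z * a + tr12 l (q e) z * b,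
        tr21 l (q e) z * a + tr22 l (q e) z * b) |y a b. (y, a, b) \<in> branch_solutions l q z (edges es) (snd e)}"
    using 2 by (intro branch_solutions_stalk) (auto simp: vertices_def)
  thus ?case using 2 by simp
next
  case (3 w e es)
  have "branch_solutions l q z (insert e (edges es)) w =
     {(y + on_edge l e (fst (evp l (q e) t 0 z)), a, b + tr21 l (q e) z * t) |y a b t.
        (y, a, b) \<in> branch_solutions l q z (edges es) w \<and> a = tr11 l (q e) z * t}"
    using 3 ordered_root[of w es] by (intro branch_solutions_pendant[where x = "snd e"]) (auto simp: vertices_def)
  thus ?case using 3 by simp
qed

lemma L2_imp_edge_potential:
  assumes l: "0 < l" and f: "L2 l f"
  shows "edge_potential l f"
proof
  show "0 < l" by (rule l)
  have "set_integrable lebesgue {0<..<l} (\<lambda>x. 1 + (f x)\<^sup>2)"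
    using f by (intro set_integral_add) (auto simp: L2_def)
  moreover have "\<bar>t\<bar> \<le> 1 + t\<^sup>2" for t :: real
  proof -
    have "0 \<le> (\<bar>t\<bar> - 1)\<^sup>2" by simp
    hence "2 * \<bar>t\<bar> \<le> 1 + t\<^sup>2" by (simp add: power2_diff)
    thus ?thesis using abs_ge_zero[of t] by linarith
  qed
  ultimately have "f absolutely_integrable_on {0<..<l}"
    using f by (intro set_integrable_bound[of lebesgue "{0<..<l}" "\<lambda>x. 1 + (f x)\<^sup>2" f]) (auto simp: L2_def)
  thus "f absolutely_integrable_on {0..l}"
    using absolutely_integrable_on_open_interval[where f = f and a = 0 and b = l] by simp
qed

text \<open>The list begins with a stalk edge, so exactly one edge leaves the root, and the boundary
  data of the whole tree are value and derivative on it. The separate condition for pendant vertices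
  is absorbed by the empty sum.\<close>

lemma eigenspaces_presented:
  assumes wf: "pair_wf_digraph G" and p: "presents G r es" and es: "es \<noteq> []" "fst (hd es)"
  shows "neumann_eigenspace G r l q z = {y. \<exists>a. (y, a, 0) \<in> branch_solutions l q z (edges es) r}"
    and "dirichlet_eigenspace G r l q z = {y. \<exists>b. (y, 0, b) \<in> branch_solutions l q z (edges es) r}"
proof -
  let ?E = "edges es"
  note E = presents_tree_edges[OF wf p]
  obtain e fs where e: "es = (True, e) # fs" using es by (cases es) auto
  have ord: "ordered r es" using p by (simp add: presents_def)
  have ke: "k = e" if "k \<in> ?E" "fst k = r" for k
  proof (rule ccontr)
    assume "k \<noteq> e"
    hence "k \<in> edges fs" using that(1) by (simp add: e)
    hence "r \<in> vertices fs" using edges_in_vertices(1)[of k fs] that(2) by simp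
    thus False using ord by (simp add: e)
  qed
  have er: "e \<in> ?E" "fst e = r" using ord by (simp_all add: e)
  have root: "{k \<in> ?E. fst k = r} = {e}" using ke er by blast
  have root': "fst k = r \<longleftrightarrow> k = e" if "k \<in> ?E" for k using ke[OF that] er(2) by blast
  have vc: "vertex_conditions G r l y y' \<longleftrightarrow> (\<forall>j\<in>?E. (\<forall>k\<in>?E. fst k = snd j \<longrightarrow> y j l = y k 0) \<and>
      y' j l = (\<Sum>k | k \<in> ?E \<and> fst k = snd j. y' k 0))" for y y'
  proof -
    have "(if out_degree (with_proj G) (snd j) = 1 then y' j l = 0
        else (\<forall>k\<in>?E. fst k = snd j \<longrightarrow> y j l = y k 0) \<and> y' j l = (\<Sum>k | k \<in> ?E \<and> fst k = snd j. y' k 0))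
      \<longleftrightarrow> (\<forall>k\<in>?E. fst k = snd j \<longrightarrow> y j l = y k 0) \<and> y' j l = (\<Sum>k | k \<in> ?E \<and> fst k = snd j. y' k 0)" if "j \<in> ?E" for j
    proof (cases "{k \<in> ?E. fst k = snd j} = {}")
      case True
      have d: "out_degree (with_proj G) (snd j) = 1" using presents_out_degree[OF p that] True by simp
      have s: "(\<Sum>k | k \<in> ?E \<and> fst k = snd j. y' k 0) = 0" unfolding True by simp
      have "\<forall>k\<in>?E. fst k = snd j \<longrightarrow> y j l = y k 0" using True by blast
      thus ?thesis unfolding d s by simp
    next
      case False
      hence "out_degree (with_proj G) (snd j) \<noteq> 1" using presents_out_degree[OF p that] by simp
      thus ?thesis by simp
    qed
    thus ?thesis unfolding vertex_conditions_def E by blast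
  qed
  have ts: "tree_solution G r l q z y y' \<longleftrightarrow> (\<forall>j\<in>?E. sturm_liouville_solution l (q j) z (y j) (y' j)) \<and>
      (\<forall>j x. j \<notin> ?E \<or> x \<notin> {0..l} \<longrightarrow> y j x = 0) \<and>
      (\<forall>j\<in>?E. (\<forall>k\<in>?E. fst k = snd j \<longrightarrow> y j l = y k 0) \<and> y' j l = (\<Sum>k | k \<in> ?E \<and> fst k = snd j. y' k 0))" for y y'
    unfolding tree_solution_def vc E by blast
  have br: "(y, a, b) \<in> branch_solutions l q z ?E r \<longleftrightarrow> (\<exists>y'. tree_solution G r l q z y y' \<and> y e 0 = a \<and> b = y' e 0)" for y a b
  proof -
    have "(\<forall>k\<in>?E. fst k = r \<longrightarrow> y k 0 = a) \<longleftrightarrow> y e 0 = a" using root' er by auto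
    moreover have "(\<Sum>k | k \<in> ?E \<and> fst k = r. y' k 0) = y' e 0" for y' :: "'a \<times> 'a \<Rightarrow> real \<Rightarrow> complex"
      unfolding root by simp
    ultimately show ?thesis unfolding branch_solutions_def ts by simp
  qed
  have rt: "(\<forall>j\<in>?E. fst j = r \<longrightarrow> P j) \<longleftrightarrow> P e" for P using root' er by auto
  show "neumann_eigenspace G r l q z = {y. \<exists>a. (y, a, 0) \<in> branch_solutions l q z ?E r}"
    unfolding neumann_eigenspace_def E rt br by auto
  show "dirichlet_eigenspace G r l q z = {y. \<exists>b. (y, 0, b) \<in> branch_solutions l q z ?E r}"
    unfolding dirichlet_eigenspace_def E rt br by auto
qed

theorem mainTheorem1:
  fixes l :: real
    and T :: "'a pair_pre_digraph" and r :: 'a and q :: "'a \<times> 'a \<Rightarrow> real \<Rightarrow> real"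
    and T' :: "'b pair_pre_digraph" and r' :: 'b and q' :: "'b \<times> 'b \<Rightarrow> real \<Rightarrow> real"
  assumes "0 < l"
    and "rooted_caterpillar T r" and "rooted_caterpillar T' r'"
    and "\<And>j. j \<in> tree_edges T r \<Longrightarrow> L2 l (q j)"
    and "\<And>j. j \<in> tree_edges T' r' \<Longrightarrow> L2 l (q' j)"
    and "neumann_spectrum T r l q = neumann_spectrum T' r' l q'"
    and "dirichlet_spectrum T r l q = dirichlet_spectrum T' r' l q'"
  shows "digraph_iso (with_proj T) (with_proj T')"
proof -
  have wf: "pair_wf_digraph T" "pair_wf_digraph T'"
    using assms(2,3) by (auto simp: rooted_caterpillar_def caterpillar_def undirected_tree_def
        pair_graph_def pair_digraph_def pair_fin_digraph_def)
  obtain es where es: "presents T r es" "es \<noteq> []" "fst (hd es)" "fst (last es)"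
    using rooted_caterpillar_presents[OF assms(2)] by blast
  obtain es' where es': "presents T' r' es'" "es' \<noteq> []" "fst (hd es')" "fst (last es')"
    using rooted_caterpillar_presents[OF assms(3)] by blast
  have ord: "ordered r es" "ordered r' es'" using es(1) es'(1) by (auto simp: presents_def)
  have ep: "edge_potential l (q e)" if "e \<in> edges es" for e
    using L2_imp_edge_potential[OF assms(1) assms(4)] presents_tree_edges[OF wf(1) es(1)] that by simp
  have ep': "edge_potential l (q' e)" if "e \<in> edges es'" for e
    using L2_imp_edge_potential[OF assms(1) assms(5)] presents_tree_edges[OF wf(2) es'(1)] that by simp
  have d: "distinct (map snd es)" "distinct (map snd es')"
    using ordered_distinct[OF ord(1)] ordered_distinct[OF ord(2)]
    by (auto simp: distinct_map inj_on_def)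
  have "map fst es = map fst es'"
  proof (rule shape_determined[OF assms(1) es(2-4) d(1) _ es'(2-4) d(2)])
    show "edge_potential l (q e)" if "e \<in> snd ` set es" for e using ep that by (simp add: edges_def)
    show "edge_potential l (q' e)" if "e \<in> snd ` set es'" for e using ep' that by (simp add: edges_def)
    fix z
    show "family.dim {y. \<exists>b. (y, 0, b) \<in> sol_space l q z es} = family.dim {y. \<exists>b. (y, 0, b) \<in> sol_space l q' z es'}"
      using fun_cong[OF assms(7), of z]
      unfolding dirichlet_spectrum_def eigenspaces_presented(2)[OF wf(1) es(1-3)] eigenspaces_presented(2)[OF wf(2) es'(1-3)]
      by (simp add: sol_space_eq_branch_solutions[OF ord(1) ep] sol_space_eq_branch_solutions[OF ord(2) ep'])
    show "family.dim {y. \<exists>a. (y, a, 0) \<in> sol_space l q z es} = family.dim {y. \<exists>a. (y, a, 0) \<in> sol_space l q' z es'}"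
      using fun_cong[OF assms(6), of z]
      unfolding neumann_spectrum_def eigenspaces_presented(1)[OF wf(1) es(1-3)] eigenspaces_presented(1)[OF wf(2) es'(1-3)]
      by (simp add: sol_space_eq_branch_solutions[OF ord(1) ep] sol_space_eq_branch_solutions[OF ord(2) ep'])
  qed
  thus ?thesis using presents_isomorphic[OF wf(1) es(1) es'(1)] by blast
qed

end
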